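(* Let $\alpha\in(0,1)$ and let $(X_t)_{t\ge0}$ be a strictly $\alpha$-stable Lévy process with no negative jumps (so $X$ is an $\alpha$-stable subordinator), with laws $(\mathbb{P}_x)_{x\in\mathbb{R}}$, $\mathbb{P}_x(X_0=x)=1$. Let $T_{[-1,1]}=\inf\{t\ge 0: X_t\in[-1,1]\}$. Define $h:\mathbb{R}\setminus[-1,1]\to[0,\infty)$ by $$h(x)=\begin{cases}1 & \text{if } x>1,\\[2pt] 1-\dfrac{\sin(\pi\alpha)}{\pi}\displaystyle\int_0^{\frac{2}{-1-x}} t^{-\alpha}(1+t)^{-1}\,\mathrm{d}t & \text{if } x<-1.\end{cases}$$ Then $h$ is invariant for the process killed on entering $[-1,1]$, i.e. $$\mathbb{E}_x\big[\mathbf{1}_{\{t<T_{[-1,1]}\}}\,h(X_t)\big]=h(x)\qquad\text{for all } x\in\mathbb{R}\setminus[-1,1],\ t\ge0.$$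
   Context: A stable process with index $\alpha$ is a Lévy process satisfying the scaling property: for all $c>0$ and $x\in\mathbb{R}$, $((cX_{c^{-\alpha}t})_{t\ge0},\mathbb{P}_x)$ has the same law as $((X_t)_{t\ge0},\mathbb{P}_{cx})$. "No negative jumps" means its Lévy measure is supported on $(0,\infty)$; for $\alpha\in(0,1)$ such a process is a (pure-jump, driftless) subordinator with positivity parameter $\rho=\mathbb{P}_0(X_1\ge0)=1$. *)

theory Defs
  imports "HOL-Probability.Probability"
begin

text \<open>A real-valued Levy process started at 0 on a probability space M, indexed by time t \<ge> 0
  (values of X at negative times are irrelevant).  Under P_x the process is x + X.\<close>

definition levy_process :: "'a measure \<Rightarrow> (real \<Rightarrow> 'a \<Rightarrow> real) \<Rightarrow> bool" where
  "levy_process M X \<longleftrightarrow>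
     prob_space M \<and>
     (\<forall>t. X t \<in> borel_measurable M) \<and>
     (AE \<omega> in M. X 0 \<omega> = 0) \<and>
     (\<forall>n (ts :: nat \<Rightarrow> real). 0 \<le> ts 0 \<and> (\<forall>i. ts i \<le> ts (Suc i)) \<longrightarrow>
        prob_space.indep_vars M (\<lambda>_. borel) (\<lambda>i \<omega>. X (ts (Suc i)) \<omega> - X (ts i) \<omega>) {..<n}) \<and>
     (\<forall>s t. 0 \<le> s \<and> 0 \<le> t \<longrightarrow>
        distr M borel (\<lambda>\<omega>. X (s + t) \<omega> - X s \<omega>) = distr M borel (X t)) \<and>
     (AE \<omega> in M. (\<forall>t\<ge>0. continuous (at_right t) (\<lambda>s. X s \<omega>)) \<and>
                  (\<forall>t>0. \<exists>l. ((\<lambda>s. X s \<omega>) \<longlongrightarrow> l) (at_left t)))"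

definition stable_process :: "'a measure \<Rightarrow> real \<Rightarrow> (real \<Rightarrow> 'a \<Rightarrow> real) \<Rightarrow> bool" where
  "stable_process M \<alpha> X \<longleftrightarrow>
     levy_process M X \<and>
     (\<forall>c>0. \<forall>n (ts :: nat \<Rightarrow> real). (\<forall>i. 0 \<le> ts i) \<longrightarrow>
        distr M (PiM {..<n} (\<lambda>_. borel)) (\<lambda>\<omega>. \<lambda>i\<in>{..<n}. c * X (c powr (-\<alpha>) * ts i) \<omega>)
        = distr M (PiM {..<n} (\<lambda>_. borel)) (\<lambda>\<omega>. \<lambda>i\<in>{..<n}. X (ts i) \<omega>))"

definition no_negative_jumps :: "'a measure \<Rightarrow> (real \<Rightarrow> 'a \<Rightarrow> real) \<Rightarrow> bool" where
  "no_negative_jumps M X \<longleftrightarrow>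
     (AE \<omega> in M. \<forall>t>0. \<forall>l. ((\<lambda>s. X s \<omega>) \<longlongrightarrow> l) (at_left t) \<longrightarrow> l \<le> X t \<omega>)"

text \<open>First hitting time of [-1,1] for the process started at x (i.e. x + X); Inf {} = \<infinity>.\<close>

definition hit_time :: "(real \<Rightarrow> 'a \<Rightarrow> real) \<Rightarrow> real \<Rightarrow> 'a \<Rightarrow> ereal" where
  "hit_time X x \<omega> = Inf (ereal ` {s. 0 \<le> s \<and> x + X s \<omega> \<in> {-1..1}})"

text \<open>The function h (its value on [-1,1] is irrelevant and set to 0).\<close>

definition h_inv :: "real \<Rightarrow> real \<Rightarrow> real" where
  "h_inv \<alpha> x =
     (if x > 1 then 1
      else if x < -1 then
        1 - sin (pi * \<alpha>) / pi * (LBINT s:{0..2 / (-1 - x)}. s powr (-\<alpha>) / (1 + s))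
      else 0)"

end

theory Submission
  imports Defs
begin

text \<open>
  Since \<open>\<alpha> < 1\<close>, the increments of \<open>X\<close> over a fine grid, truncated at a small height \<open>\<epsilon>\<close>, have total
  mean of order \<open>\<epsilon> powr (1 - \<alpha>)\<close>; as there are no negative jumps, the decrements over a fine
  enough grid are all below \<open>\<epsilon>\<close>, so by Fatou's lemma \<open>X\<close> is nondecreasing.  Its Laplace transform is
  \<open>exp (- c t q powr \<alpha>)\<close> by scaling.

  Let \<open>V\<^sub>a\<close> be the value of \<open>X\<close> at the first passage over \<open>a = -1 - x > 0\<close>.  For the walk on a grid of
  mesh \<open>d\<close>, summing over the step that crosses \<open>a\<close> gives
  \<open>\<integral> exp (- a) E exp (- p (V\<^sub>a - a)) da\<close> explicitly; letting \<open>d \<rightarrow> 0\<close> and using that \<open>V\<^sub>a / a\<close> has the law of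
  \<open>V\<^sub>1\<close> this becomes \<open>E (1 / (1 + p (V\<^sub>1 - 1))) = (1 - p powr \<alpha>) / (1 - p)\<close>.  Expanding in powers of
  \<open>1 - p\<close> yields all moments of \<open>1 - a / V\<^sub>a\<close>, which are those of the Beta law with parameters
  \<open>1 - \<alpha>\<close> and \<open>\<alpha>\<close>; hence \<open>h\<close> at \<open>x < -1\<close> is the probability \<open>P (V\<^sub>a > a + 2)\<close> of never hitting the
  interval, and its invariance is the Markov property at time \<open>t\<close>.
\<close>

section \<open>Cadlag paths and first passage\<close>

text \<open>The definitions speak of finite-dimensional laws and of paths, not of a Levy measure, so
  monotonicity has to be extracted from scaling and path regularity. Independence, too, is given at
  deterministic times. The crossing of a level is therefore decomposed over the steps of a
  deterministic grid, and the future after \<open>t\<close> is tested at finitely many grid times.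
  Such a test can miss a path that touches the right end of the interval at a single instant, so the
  passage value must be shown to have no atom there. The weight exp (- a), combined with scaling,
  collapses a double transform in level and overshoot to a one-parameter Stieltjes transform, and
  the unknown speed \<open>rate\<close> cancels in the limit. The constant sin (pi * \<alpha>) / pi
  is 1 / Beta (1 - \<alpha>) \<alpha>, and the integral in \<open>h_inv\<close> is the Beta
  distribution function after w = s / (1 + s). The hypotheses also admit the zero process, which
  never passes a positive level; it is treated apart, \<open>h_inv\<close> being invariant because
  nothing moves.\<close>

lemma cadlag_small_decrement:
  fixes f :: "real \<Rightarrow> real"
  assumes rc: "\<And>t. 0 \<le> t \<Longrightarrow> continuous (at_right t) f"
    and ll: "\<And>t. 0 < t \<Longrightarrow> \<exists>l. (f \<longlongrightarrow> l) (at_left t)"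
    and nj: "\<And>t l. 0 < t \<Longrightarrow> (f \<longlongrightarrow> l) (at_left t) \<Longrightarrow> l \<le> f t"
    and e: "0 < e"
  shows "\<exists>\<eta>>0. \<forall>s u. 0 \<le> s \<and> s \<le> u \<and> u \<le> T \<and> u \<le> s + \<eta> \<longrightarrow> f s - f u < e"
proof -
  have "\<exists>d>0. \<forall>s u. 0 \<le> s \<and> t - d < s \<and> s \<le> u \<and> u < t + d \<longrightarrow> f s - f u < e" if t: "0 \<le> t" for t
  proof -
    from rc[OF t] have "(f \<longlongrightarrow> f t) (at_right t)" by (simp add: continuous_within)
    from tendstoD[OF this, of "e/3"] e obtain b where b: "b > t"
      "\<And>y. t < y \<Longrightarrow> y < b \<Longrightarrow> \<bar>f y - f t\<bar> < e/3"
      by (auto simp: eventually_at_right_field dist_real_def)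
    have b': "\<bar>f y - f t\<bar> < e/3" if "t \<le> y" "y < b" for y
      using b(2)[of y] that e by (cases "y = t") auto
    show ?thesis
    proof (cases "t = 0")
      case True
      show ?thesis
      proof (intro exI conjI allI impI)
        show "b > 0" using b True by simp
        fix s u assume "0 \<le> s \<and> t - b < s \<and> s \<le> u \<and> u < t + b"
        then have "t \<le> s" "s < b" "t \<le> u" "u < b" using True by linarith+
        then have "\<bar>f s - f t\<bar> < e/3" "\<bar>f u - f t\<bar> < e/3" using b' by blast+
        then show "f s - f u < e" by linarith
      qed
    next
      case False
      with t have t0: "0 < t" by simp
      obtain l where l: "(f \<longlongrightarrow> l) (at_left t)" using ll[OF t0] by blast
      have lt: "l \<le> f t" using nj[OF t0 l] .
      from tendstoD[OF l, of "e/3"] e obtain c where c: "c < t"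
        "\<And>y. c < y \<Longrightarrow> y < t \<Longrightarrow> \<bar>f y - l\<bar> < e/3"
        by (auto simp: eventually_at_left_field dist_real_def)
      show ?thesis
      proof (intro exI conjI allI impI)
        show "min (b - t) (t - c) > 0" using b c by simp
        fix s u assume su: "0 \<le> s \<and> t - min (b - t) (t - c) < s \<and> s \<le> u \<and> u < t + min (b - t) (t - c)"
        then have r: "c < s" "c < u" "s < b" "u < b" by auto
        have S: "\<bar>f s - f t\<bar> < e/3" if "s \<ge> t" using b'[OF that r(3)] .
        have S': "\<bar>f s - l\<bar> < e/3" if "s < t" using c(2)[OF r(1) that] .
        have U: "\<bar>f u - f t\<bar> < e/3" if "u \<ge> t" using b'[OF that r(4)] .
        have U': "\<bar>f u - l\<bar> < e/3" if "u < t" using c(2)[OF r(2) that] .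
        show "f s - f u < e"
        proof (cases "s < t")
          case s: True
          have "\<bar>f s - l\<bar> < e/3" by (rule S'[OF s])
          \<comment> \<open>On either side of \<open>t\<close>, \<open>f u\<close> is not far below
            the left limit: before \<open>t\<close> by closeness to \<open>l\<close>, from
            \<open>t\<close> on because the jump at \<open>t\<close> goes up.\<close>
          moreover have "f u > l - e/3"
          proof (cases "u < t")
            case True
            from U'[OF True] show ?thesis by linarith
          next
            case False
            then have "t \<le> u" by simp
            from U[OF this] lt show ?thesis by linarith
          qed
          ultimately show ?thesis using e by linarith
        next
          case False
          then have "t \<le> s" "t \<le> u" using su by auto
          from S[OF this(1)] U[OF this(2)] show ?thesis using e by linarith
        qed
      qed
    qed
  qed
  then obtain d where d: "\<And>t. 0 \<le> t \<Longrightarrow> d t > 0"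
    "\<And>t s u. 0 \<le> t \<Longrightarrow> 0 \<le> s \<Longrightarrow> t - d t < s \<Longrightarrow> s \<le> u \<Longrightarrow> u < t + d t \<Longrightarrow> f s - f u < e"
    by metis
  have "{0..T} \<subseteq> \<Union>((\<lambda>t. ball t (d t)) ` {0..T})" using d(1) by force
  \<comment> \<open>A Lebesgue number of the cover makes the local widths \<open>d t\<close>
    uniform: each \<open>s\<close> shares one good ball with all points within \<epsilon> of
    it.\<close>
  then obtain \<epsilon> where \<epsilon>: "0 < \<epsilon>" "\<And>x. x \<in> {0..T} \<Longrightarrow> \<exists>G \<in> (\<lambda>t. ball t (d t)) ` {0..T}. ball x \<epsilon> \<subseteq> G"
    by (rule Heine_Borel_lemma[rotated]) auto
  show ?thesis
  proof (intro exI conjI allI impI)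
    show "\<epsilon>/2 > 0" using \<epsilon> by simp
    fix s u assume su: "0 \<le> s \<and> s \<le> u \<and> u \<le> T \<and> u \<le> s + \<epsilon>/2"
    then obtain t where t: "t \<in> {0..T}" "ball s \<epsilon> \<subseteq> ball t (d t)" using \<epsilon>(2)[of s] by auto
    have "s \<in> ball s \<epsilon>" "u \<in> ball s \<epsilon>" using su \<epsilon> by (auto simp: dist_real_def)
    with t(2) have "s \<in> ball t (d t)" "u \<in> ball t (d t)" by blast+
    then have "t - d t < s" "u < t + d t" by (auto simp: dist_real_def)
    then show "f s - f u < e" using d(2)[of t s u] t su by auto
  qed
qed

text \<open>Compactness again: near each time the path is close to its value or to its left limit
  there. In \<open>tail_bound\<close> this provides a height below which |X| stays on [0,1] with
  probability above 1/2.\<close>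

lemma cadlag_bounded:
  fixes f :: "real \<Rightarrow> real"
  assumes rc: "\<And>t. 0 \<le> t \<Longrightarrow> continuous (at_right t) f"
    and ll: "\<And>t. 0 < t \<Longrightarrow> \<exists>l. (f \<longlongrightarrow> l) (at_left t)"
  shows "\<exists>B. \<forall>t. 0 \<le> t \<and> t \<le> T \<longrightarrow> \<bar>f t\<bar> \<le> B"
proof -
  have "\<exists>d>0. \<exists>B. \<forall>s. 0 \<le> s \<and> s \<in> ball t d \<longrightarrow> \<bar>f s\<bar> \<le> B" if t: "0 \<le> t" for t
  proof -
    from rc[OF t] have "(f \<longlongrightarrow> f t) (at_right t)" by (simp add: continuous_within)
    from tendstoD[OF this, of 1] obtain b where b: "b > t"
      "\<And>y. t < y \<Longrightarrow> y < b \<Longrightarrow> \<bar>f y - f t\<bar> < 1"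
      by (auto simp: eventually_at_right_field dist_real_def)
    have b': "\<bar>f y - f t\<bar> < 1" if "t \<le> y" "y < b" for y
      using b(2)[of y] that by (cases "y = t") auto
    show ?thesis
    proof (cases "t = 0")
      case True
      show ?thesis
      proof (intro exI conjI allI impI)
        show "b > 0" using b True by simp
        fix s assume s: "0 \<le> s \<and> s \<in> ball t b"
        then have "dist t s < b" by (simp only: mem_ball)
        then have "s < b" unfolding dist_real_def True by linarith
        moreover have "t \<le> s" using s True by simp
        ultimately have "\<bar>f s - f t\<bar> < 1" by (intro b')
        then show "\<bar>f s\<bar> \<le> \<bar>f t\<bar> + 1" by linarith
      qed
    next
      case False
      with t have t0: "0 < t" by simp
      obtain l where l: "(f \<longlongrightarrow> l) (at_left t)" using ll[OF t0] by blast
      from tendstoD[OF l, of 1] obtain c where c: "c < t"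
        "\<And>y. c < y \<Longrightarrow> y < t \<Longrightarrow> \<bar>f y - l\<bar> < 1"
        by (auto simp: eventually_at_left_field dist_real_def)
      show ?thesis
      proof (intro exI conjI allI impI)
        show "min (b - t) (t - c) > 0" using b c by simp
        fix s assume su: "0 \<le> s \<and> s \<in> ball t (min (b - t) (t - c))"
        have "dist t s < b - t" "dist t s < t - c" using su by auto
        then have r: "s < b" "c < s" unfolding dist_real_def by linarith+
        show "\<bar>f s\<bar> \<le> \<bar>f t\<bar> + \<bar>l\<bar> + 1"
        proof (cases "s < t")
          case True
          from c(2)[OF r(2) True] show ?thesis by linarith
        next
          case False
          then have "t \<le> s" by simp
          from b'[OF this r(1)] show ?thesis by linarith
        qed
      qed
    qed
  qed
  then have "\<forall>t. \<exists>d. 0 \<le> t \<longrightarrow> d > 0 \<and> (\<exists>B. \<forall>s. 0 \<le> s \<and> s \<in> ball t d \<longrightarrow> \<bar>f s\<bar> \<le> B)" by blast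
  from choice[OF this] obtain d where d1: "\<forall>t. 0 \<le> t \<longrightarrow> d t > 0 \<and>
    (\<exists>B. \<forall>s. 0 \<le> s \<and> s \<in> ball t (d t) \<longrightarrow> \<bar>f s\<bar> \<le> B)" ..
  then have "\<forall>t. \<exists>B. 0 \<le> t \<longrightarrow> (\<forall>s. 0 \<le> s \<and> s \<in> ball t (d t) \<longrightarrow> \<bar>f s\<bar> \<le> B)" by blast
  from choice[OF this] obtain B where B: "\<forall>t. 0 \<le> t \<longrightarrow>
    (\<forall>s. 0 \<le> s \<and> s \<in> ball t (d t) \<longrightarrow> \<bar>f s\<bar> \<le> B t)" ..
  have "{0..T} \<subseteq> (\<Union>t\<in>{0..T}. ball t (d t))"
  proof
    fix t assume t: "t \<in> {0..T}"
    then have "t \<in> ball t (d t)" using d1 by simp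
    with t show "t \<in> (\<Union>t\<in>{0..T}. ball t (d t))" by (rule UN_I)
  qed
  then obtain C where C: "C \<subseteq> {0..T}" "finite C" "{0..T} \<subseteq> (\<Union>t\<in>C. ball t (d t))"
    by (rule compactE_image[OF compact_Icc, rotated]) auto
  have "\<bar>f t\<bar> \<le> (\<Sum>c\<in>C. \<bar>B c\<bar>)" if "0 \<le> t" "t \<le> T" for t
  proof -
    have "t \<in> {0..T}" using that by simp
    with C(3) have "t \<in> (\<Union>t\<in>C. ball t (d t))" by blast
    then obtain c where c: "c \<in> C" "t \<in> ball c (d c)" by blast
    moreover have "0 \<le> c" using c C(1) by auto
    ultimately have "\<bar>f t\<bar> \<le> B c" using B that by blast
    then have "\<bar>f t\<bar> \<le> \<bar>B c\<bar>" by linarith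
    also have "\<dots> \<le> (\<Sum>c\<in>C. \<bar>B c\<bar>)" using c C by (intro member_le_sum) auto
    finally show ?thesis .
  qed
  then show ?thesis by blast
qed

section \<open>First passage of a nondecreasing right-continuous path, in continuous time and along
  a grid\<close>

definition subordinator_path :: "(real \<Rightarrow> real) \<Rightarrow> bool" where
  "subordinator_path F \<longleftrightarrow> F 0 = 0 \<and> mono_on {0..} F \<and>
     (\<forall>t\<ge>0. continuous (at_right t) F) \<and> (\<forall>a. \<exists>t\<ge>0. a \<le> F t)"

text \<open>The real-valued infimum is meaningful because a \<open>subordinator_path\<close> is
  unbounded, which makes the set nonempty for every level.\<close>

definition passage_time :: "(real \<Rightarrow> real) \<Rightarrow> real \<Rightarrow> real" where
  "passage_time F a = Inf {t. 0 \<le> t \<and> a \<le> F t}"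

definition passage_value :: "(real \<Rightarrow> real) \<Rightarrow> real \<Rightarrow> real" where
  "passage_value F a = F (passage_time F a)"

definition grid_passage :: "real \<Rightarrow> (real \<Rightarrow> real) \<Rightarrow> real \<Rightarrow> real" where
  "grid_passage d F a = F (d * real (LEAST n. a \<le> F (d * real n)))"

context
  fixes F :: "real \<Rightarrow> real"
  assumes F: "subordinator_path F"
begin

lemma path_mono: "0 \<le> s \<Longrightarrow> s \<le> t \<Longrightarrow> F s \<le> F t"
  using F by (auto simp: subordinator_path_def mono_on_def)

lemma path_right: "0 \<le> t \<Longrightarrow> (F \<longlongrightarrow> F t) (at_right t)"
  using F by (auto simp: subordinator_path_def continuous_within)

lemma passage_time_nonneg: "0 \<le> passage_time F a"
  unfolding passage_time_def using F by (intro cInf_greatest) (auto simp: subordinator_path_def)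

lemma passage_time_le: "0 \<le> t \<Longrightarrow> a \<le> F t \<Longrightarrow> passage_time F a \<le> t"
  unfolding passage_time_def by (intro cInf_lower bdd_belowI[of _ 0]) auto

lemma le_path_if: assumes "passage_time F a < t" shows "a \<le> F t"
proof -
  have "{t. 0 \<le> t \<and> a \<le> F t} \<noteq> {}" using F by (auto simp: subordinator_path_def)
  from cInf_lessD[OF this] assms obtain s where "0 \<le> s" "a \<le> F s" "s < t"
    by (auto simp: passage_time_def)
  then show ?thesis using path_mono[of s t] by auto
qed

text \<open>Strictly after the passage time the path is at least \<open>a\<close>; right continuity
  carries this to the passage time itself, even when the level is crossed by a jump.\<close>

lemma le_passage_value: "a \<le> passage_value F a"
  unfolding passage_value_def
proof (rule tendsto_lowerbound[OF path_right[OF passage_time_nonneg[of a]]])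
  show "\<forall>\<^sub>F t in at_right (passage_time F a). a \<le> F t"
    by (auto simp: eventually_at_right_field intro!: exI[of _ "passage_time F a + 1"] le_path_if)
qed simp

lemma le_path_iff: "0 \<le> t \<Longrightarrow> a \<le> F t \<longleftrightarrow> passage_time F a \<le> t"
  using passage_time_le[of t a] le_passage_value[of a] path_mono[OF passage_time_nonneg, of a t]
  by (auto simp: passage_value_def)

lemma passage_value_le: "0 \<le> t \<Longrightarrow> a \<le> F t \<Longrightarrow> passage_value F a \<le> F t"
  using le_path_iff[of t a] path_mono[OF passage_time_nonneg, of a t] by (auto simp: passage_value_def)

text \<open>From any time at or above \<open>a\<close> on, a monotone path is at least its first
  passage value, so a visit to [a, b] forces that value to be at most \<open>b\<close>. Hitting an
  interval thus becomes a statement about the overshoot.\<close>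

lemma ex_path_in_iff: "(\<exists>t\<ge>0. a \<le> F t \<and> F t \<le> b) \<longleftrightarrow> passage_value F a \<le> b"
  using passage_value_le[of _ a] le_passage_value[of a] passage_time_nonneg[of a]
  by (fastforce simp: passage_value_def)

lemma ex_grid_time: assumes "0 < d" shows "\<exists>n. a \<le> F (d * real n)"
proof -
  obtain n where "passage_time F a / d \<le> real n" using real_arch_simple by blast
  then have "passage_time F a \<le> d * real n" using assms by (simp add: field_simps)
  then show ?thesis using le_path_iff[of "d * real n" a] assms by auto
qed

lemma grid_passage_ge: "0 < d \<Longrightarrow> a \<le> grid_passage d F a"
  unfolding grid_passage_def using ex_grid_time[of d a] by (rule LeastI_ex)

lemma grid_passage_eq:
  assumes "0 < d" "F (d * real n) < a" "a \<le> F (d * real (Suc n))"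
  shows "grid_passage d F a = F (d * real (Suc n))"
proof -
  have "(LEAST n. a \<le> F (d * real n)) = Suc n"
  proof (rule Least_equality)
    fix m assume m: "a \<le> F (d * real m)"
    show "Suc n \<le> m"
    proof (rule ccontr)
      assume "\<not> Suc n \<le> m"
      then have "F (d * real m) \<le> F (d * real n)" using assms by (intro path_mono) auto
      with m assms show False by simp
    qed
  qed (use assms in simp)
  then show ?thesis by (simp add: grid_passage_def)
qed

lemma grid_passage_bracket:
  assumes "0 < d" "0 < a"
  shows "\<exists>!n. F (d * real n) < a \<and> a \<le> F (d * real (Suc n))"
proof (rule ex_ex1I)
  define N where "N = (LEAST n. a \<le> F (d * real n))"
  have N: "a \<le> F (d * real N)" unfolding N_def using ex_grid_time[OF assms(1)] by (rule LeastI_ex)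
  \<comment> \<open>Since \<open>F 0 = 0 < a\<close>, the first grid time at or above
    \<open>a\<close> is preceded by a grid step.\<close>
  have "N \<noteq> 0" using N assms F by (cases N) (auto simp: subordinator_path_def)
  then obtain n where n: "N = Suc n" by (cases N) auto
  have "\<not> a \<le> F (d * real n)" using not_less_Least[of n "\<lambda>n. a \<le> F (d * real n)"] n N_def by auto
  then show "\<exists>n. F (d * real n) < a \<and> a \<le> F (d * real (Suc n))" using N n by (auto intro!: exI[of _ n])
next
  fix m n assume "F (d * real m) < a \<and> a \<le> F (d * real (Suc m))"
    "F (d * real n) < a \<and> a \<le> F (d * real (Suc n))"
  then have "F (d * real m) < F (d * real (Suc n))" "F (d * real n) < F (d * real (Suc m))" by linarith+
  then have "\<not> Suc n \<le> m" "\<not> Suc m \<le> n"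
    using path_mono[of "d * real (Suc n)" "d * real m"] path_mono[of "d * real (Suc m)" "d * real n"] assms
    by (auto simp del: of_nat_Suc)
  then show "m = n" by simp
qed

text \<open>The grid time of the crossing lies in [T, T + d n) for the passage time T, so it
  approaches T from the right, where the path is continuous.\<close>

lemma grid_passage_tendsto:
  assumes a: "0 < a" and d: "\<And>n. 0 < d n" "d \<longlonglongrightarrow> 0"
  shows "(\<lambda>n. grid_passage (d n) F a) \<longlonglongrightarrow> passage_value F a"
proof (rule tendstoI)
  fix e :: real assume e: "0 < e"
  define T where "T = passage_time F a"
  have T: "0 \<le> T" unfolding T_def by (rule passage_time_nonneg)
  from tendstoD[OF path_right[OF T] e] obtain b where b: "b > T"
    "\<And>y. T < y \<Longrightarrow> y < b \<Longrightarrow> dist (F y) (F T) < e"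
    by (auto simp: eventually_at_right_field)
  have "\<forall>\<^sub>F n in sequentially. d n < b - T" using d(2) b(1) by (intro order_tendstoD) auto
  then show "\<forall>\<^sub>F n in sequentially. dist (grid_passage (d n) F a) (passage_value F a) < e"
  proof eventually_elim
    case (elim n)
    obtain k where k: "F (d n * real k) < a" "a \<le> F (d n * real (Suc k))"
      using grid_passage_bracket[OF d(1) a, of n] by blast
    have "T \<le> d n * real (Suc k)" using k le_path_iff[of "d n * real (Suc k)" a] d(1)[of n] T_def by auto
    moreover have "d n * real k < T" using k le_path_iff[of "d n * real k" a] d(1)[of n] T_def by auto
    then have "d n * real (Suc k) < b" using elim by (simp add: algebra_simps)
    moreover have "grid_passage (d n) F a = F (d n * real (Suc k))"
      using grid_passage_eq[OF d(1) k] .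
    ultimately show ?case using b(2)[of "d n * real (Suc k)"] e
      by (cases "T = d n * real (Suc k)") (auto simp: passage_value_def T_def)
  qed
qed

text \<open>The mesh 1/n shrinks while the horizon n grows, so the grid eventually sees every visit
  to [a, b] that lasts for a positive time. If the passage value is below \<open>b\<close>, right
  continuity makes the visit last; if it equals \<open>b\<close>, the visit may be a single instant,
  which \<open>ne\<close> excludes. \<open>F t < a\<close> ensures that the passage still lies
  ahead.\<close>

lemma grid_avoids_eventually_iff:
  assumes t: "0 \<le> t" "F t < a" and ne: "passage_value F a \<noteq> b"
  shows "\<forall>\<^sub>F n in sequentially. (\<forall>k\<le>n^2. F (t + real k / real n) \<notin> {a..b}) \<longleftrightarrow> b < passage_value F a"
proof (cases "b < passage_value F a")
  case True
  then have *: "\<not> (a \<le> F s \<and> F s \<le> b)" if "0 \<le> s" for s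
    using that ex_path_in_iff[of a b] by auto
  have "F (t + real k / real n) \<notin> {a..b}" for k n using *[of "t + real k / real n"] t(1) by simp
  then show ?thesis using True by simp
next
  case False
  with ne have lt: "passage_value F a < b" by simp
  define T where "T = passage_time F a"
  have T: "0 \<le> T" "t < T" unfolding T_def using passage_time_nonneg le_path_iff[of t a] t by auto
  have "\<forall>\<^sub>F s in at_right T. F s < b"
    using order_tendstoD(2)[OF path_right[OF T(1)], of b] lt by (simp add: T_def passage_value_def)
  then obtain c where c: "c > T" "\<And>y. T < y \<Longrightarrow> y < c \<Longrightarrow> F y < b"
    by (auto simp: eventually_at_right_field)
  \<comment> \<open>From \<open>N\<close> on the mesh is smaller than the visit [T, c) and the
    horizon reaches beyond \<open>c\<close>.\<close>
  obtain N where N: "1 / (c - T) < real N" "c - t < real N" "0 < N"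
    using reals_Archimedean2[of "max 1 (max (1 / (c - T)) (c - t))"] by auto
  have "\<exists>k\<le>n^2. a \<le> F (t + real k / real n) \<and> F (t + real k / real n) \<le> b" if n: "N \<le> n" for n
  proof -
    have n': "1 / (c - T) < real n" "c - t < real n" "0 < real n"
      using N n by (auto intro: less_le_trans[of _ "real N"])
    then have dc: "1 / real n < c - T" using c(1) by (simp add: field_simps)
    \<comment> \<open>Index of the first grid point at or after \<open>T\<close>; it overshoots
      \<open>T\<close> by less than one mesh.\<close>
    define k where "k = nat \<lceil>(T - t) * real n\<rceil>"
    have kr: "real k = of_int \<lceil>(T - t) * real n\<rceil>" unfolding k_def using T n' by simp
    have 1: "(T - t) * real n \<le> real k" "real k < (T - t) * real n + 1" unfolding kr by linarith+
    have "T - t \<le> real k / real n" "real k / real n < T - t + 1 / real n"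
      using 1 n' by (auto simp: field_simps)
    then have 2: "T \<le> t + real k / real n" "t + real k / real n < c" using dc by linarith+
    then have "real k / real n \<le> real n" using n'(2) by linarith
    then have "real k \<le> (real n)^2" using n' by (simp add: field_simps power2_eq_square)
    then have 3: "k \<le> n^2" by (metis of_nat_le_iff of_nat_power)
    have "a \<le> F (t + real k / real n)" using 2 le_path_iff[of "t + real k / real n" a] t n' T_def by auto
    moreover have "F (t + real k / real n) \<le> b"
      using 2 c(2)[of "t + real k / real n"] lt
      by (cases "T = t + real k / real n") (auto simp: T_def passage_value_def)
    ultimately show ?thesis using 3 by blast
  qed
  then show ?thesis using False by (force simp: eventually_sequentially)
qed

end

section \<open>The generalised arcsine law\<close>

text \<open>On [0,1] all moments are at most 1, so a Taylor polynomial of the characteristic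
  function is off by at most 2 |t|^n / n!. The two laws share these polynomials, hence their
  characteristic functions.\<close>

lemma real_distribution_eq_if_moments_eq:
  fixes \<mu> \<nu> :: "real measure"
  assumes "real_distribution \<mu>" "real_distribution \<nu>"
    and bd: "AE x in \<mu>. x \<in> {0..1}" "AE x in \<nu>. x \<in> {0..1}"
    and mom: "\<And>k::nat. (\<integral>x. x ^ k \<partial>\<mu>) = (\<integral>x. x ^ k \<partial>\<nu>)"
  shows "\<mu> = \<nu>"
proof (rule Levy_uniqueness[OF assms(1,2)], rule ext)
  fix t :: real
  have approx: "cmod (char M t - (\<Sum>k \<le> n. ((\<i> * t)^k / fact k) * (\<integral>x. x ^ k \<partial>M))) \<le> 2 * (\<bar>t\<bar>^n / fact n)"
    if M: "real_distribution M" and bd: "AE x in M. x \<in> {0..1}" for M n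
  proof -
    interpret M: real_distribution M by fact
    have pw: "AE x in M. \<bar>x\<bar> ^ k \<le> 1" for k :: nat
      using bd by eventually_elim (auto intro: power_le_one)
    have i: "integrable M (\<lambda>x. x ^ k)" for k :: nat
      using pw[of k] by (intro M.integrable_const_bound[of _ 1]) (simp_all add: power_abs)
    have "(\<integral>x. \<bar>x\<bar> ^ n \<partial>M) \<le> (\<integral>x. 1 \<partial>M)"
      using pw[of n] by (intro integral_mono_AE M.integrable_const_bound[of _ 1]) (simp_all add: power_abs)
    then have "(\<integral>x. \<bar>x\<bar> ^ n \<partial>M) \<le> 1" using M.prob_space by simp
    then have "(2 * \<bar>t\<bar> ^ n / fact n) * (\<integral>x. \<bar>x\<bar> ^ n \<partial>M) \<le> (2 * \<bar>t\<bar> ^ n / fact n) * 1"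
      by (intro mult_left_mono) auto
    with M.char_approx1[of n t, OF i] show ?thesis by simp
  qed
  have "cmod (char \<mu> t - char \<nu> t) \<le> 4 * (\<bar>t\<bar>^n / fact n)" for n
  proof -
    have "cmod (char \<mu> t - char \<nu> t) \<le>
      cmod (char \<mu> t - (\<Sum>k \<le> n. ((\<i> * t)^k / fact k) * (\<integral>x. x ^ k \<partial>\<mu>))) +
      cmod (char \<nu> t - (\<Sum>k \<le> n. ((\<i> * t)^k / fact k) * (\<integral>x. x ^ k \<partial>\<nu>)))"
      using norm_triangle_ineq4[of "char \<mu> t - (\<Sum>k \<le> n. ((\<i> * t)^k / fact k) * (\<integral>x. x ^ k \<partial>\<mu>))"
        "char \<nu> t - (\<Sum>k \<le> n. ((\<i> * t)^k / fact k) * (\<integral>x. x ^ k \<partial>\<nu>))"] mom by simp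
    also have "\<dots> \<le> 2 * (\<bar>t\<bar>^n / fact n) + 2 * (\<bar>t\<bar>^n / fact n)"
      by (intro add_mono approx assms)
    finally show ?thesis by simp
  qed
  moreover have "(\<lambda>n. 4 * (\<bar>t\<bar>^n / fact n)) \<longlonglongrightarrow> 4 * 0"
    using summable_LIMSEQ_zero[OF summable_exp[of "\<bar>t\<bar>"]]
    by (intro tendsto_mult tendsto_const) (simp add: field_simps)
  ultimately have "cmod (char \<mu> t - char \<nu> t) \<le> 4 * 0"
    by (intro LIMSEQ_le_const) auto
  then show "char \<mu> t = char \<nu> t" by simp
qed

text \<open>The sum is known only to the right of 0. Convergence at points of (0,1) beyond |z| gives
  convergence in the open unit disc, so the sum is continuous at 0 and a one-sided limit identifies
  \<open>c 0\<close>.\<close>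

lemma power_series_constant_coeff_zero:
  fixes c :: "nat \<Rightarrow> real"
  assumes c: "\<And>z. 0 < z \<Longrightarrow> z < 1 \<Longrightarrow> (\<lambda>k. c k * z ^ k) sums 0"
  shows "c 0 = 0"
proof -
  have "summable (\<lambda>k. c k * z ^ k)" if "norm z < 1" for z
  proof (rule powser_inside)
    show "summable (\<lambda>k. c k * ((\<bar>z\<bar> + 1)/2) ^ k)"
      using that by (intro sums_summable[OF c]) auto
    show "norm z < norm ((\<bar>z\<bar> + 1)/2)" using that by simp
  qed
  then have "((\<lambda>z. \<Sum>k. c k * z ^ k) \<longlongrightarrow> c 0) (at 0)"
    by (intro powser_limit_0[of 1] summable_sums) simp_all
  then have "((\<lambda>z. \<Sum>k. c k * z ^ k) \<longlongrightarrow> c 0) (at_right 0)"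
    by (rule tendsto_within_subset) simp
  moreover have "\<forall>\<^sub>F z in at_right 0. z < (1::real)"
    by (intro order_tendstoD(2)[OF tendsto_ident_at]) simp
  then have "\<forall>\<^sub>F z in at_right 0. 0 = (\<Sum>k. c k * z ^ k)"
    using eventually_at_right_less[of 0] by eventually_elim (rule sums_unique[OF c])
  then have "((\<lambda>z. \<Sum>k. c k * z ^ k) \<longlongrightarrow> 0) (at_right 0)"
    by (rule Lim_transform_eventually[OF tendsto_const])
  ultimately show ?thesis by (intro tendsto_unique[where F = "at_right (0::real)"]) auto
qed

text \<open>Once the constant coefficient vanishes, dividing by \<open>z\<close> gives a series of
  the same kind with shifted coefficients, so induction on the index applies.\<close>

lemma power_series_unique_right:
  fixes a b :: "nat \<Rightarrow> real"
  assumes a: "\<And>z. 0 < z \<Longrightarrow> z < 1 \<Longrightarrow> (\<lambda>k. a k * z ^ k) sums f z"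
    and b: "\<And>z. 0 < z \<Longrightarrow> z < 1 \<Longrightarrow> (\<lambda>k. b k * z ^ k) sums f z"
  shows "a = b"
proof -
  have zero: "c n = 0" if "\<And>z. 0 < z \<Longrightarrow> z < 1 \<Longrightarrow> (\<lambda>k. c k * z ^ k) sums 0" for c :: "nat \<Rightarrow> real" and n
    using that
  proof (induction n arbitrary: c)
    case 0
    then show ?case by (rule power_series_constant_coeff_zero)
  next
    case (Suc n)
    have c0: "c 0 = 0" by (rule power_series_constant_coeff_zero) (rule Suc.prems)
    show ?case
    proof (rule Suc.IH)
      fix z :: real assume z: "0 < z" "z < 1"
      have "(\<lambda>k. c (Suc k) * z ^ Suc k) sums 0"
        using sums_Suc_iff[of "\<lambda>k. c k * z ^ k" 0] Suc.prems[OF z] c0 by simp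
      then have "(\<lambda>k. (1/z) * (c (Suc k) * z ^ Suc k)) sums ((1/z) * 0)" by (rule sums_mult)
      moreover have "(\<lambda>k. (1/z) * (c (Suc k) * z ^ Suc k)) = (\<lambda>k. c (Suc k) * z ^ k)"
        using z by (simp add: fun_eq_iff)
      ultimately show "(\<lambda>k. c (Suc k) * z ^ k) sums 0" by simp
    qed
  qed
  have "a n - b n = 0" for n
  proof (rule zero[of "\<lambda>k. a k - b k"])
    fix z :: real assume z: "0 < z" "z < 1"
    show "(\<lambda>k. (a k - b k) * z ^ k) sums 0"
      using sums_diff[OF a[OF z] b[OF z]] by (simp add: left_diff_distrib)
  qed
  then show ?thesis by (simp add: fun_eq_iff)
qed

text \<open>The generating function of the moments: a geometric series integrated term by term, with
  \<open>z ^ k\<close> as summable dominating terms.\<close>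

lemma (in prob_space) geometric_moments_sums:
  assumes [measurable]: "W \<in> borel_measurable M" and W: "AE \<omega> in M. 0 \<le> W \<omega> \<and> W \<omega> \<le> 1"
    and z: "0 \<le> z" "z < (1::real)"
  shows "(\<lambda>k. expectation (\<lambda>\<omega>. W \<omega> ^ k) * z ^ k) sums expectation (\<lambda>\<omega>. 1 / (1 - z * W \<omega>))"
proof -
  have bd: "AE \<omega> in M. norm (W \<omega> ^ k * z ^ k) \<le> z ^ k" for k
    using W by eventually_elim (use z in \<open>auto simp: abs_mult power_le_one mult_left_le_one_le\<close>)
  have i: "integrable M (\<lambda>\<omega>. W \<omega> ^ k * z ^ k)" for k
    using bd[of k] by (intro integrable_const_bound[of _ "z ^ k"]) auto
  have le: "(\<integral>\<omega>. norm (W \<omega> ^ k * z ^ k) \<partial>M) \<le> z ^ k" for k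
  proof -
    have "(\<integral>\<omega>. norm (W \<omega> ^ k * z ^ k) \<partial>M) \<le> (\<integral>\<omega>. z ^ k \<partial>M)"
      using bd[of k] i by (intro integral_mono_AE) auto
    then show ?thesis by (simp add: prob_space)
  qed
  have g: "summable (\<lambda>k. z ^ k)" using z by (intro summable_geometric) auto
  have "(\<lambda>k. \<integral>\<omega>. W \<omega> ^ k * z ^ k \<partial>M) sums (\<integral>\<omega>. (\<Sum>k. W \<omega> ^ k * z ^ k) \<partial>M)"
  proof (rule sums_integral[OF i])
    show "AE \<omega> in M. summable (\<lambda>k. norm (W \<omega> ^ k * z ^ k))"
    proof -
      have "AE \<omega> in M. \<forall>k. norm (W \<omega> ^ k * z ^ k) \<le> z ^ k" using bd by (subst AE_all_countable) blast
      then show ?thesis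
      proof eventually_elim
        case (elim \<omega>)
        show ?case by (rule summable_comparison_test'[OF g, of 0]) (use elim in \<open>auto simp del: norm_mult\<close>)
      qed
    qed
    show "summable (\<lambda>k. \<integral>\<omega>. norm (W \<omega> ^ k * z ^ k) \<partial>M)"
      by (rule summable_comparison_test'[OF g, of 0]) (use le in \<open>auto simp: integral_nonneg_AE\<close>)
  qed
  also have "(\<integral>\<omega>. (\<Sum>k. W \<omega> ^ k * z ^ k) \<partial>M) = (\<integral>\<omega>. 1 / (1 - z * W \<omega>) \<partial>M)"
  proof (rule integral_cong_AE)
    show "AE \<omega> in M. (\<Sum>k. W \<omega> ^ k * z ^ k) = 1 / (1 - z * W \<omega>)"
      using W
    proof eventually_elim
      case (elim \<omega>)
      then have "z * W \<omega> \<le> z * 1" using z by (intro mult_left_mono) auto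
      then have "(\<Sum>k. (z * W \<omega>) ^ k) = 1 / (1 - z * W \<omega>)" using z elim by (intro suminf_geometric) auto
      then show ?case by (simp add: power_mult_distrib mult.commute)
    qed
  qed measurable
  finally show ?thesis by simp
qed

section \<open>The Beta law with parameters 1 - \<alpha> and \<alpha>: normalisation, moments and
  tail\<close>

definition arcsine_density :: "real \<Rightarrow> real \<Rightarrow> real" where
  "arcsine_density \<alpha> w = sin (pi * \<alpha>) / pi * (w powr (-\<alpha>) * (1 - w) powr (\<alpha> - 1)) * indicator {0..1} w"

definition arcsine_law :: "real \<Rightarrow> real measure" where
  "arcsine_law \<alpha> = density lborel (\<lambda>w. ennreal (arcsine_density \<alpha> w))"

lemma arcsine_density_measurable [measurable]: "arcsine_density \<alpha> \<in> borel_measurable borel"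
  unfolding arcsine_density_def[abs_def] by measurable

lemma sets_arcsine_law [simp, measurable_cong]: "sets (arcsine_law \<alpha>) = sets borel"
  by (simp add: arcsine_law_def)

lemma space_arcsine_law [simp]: "space (arcsine_law \<alpha>) = UNIV"
  by (simp add: arcsine_law_def)

context
  fixes \<alpha> :: real
  assumes \<alpha>: "0 < \<alpha>" "\<alpha> < 1"
begin

lemma sin_pi_pos: "0 < sin (pi * \<alpha>)"
  using \<alpha> by (intro sin_gt_zero) auto

lemma arcsine_density_nonneg: "0 \<le> arcsine_density \<alpha> w"
  using sin_pi_pos by (simp add: arcsine_density_def)

text \<open>As Gamma 1 = 1, the Beta value is Gamma \<alpha> * Gamma (1 - \<alpha>), which Euler's
  reflection formula evaluates over the complex numbers.\<close>

lemma Beta_reflection: "sin (pi * \<alpha>) / pi * Beta (1 - \<alpha>) \<alpha> = 1"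
proof -
  have "complex_of_real (Gamma \<alpha> * Gamma (1 - \<alpha>)) = complex_of_real (pi / sin (pi * \<alpha>))"
    using Gamma_reflection_complex[of "complex_of_real \<alpha>"]
    by (simp add: Gamma_complex_of_real[symmetric] sin_of_real[symmetric])
  then have "Gamma \<alpha> * Gamma (1 - \<alpha>) = pi / sin (pi * \<alpha>)"
    by (simp only: of_real_eq_iff)
  then show ?thesis using sin_pi_pos by (simp add: Beta_def mult.commute field_simps)
qed

text \<open>Both sides satisfy (k + 1) c(k+1) = (k + 1 - \<alpha>) c(k). The right side is written
  as the coefficient of z^k in the binomial series of (1 - z) powr (\<alpha> - 1), ready for
  comparison with a generating function of moments.\<close>

lemma Beta_moment:
  "sin (pi * \<alpha>) / pi * Beta (real k + 1 - \<alpha>) \<alpha> = (-1) ^ k * ((\<alpha> - 1) gchoose k)"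
proof (induction k)
  case 0
  then show ?case using Beta_reflection by simp
next
  case (Suc k)
  define y where "y = real k + 1 - \<alpha>"
  have y: "0 < y" using \<alpha> by (simp add: y_def add_pos_nonneg)
  have "(y + \<alpha>) * Beta (y + 1) \<alpha> = y * Beta y \<alpha>"
    using y by (intro Beta_plus1_left) (auto dest: nonpos_Ints_nonpos)
  then have *: "(real k + 1) * Beta (real (Suc k) + 1 - \<alpha>) \<alpha> = y * Beta y \<alpha>"
    by (simp add: y_def algebra_simps)
  have "(real k + 1) * (sin (pi * \<alpha>) / pi * Beta (real (Suc k) + 1 - \<alpha>) \<alpha>) =
      sin (pi * \<alpha>) / pi * ((real k + 1) * Beta (real (Suc k) + 1 - \<alpha>) \<alpha>)"
    by (simp only: mult_ac)
  also have "\<dots> = y * (sin (pi * \<alpha>) / pi * Beta y \<alpha>)"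
    unfolding * by (simp only: mult_ac)
  also have "\<dots> = y * ((-1) ^ k * ((\<alpha> - 1) gchoose k))"
    using Suc.IH by (simp only: y_def)
  also have "\<dots> = (-1) ^ Suc k * (((\<alpha> - 1) - real k) * ((\<alpha> - 1) gchoose k))"
    by (simp add: y_def algebra_simps)
  also have "((\<alpha> - 1) - real k) * ((\<alpha> - 1) gchoose k) = (real k + 1) * ((\<alpha> - 1) gchoose Suc k)"
    using gbinomial_mult_1[of "\<alpha> - 1" k] by (simp add: algebra_simps)
  finally have "(real k + 1) * (sin (pi * \<alpha>) / pi * Beta (real (Suc k) + 1 - \<alpha>) \<alpha>) =
      (real k + 1) * ((-1) ^ Suc k * ((\<alpha> - 1) gchoose Suc k))"
    by (simp only: mult_ac)
  then show ?case by (subst (asm) mult_left_cancel) auto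
qed

lemma arcsine_moment_nn:
  "(\<integral>\<^sup>+w. ennreal (w ^ k * arcsine_density \<alpha> w) \<partial>lborel) = ennreal ((-1) ^ k * ((\<alpha> - 1) gchoose k))"
proof -
  let ?f = "\<lambda>t. sin (pi * \<alpha>) / pi * (t powr (real k + 1 - \<alpha> - 1) * (1 - t) powr (\<alpha> - 1))"
  have "(?f has_integral sin (pi * \<alpha>) / pi * Beta (real k + 1 - \<alpha>) \<alpha>) {0..1}"
    using \<alpha> by (intro has_integral_mult_right has_integral_Beta_real) auto
  from nn_integral_has_integral_lebesgue[OF _ this]
  have "(\<integral>\<^sup>+t. ennreal (indicator {0..1} t * ?f t) \<partial>lborel) = ennreal (sin (pi * \<alpha>) / pi * Beta (real k + 1 - \<alpha>) \<alpha>)"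
    using sin_pi_pos by simp
  moreover have "indicator {0..1} t * ?f t = t ^ k * arcsine_density \<alpha> t" for t
  proof (cases "0 < t")
    case True
    have "t powr (real k + 1 - \<alpha> - 1) = t ^ k * t powr (-\<alpha>)"
      using True by (simp add: powr_realpow[symmetric] powr_add[symmetric])
    then show ?thesis by (simp add: arcsine_density_def)
  \<comment> \<open>At \<open>t = 0\<close> both sides vanish because \<open>0 powr _\<close> is 0;
    for negative \<open>t\<close> the indicator does it.\<close>
  qed (auto simp: arcsine_density_def indicator_def)
  ultimately show ?thesis unfolding Beta_moment by simp
qed

lemma real_distribution_arcsine_law: "real_distribution (arcsine_law \<alpha>)"
proof -
  have "emeasure (arcsine_law \<alpha>) UNIV = 1"
    using arcsine_moment_nn[of 0] by (simp add: arcsine_law_def emeasure_density)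
  then have "prob_space (arcsine_law \<alpha>)" by (intro prob_spaceI) simp
  then show ?thesis by (simp add: real_distribution_def real_distribution_axioms_def)
qed

lemma AE_arcsine_law: "AE w in arcsine_law \<alpha>. w \<in> {0..1}"
  unfolding arcsine_law_def by (subst AE_density) (auto simp: arcsine_density_def indicator_def)

lemma arcsine_moment: "(\<integral>w. w ^ k \<partial>arcsine_law \<alpha>) = (-1) ^ k * ((\<alpha> - 1) gchoose k)"
proof -
  have "(\<integral>w. w ^ k \<partial>arcsine_law \<alpha>) = enn2real (\<integral>\<^sup>+w. ennreal (w ^ k) \<partial>arcsine_law \<alpha>)"
    using AE_arcsine_law by (intro integral_eq_nn_integral) (auto elim!: eventually_mono)
  also have "(\<integral>\<^sup>+w. ennreal (w ^ k) \<partial>arcsine_law \<alpha>) =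
      (\<integral>\<^sup>+w. ennreal (arcsine_density \<alpha> w) * ennreal (w ^ k) \<partial>lborel)"
    unfolding arcsine_law_def by (rule nn_integral_density) auto
  also have "\<dots> = (\<integral>\<^sup>+w. ennreal (w ^ k * arcsine_density \<alpha> w) \<partial>lborel)"
    by (intro nn_integral_cong, subst ennreal_mult'[OF arcsine_density_nonneg, symmetric]) (simp only: mult.commute)
  finally show ?thesis
    unfolding arcsine_moment_nn Beta_moment[symmetric]
    using sin_pi_pos \<alpha> by (simp add: Beta_def)
qed

text \<open>Substituting w = s / (1 + s) turns the Beta density into the integrand of
  \<open>h_inv\<close>: the exponents of 1 + s, namely \<alpha> from w, 1 - \<alpha> from 1 - w and
  -2 from the derivative, add up to -1.\<close>

lemma measure_arcsine_law_greater:
  assumes r: "0 \<le> r"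
  shows "measure (arcsine_law \<alpha>) {r / (1 + r)<..} =
    1 - sin (pi * \<alpha>) / pi * (LBINT s:{0..r}. s powr (-\<alpha>) / (1 + s))"
proof -
  interpret real_distribution "arcsine_law \<alpha>" by (rule real_distribution_arcsine_law)
  define g :: "real \<Rightarrow> real" where "g s = s / (1 + s)" for s
  have g: "g 0 = 0" "g r = r / (1 + r)" by (simp_all add: g_def)
  have "emeasure (arcsine_law \<alpha>) {..r / (1 + r)} =
      (\<integral>\<^sup>+w. ennreal (arcsine_density \<alpha> w) * indicator {..r / (1 + r)} w \<partial>lborel)"
    by (simp add: arcsine_law_def emeasure_density)
  \<comment> \<open>The density vanishes to the left of 0 = \<open>g 0\<close>, so the half-line
    shrinks to the image of [0, r].\<close>
  also have "\<dots> = (\<integral>\<^sup>+w. ennreal (arcsine_density \<alpha> w) * indicator {g 0..g r} w \<partial>lborel)"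
    unfolding g by (intro nn_integral_cong) (auto simp: arcsine_density_def split: split_indicator)
  also have "\<dots> = (\<integral>\<^sup>+w. ennreal (arcsine_density \<alpha> w * indicator {g 0..g r} w) \<partial>lborel)"
    by (intro nn_integral_cong) (auto split: split_indicator)
  also have "\<dots> = (\<integral>\<^sup>+s. ennreal (arcsine_density \<alpha> (g s) * (1 / (1 + s)^2) * indicator {0..r} s) \<partial>lborel)"
  proof (rule nn_integral_substitution)
    show "(g has_real_derivative 1 / (1 + s)^2) (at s)" if "s \<in> {0..r}" for s
      using that unfolding g_def[abs_def]
      by (auto intro!: derivative_eq_intros simp: field_simps power2_eq_square)
    show "continuous_on {0..r} (\<lambda>s. 1 / (1 + s)^2)" by (intro continuous_intros) auto
    show "set_borel_measurable borel {g 0..g r} (arcsine_density \<alpha>)"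
      unfolding set_borel_measurable_def by measurable
  qed (use r in auto)
  also have "\<dots> = (\<integral>\<^sup>+s. ennreal (sin (pi * \<alpha>) / pi) * ennreal (indicator {0..r} s * (s powr (-\<alpha>) / (1 + s))) \<partial>lborel)"
  proof (intro nn_integral_cong)
    fix s :: real
    show "ennreal (arcsine_density \<alpha> (g s) * (1 / (1 + s)^2) * indicator {0..r} s) =
      ennreal (sin (pi * \<alpha>) / pi) * ennreal (indicator {0..r} s * (s powr (-\<alpha>) / (1 + s)))"
    proof (cases "0 < s \<and> s \<le> r")
      case True
      then have s: "0 < s" by simp
      have 1: "1 - g s = 1 / (1 + s)" using s by (simp add: g_def field_simps)
      have 2: "g s powr (-\<alpha>) = s powr (-\<alpha>) * (1 + s) powr \<alpha>"
        using s by (simp add: g_def powr_divide powr_minus field_simps)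
      have 3: "(1 - g s) powr (\<alpha> - 1) = (1 + s) / (1 + s) powr \<alpha>"
        using s unfolding 1 by (simp add: powr_divide powr_diff)
      have "(S * P) * ((1 + s) / P) * (1 / (1 + s)^2) = S / (1 + s)" if "0 < P" for S P :: real
        using that s by (simp add: power2_eq_square)
      from this[of "(1 + s) powr \<alpha>" "s powr (-\<alpha>)"] s
      have 4: "(s powr (-\<alpha>) * (1 + s) powr \<alpha>) * ((1 + s) / (1 + s) powr \<alpha>) * (1 / (1 + s)^2) = s powr (-\<alpha>) / (1 + s)"
        by simp
      have "g s \<in> {0..1}" using s by (simp add: g_def)
      then have "arcsine_density \<alpha> (g s) * (1 / (1 + s)^2) = sin (pi * \<alpha>) / pi * (s powr (-\<alpha>) / (1 + s))"
        by (simp only: arcsine_density_def 2 3 4[symmetric] indicator_simps mult.right_neutral mult.assoc)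
      then show ?thesis using True sin_pi_pos by (simp add: ennreal_mult'[symmetric])
    next
      case False
      then show ?thesis by (auto simp: g_def arcsine_density_def split: split_indicator)
    qed
  qed
  also have "\<dots> = ennreal (sin (pi * \<alpha>) / pi) * (\<integral>\<^sup>+s. ennreal (indicator {0..r} s * (s powr (-\<alpha>) / (1 + s))) \<partial>lborel)"
    by (rule nn_integral_cmult) measurable
  finally have "measure (arcsine_law \<alpha>) {..r / (1 + r)} =
      sin (pi * \<alpha>) / pi * enn2real (\<integral>\<^sup>+s. ennreal (indicator {0..r} s * (s powr (-\<alpha>) / (1 + s))) \<partial>lborel)"
    using sin_pi_pos by (simp add: measure_def enn2real_mult)
  also have "enn2real (\<integral>\<^sup>+s. ennreal (indicator {0..r} s * (s powr (-\<alpha>) / (1 + s))) \<partial>lborel) =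
      (LBINT s:{0..r}. s powr (-\<alpha>) / (1 + s))"
    unfolding set_lebesgue_integral_def
    by (subst integral_eq_nn_integral) (auto split: split_indicator)
  finally have "measure (arcsine_law \<alpha>) {..r / (1 + r)} =
      sin (pi * \<alpha>) / pi * (LBINT s:{0..r}. s powr (-\<alpha>) / (1 + s))" .
  moreover have "measure (arcsine_law \<alpha>) (space (arcsine_law \<alpha>) - {..r / (1 + r)}) =
      1 - measure (arcsine_law \<alpha>) {..r / (1 + r)}"
    by (rule prob_compl) simp
  moreover have "space (arcsine_law \<alpha>) - {..r / (1 + r)} = {r / (1 + r)<..}" by auto
  ultimately show ?thesis by simp
qed

text \<open>Serves to rule out that a passage lands exactly on the right end of the
  interval.\<close>

lemma measure_arcsine_law_singleton: "measure (arcsine_law \<alpha>) {w} = 0"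
proof -
  have "emeasure (arcsine_law \<alpha>) {w} = (\<integral>\<^sup>+x. 0 \<partial>lborel)"
    unfolding arcsine_law_def
    by (subst emeasure_density) (auto intro!: nn_integral_cong_AE AE_mp[OF AE_lborel_singleton[of w]] split: split_indicator)
  then show ?thesis by (simp add: measure_def)
qed

end

text \<open>\<open>E\<close> prescribes the generating function of the moments of \<open>W\<close>;
  its binomial expansion has the Beta moments as coefficients, and on [0,1] the moments determine
  the law.\<close>

lemma (in prob_space) distr_eq_arcsine_law:
  assumes \<alpha>: "0 < \<alpha>" "\<alpha> < 1"
    and [measurable]: "W \<in> borel_measurable M" and W: "AE \<omega> in M. 0 \<le> W \<omega> \<and> W \<omega> \<le> 1"
    and E: "\<And>z. 0 < z \<Longrightarrow> z < 1 \<Longrightarrow> expectation (\<lambda>\<omega>. 1 / (1 - z * W \<omega>)) = (1 - z) powr (\<alpha> - 1)"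
  shows "distr M borel W = arcsine_law \<alpha>"
proof (rule real_distribution_eq_if_moments_eq)
  show "real_distribution (distr M borel W)" by simp
  show "real_distribution (arcsine_law \<alpha>)" by (rule real_distribution_arcsine_law[OF \<alpha>])
  show "AE x in distr M borel W. x \<in> {0..1}" using W by (subst AE_distr_iff) auto
  show "AE x in arcsine_law \<alpha>. x \<in> {0..1}" by (rule AE_arcsine_law[OF \<alpha>])
  have "(\<lambda>k. expectation (\<lambda>\<omega>. W \<omega> ^ k)) = (\<lambda>k. (-1) ^ k * ((\<alpha> - 1) gchoose k))"
  proof (rule power_series_unique_right)
    fix z :: real assume z: "0 < z" "z < 1"
    show "(\<lambda>k. expectation (\<lambda>\<omega>. W \<omega> ^ k) * z ^ k) sums (1 - z) powr (\<alpha> - 1)"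
      using geometric_moments_sums[OF _ W, of z] z by (simp add: E)
    show "(\<lambda>k. ((-1) ^ k * ((\<alpha> - 1) gchoose k)) * z ^ k) sums (1 - z) powr (\<alpha> - 1)"
      using gen_binomial_real[of "-z" "\<alpha> - 1"] z by (simp add: power_minus[of z] mult_ac)
  qed
  then show "(\<integral>x. x ^ k \<partial>distr M borel W) = (\<integral>x. x ^ k \<partial>arcsine_law \<alpha>)" for k
    by (simp add: integral_distr arcsine_moment[OF \<alpha>] fun_eq_iff)
qed

section \<open>Monotonicity of the paths\<close>

text \<open>A discrete layer decomposition: for each level \<open>b ^ i\<close> that
  \<open>z\<close> exceeds, the next truncation level \<open>b ^ Suc i\<close> is paid in full. In
  expectation it turns tail bounds at the levels into a bound for a truncated mean.\<close>

lemma min_power_le_sum: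
  fixes b z :: real
  assumes b: "1 \<le> b"
  shows "min z (b ^ K) \<le> 1 + (\<Sum>i<K. b ^ Suc i * (if b ^ i < z then 1 else 0))"
proof (induction K)
  case (Suc K)
  have nn: "0 \<le> b ^ Suc K" "0 \<le> b ^ K" using b by (simp_all del: power_Suc)
  have "min z (b ^ Suc K) \<le> min z (b ^ K) + b ^ Suc K * (if b ^ K < z then 1 else 0)"
  proof (cases "b ^ K < z")
    case True
    then have "min z (b ^ K) = b ^ K" by simp
    moreover have "min z (b ^ Suc K) \<le> b ^ Suc K" by (rule min.cobounded2)
    ultimately show ?thesis unfolding if_P[OF True] using nn by linarith
  next
    case False
    then have "min z (b ^ K) = z" by simp
    moreover have "min z (b ^ Suc K) \<le> z" by (rule min.cobounded1)
    ultimately show ?thesis unfolding if_not_P[OF False] by linarith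
  qed
  with Suc show ?case by simp
qed simp

section \<open>The process: direct consequences of its definition, tails, and the sign of its
  increments\<close>

locale stable_no_neg_jumps = prob_space M
  for M :: "'a measure" +
  fixes X :: "real \<Rightarrow> 'a \<Rightarrow> real" and \<alpha> :: real
  assumes \<alpha>: "0 < \<alpha>" "\<alpha> < 1"
    and stable: "stable_process M \<alpha> X"
    and no_neg: "no_negative_jumps M X"
begin

lemma levy: "levy_process M X"
  using stable by (simp add: stable_process_def)

lemma X_measurable [measurable]: "X t \<in> borel_measurable M"
  using levy by (simp add: levy_process_def)

lemma distr_increment: "0 \<le> s \<Longrightarrow> 0 \<le> t \<Longrightarrow> distr M borel (\<lambda>\<omega>. X (s + t) \<omega> - X s \<omega>) = distr M borel (X t)"
  using levy by (simp add: levy_process_def)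

lemma indep_increments:
  "0 \<le> ts 0 \<Longrightarrow> (\<And>i. ts i \<le> ts (Suc i)) \<Longrightarrow>
    indep_vars (\<lambda>_. borel) (\<lambda>i \<omega>. X (ts (Suc i)) \<omega> - X (ts i) \<omega>) {..<n}"
  using levy unfolding levy_process_def by blast

lemma AE_regular:
  "AE \<omega> in M. X 0 \<omega> = 0 \<and> (\<forall>t\<ge>0. continuous (at_right t) (\<lambda>s. X s \<omega>)) \<and>
     (\<forall>t>0. \<exists>l. ((\<lambda>s. X s \<omega>) \<longlongrightarrow> l) (at_left t)) \<and>
     (\<forall>t>0. \<forall>l. ((\<lambda>s. X s \<omega>) \<longlongrightarrow> l) (at_left t) \<longrightarrow> l \<le> X t \<omega>)"
proof -
  have "AE \<omega> in M. X 0 \<omega> = 0"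
    and "AE \<omega> in M. (\<forall>t\<ge>0. continuous (at_right t) (\<lambda>s. X s \<omega>)) \<and>
                  (\<forall>t>0. \<exists>l. ((\<lambda>s. X s \<omega>) \<longlongrightarrow> l) (at_left t))"
    and "AE \<omega> in M. \<forall>t>0. \<forall>l. ((\<lambda>s. X s \<omega>) \<longlongrightarrow> l) (at_left t) \<longrightarrow> l \<le> X t \<omega>"
    using levy no_neg unfolding levy_process_def no_negative_jumps_def by blast+
  then show ?thesis by eventually_elim blast
qed

lemma distr_scaling_vector:
  fixes ts :: "nat \<Rightarrow> real"
  assumes "0 < c" "\<And>i. 0 \<le> ts i"
  shows "distr M (PiM {..<n} (\<lambda>_. borel)) (\<lambda>\<omega>. \<lambda>i\<in>{..<n}. c * X (c powr (-\<alpha>) * ts i) \<omega>)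
        = distr M (PiM {..<n} (\<lambda>_. borel)) (\<lambda>\<omega>. \<lambda>i\<in>{..<n}. X (ts i) \<omega>)"
  using stable assms unfolding stable_process_def by blast

lemma distr_scaling:
  assumes c: "0 < c" and t: "0 \<le> t"
  shows "distr M borel (\<lambda>\<omega>. c * X (c powr (-\<alpha>) * t) \<omega>) = distr M borel (X t)"
proof -
  have [measurable]: "(\<lambda>v. v (0::nat)) \<in> measurable (PiM {..<Suc 0} (\<lambda>_. borel :: real measure)) borel"
    by (rule measurable_component_singleton) simp
  have e: "distr M borel (f 0) = distr (distr M (PiM {..<Suc 0} (\<lambda>_. borel)) (\<lambda>\<omega>. \<lambda>i\<in>{..<Suc 0}. f i \<omega>)) borel (\<lambda>v. v 0)"
    if [measurable]: "\<And>i. f i \<in> borel_measurable M" for f :: "nat \<Rightarrow> 'a \<Rightarrow> real"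
    by (subst distr_distr) (auto simp: o_def)
  show ?thesis
    using e[of "\<lambda>_ \<omega>. c * X (c powr (-\<alpha>) * t) \<omega>"] e[of "\<lambda>_. X t"]
      distr_scaling_vector[OF c, of "\<lambda>_. t" "Suc 0"] t by simp
qed

lemma distr_scaling':
  assumes t: "0 < t"
  shows "distr M borel (\<lambda>\<omega>. t powr (1/\<alpha>) * X 1 \<omega>) = distr M borel (X t)"
proof -
  have "(t powr (1/\<alpha>)) powr (-\<alpha>) * t = 1"
    using t \<alpha> by (simp add: powr_powr powr_minus)
  then show ?thesis using distr_scaling[of "t powr (1/\<alpha>)" t] t by simp
qed

text \<open>Boundedness on [0,1] keeps all n increments over steps of length 1/n in [-y, y] with
  probability above 1/2. By independence, stationarity and scaling, (1 - p)^n > 1/2 for the tail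
  probability p at \<open>y * n powr (1/\<alpha>)\<close>. Then exp (n p) < 2, and 1 + n p \<le> exp
  (n p) gives n p < 1.\<close>

lemma tail_bound:
  obtains y where "0 < y" "\<And>n::nat. 0 < n \<Longrightarrow> prob {\<omega> \<in> space M. y * real n powr (1/\<alpha>) < \<bar>X 1 \<omega>\<bar>} \<le> 1 / real n"
proof -
  \<comment> \<open>Restricting to rational times keeps the event measurable.\<close>
  define B where "B k = {\<omega> \<in> space M. \<forall>r\<in>\<rat> \<inter> {0..1}. \<bar>X r \<omega>\<bar> \<le> real k}" for k :: nat
  have c: "countable (\<rat> \<inter> {0..1::real})" using countable_rat by (rule countable_subset[rotated]) auto
  have B[measurable]: "B k \<in> sets M" for k
    unfolding B_def by (intro sets.sets_Collect_countable_All' c) measurable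
  have inc: "incseq B" unfolding incseq_def B_def by (auto intro: order_trans)
  have "AE \<omega> in M. \<omega> \<in> (\<Union>k. B k)"
    using AE_regular AE_space
  proof eventually_elim
    case (elim \<omega>)
    then obtain b where b: "\<forall>t. 0 \<le> t \<and> t \<le> 1 \<longrightarrow> \<bar>X t \<omega>\<bar> \<le> b"
      using cadlag_bounded[of "\<lambda>s. X s \<omega>" 1] by blast
    obtain k where "b \<le> real k" using real_arch_simple by blast
    then have "\<omega> \<in> B k" using b elim unfolding B_def by (auto intro: order_trans)
    then show ?case by blast
  qed
  then have "prob (\<Union>k. B k) = 1" by (subst prob_eq_1) auto
  moreover have "(\<lambda>k. prob (B k)) \<longlonglongrightarrow> prob (\<Union>k. B k)"
    using inc by (intro finite_Lim_measure_incseq) auto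
  ultimately have "\<forall>\<^sub>F k in sequentially. 1/2 < prob (B k)" by (intro order_tendstoD(1)[of _ 1]) auto
  then obtain k where k: "1/2 < prob (B k)" by (auto simp: eventually_sequentially)
  \<comment> \<open>Two values of size at most \<open>k\<close> differ by at most 2 k; the extra 1
    keeps \<open>y\<close> positive when \<open>k = 0\<close>.\<close>
  define y where "y = 2 * real k + 1"
  show ?thesis
  proof
    show "0 < y" by (simp add: y_def)
    fix n :: nat assume n: "0 < n"
    define p where "p = prob {\<omega> \<in> space M. y * real n powr (1/\<alpha>) < \<bar>X 1 \<omega>\<bar>}"
    let ?Y = "\<lambda>i \<omega>. X (real (Suc i) / real n) \<omega> - X (real i / real n) \<omega>"
    have ind: "indep_vars (\<lambda>_. borel) ?Y {..<n}"
      using indep_increments[of "\<lambda>i. real i / real n" n] n by (simp add: divide_right_mono)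
    have "prob (?Y i -` {-y..y} \<inter> space M) = 1 - p" for i
    proof -
      have "prob (?Y i -` {-y..y} \<inter> space M) = measure (distr M borel (?Y i)) {-y..y}"
        by (rule measure_distr[symmetric]) auto
      also have "distr M borel (?Y i) = distr M borel (X (1 / real n))"
        using distr_increment[of "real i / real n" "1 / real n"] n
        by (simp add: add_divide_distrib add.commute)
      also have "\<dots> = distr M borel (\<lambda>\<omega>. (1 / real n) powr (1/\<alpha>) * X 1 \<omega>)"
        using distr_scaling'[of "1 / real n"] n by simp
      also have "measure \<dots> {-y..y} = prob ((\<lambda>\<omega>. (1 / real n) powr (1/\<alpha>) * X 1 \<omega>) -` {-y..y} \<inter> space M)"
        by (rule measure_distr) auto
      also have "(\<lambda>\<omega>. (1 / real n) powr (1/\<alpha>) * X 1 \<omega>) -` {-y..y} \<inter> space M =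
          space M - {\<omega> \<in> space M. y * real n powr (1/\<alpha>) < \<bar>X 1 \<omega>\<bar>}"
      proof -
        have "(1 / real n) powr (1/\<alpha>) * x \<in> {-y..y} \<longleftrightarrow> \<not> y * real n powr (1/\<alpha>) < \<bar>x\<bar>" for x
        proof -
          have P: "0 < real n powr (1/\<alpha>)" using n by simp
          have e: "(1 / real n) powr (1/\<alpha>) * x = x / real n powr (1/\<alpha>)"
            using n by (simp add: powr_divide)
          have "(1 / real n) powr (1/\<alpha>) * x \<in> {-y..y} \<longleftrightarrow> \<bar>x / real n powr (1/\<alpha>)\<bar> \<le> y"
            unfolding e atLeastAtMost_iff by linarith
          also have "\<dots> \<longleftrightarrow> \<bar>x\<bar> / real n powr (1/\<alpha>) \<le> y" using P by simp
          also have "\<dots> \<longleftrightarrow> \<bar>x\<bar> \<le> y * real n powr (1/\<alpha>)" using P by (simp add: pos_divide_le_eq)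
          finally show ?thesis by (simp only: not_less)
        qed
        then show ?thesis unfolding vimage_def by blast
      qed
      also have "prob \<dots> = 1 - p" unfolding p_def by (rule prob_compl) measurable
      finally show ?thesis .
    qed
    then have "(1 - p) ^ n = (\<Prod>i<n. prob (?Y i -` {-y..y} \<inter> space M))" by simp
    also have "\<dots> = prob (\<Inter>i<n. ?Y i -` {-y..y} \<inter> space M)"
      using n by (intro indep_varsD[OF ind, symmetric]) auto
    also have "\<dots> \<ge> prob (B k)"
    proof (intro finite_measure_mono subsetI)
      show "(\<Inter>i<n. ?Y i -` {-y..y} \<inter> space M) \<in> events"
        using n by (intro sets.finite_INT) (auto intro!: measurable_sets[of _ _ borel])
      fix \<omega> assume w: "\<omega> \<in> B k"
      have "\<bar>X (real i / real n) \<omega>\<bar> \<le> real k" if "i \<le> n" for i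
        using w that n by (auto simp: B_def)
      then have "?Y i \<omega> \<in> {-y..y}" if "i < n" for i
      proof -
        have "\<bar>X (real (Suc i) / real n) \<omega>\<bar> \<le> real k" "\<bar>X (real i / real n) \<omega>\<bar> \<le> real k"
          using that by (auto intro!: \<open>\<And>i. i \<le> n \<Longrightarrow> \<bar>X (real i / real n) \<omega>\<bar> \<le> real k\<close> simp del: of_nat_Suc)
        then show ?thesis unfolding y_def atLeastAtMost_iff by linarith
      qed
      then show "\<omega> \<in> (\<Inter>i<n. ?Y i -` {-y..y} \<inter> space M)" using w n by (auto simp: B_def)
    qed
    finally have 1: "1/2 < (1 - p) ^ n" using k by simp
    have p1: "0 \<le> p" "p \<le> 1" by (simp_all add: p_def)
    have "(1 - p) ^ n \<le> exp (-p) ^ n"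
      using p1 exp_ge_add_one_self[of "-p"] by (intro power_mono) auto
    also have "\<dots> = inverse (exp (real n * p))" by (simp add: exp_of_nat_mult exp_minus power_inverse)
    finally have "1/2 < inverse (exp (real n * p))" using 1 by simp
    then have "exp (real n * p) < 2" by (simp add: field_simps)
    with exp_ge_add_one_self[of "real n * p"] have "real n * p < 1" by linarith
    then show "prob {\<omega> \<in> space M. y * real n powr (1/\<alpha>) < \<bar>X 1 \<omega>\<bar>} \<le> 1 / real n"
      unfolding p_def[symmetric] using n by (simp add: field_simps)
  qed
qed

text \<open>Here \<alpha> < 1 is decisive: it makes b = 2 powr (1/\<alpha>) exceed 2, so the bound
  vanishes as \<open>j\<close> grows, uniformly in m \<ge> j. For the height y / b ^ j, the factor
  (2/b) ^ j is (b powr (- j)) powr (1 - \<alpha>). By scaling, X (1 / 2 ^ m) has the law of X 1 / b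
  ^ m, so it suffices to bound the mean of |X 1| / y truncated at b ^ (m - j), whose tail at b ^ i
  is at most 1 / 2 ^ i.\<close>

lemma expectation_small_increment:
  obtains y b C where "0 < y" "2 < b" "0 \<le> C"
    "\<And>m j. j \<le> m \<Longrightarrow> 2 ^ m * expectation (\<lambda>\<omega>. min \<bar>X (1 / 2 ^ m) \<omega>\<bar> (y / b ^ j)) \<le> C * (2 / b) ^ j"
proof -
  obtain y where y: "0 < y"
    and tail: "\<And>n::nat. 0 < n \<Longrightarrow> prob {\<omega> \<in> space M. y * real n powr (1/\<alpha>) < \<bar>X 1 \<omega>\<bar>} \<le> 1 / real n"
    by (rule tail_bound) (rule that)
  define b where "b = 2 powr (1/\<alpha>)"
  have "2 powr 1 < b" unfolding b_def using \<alpha> by (intro powr_less_mono) auto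
  then have b: "2 < b" by simp
  have bpow: "real (2 ^ i) powr (1/\<alpha>) = b ^ i" for i :: nat
    unfolding b_def by (simp add: powr_powr powr_realpow[symmetric] mult.commute)
  have tail': "prob {\<omega> \<in> space M. b ^ i < \<bar>X 1 \<omega>\<bar> / y} \<le> 1 / 2 ^ i" for i
    using tail[of "2 ^ i"] y unfolding bpow by (simp add: pos_less_divide_eq mult.commute)
  \<comment> \<open>Collects the factor \<open>b\<close> between consecutive levels and the
    denominator of the geometric sum of ratio b/2.\<close>
  define D where "D = b / (b/2 - 1)"
  have D: "0 \<le> D" using b by (simp add: D_def)
  define A where "A i = {\<omega> \<in> space M. b ^ i < \<bar>X 1 \<omega>\<bar> / y}" for i :: nat
  have [measurable]: "A i \<in> events" for i unfolding A_def by measurable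
  have tail'': "prob (A i) \<le> 1 / 2 ^ i" for i using tail'[of i] by (simp add: A_def)
  have E1: "expectation (\<lambda>\<omega>. min (\<bar>X 1 \<omega>\<bar> / y) (b ^ K)) \<le> 1 + D * (b/2) ^ K" for K
  proof -
    have ii: "integrable M (\<lambda>\<omega>. b ^ Suc i * indicator (A i) \<omega>)" for i
      by (intro integrable_mult_right integrable_real_indicator) (auto simp: emeasure_eq_measure)
    have int: "integrable M (\<lambda>\<omega>. 1 + (\<Sum>i<K. b ^ Suc i * indicator (A i) \<omega>))"
      by (intro Bochner_Integration.integrable_add Bochner_Integration.integrable_sum ii) simp
    have "expectation (\<lambda>\<omega>. min (\<bar>X 1 \<omega>\<bar> / y) (b ^ K)) \<le>
      expectation (\<lambda>\<omega>. 1 + (\<Sum>i<K. b ^ Suc i * indicator (A i) \<omega>))"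
    proof (rule integral_mono)
      show "integrable M (\<lambda>\<omega>. min (\<bar>X 1 \<omega>\<bar> / y) (b ^ K))"
        using y b by (intro integrable_const_bound[of _ "b ^ K"]) auto
      fix \<omega> assume w: "\<omega> \<in> space M"
      have ind: "(indicator (A i) \<omega> :: real) = (if b ^ i < \<bar>X 1 \<omega>\<bar> / y then 1 else 0)" for i
        using w by (simp add: A_def indicator_def)
      show "min (\<bar>X 1 \<omega>\<bar> / y) (b ^ K) \<le>
          1 + (\<Sum>i<K. b ^ Suc i * indicator (A i) \<omega>)"
        unfolding ind using b by (intro min_power_le_sum) simp
    qed (rule int)
    also have "\<dots> = 1 + (\<Sum>i<K. b ^ Suc i * prob (A i))"
      by (subst Bochner_Integration.integral_add)
         (simp_all only: integrable_const Bochner_Integration.integrable_sum ii Bochner_Integration.integral_sum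
           integral_mult_right_zero integral_indicator lebesgue_integral_const prob_space, simp_all add: sets.Int_space_eq2)
    also have "\<dots> \<le> 1 + (\<Sum>i<K. b ^ Suc i * (1 / 2 ^ i))"
      using b by (intro add_left_mono sum_mono mult_left_mono tail'') auto
    also have "(\<Sum>i<K. b ^ Suc i * (1 / 2 ^ i)) = b * (\<Sum>i<K. (b/2) ^ i)"
      by (simp add: sum_distrib_left power_divide)
    also have "(\<Sum>i<K. (b/2) ^ i) = ((b/2) ^ K - 1) / (b/2 - 1)"
      using b by (intro geometric_sum) auto
    also have "\<dots> \<le> (b/2) ^ K / (b/2 - 1)"
      using b by (intro divide_right_mono) auto
    finally show ?thesis using b by (simp add: D_def)
  qed
  show ?thesis
  proof
    show "0 < y" "2 < b" by fact+
    show "0 \<le> y * (1 + D)" using y D by simp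
    fix m j :: nat assume jm: "j \<le> m"
    have "expectation (\<lambda>\<omega>. min \<bar>X (1 / 2 ^ m) \<omega>\<bar> (y / b ^ j)) =
        (\<integral>x. min \<bar>x\<bar> (y / b ^ j) \<partial>distr M borel (X (1 / 2 ^ m)))"
      by (simp add: integral_distr)
    also have "\<dots> = expectation (\<lambda>\<omega>. min \<bar>(1 / 2 ^ m) powr (1/\<alpha>) * X 1 \<omega>\<bar> (y / b ^ j))"
      by (subst distr_scaling'[symmetric]) (simp_all add: integral_distr)
    also have "(\<lambda>\<omega>. min \<bar>(1 / 2 ^ m) powr (1/\<alpha>) * X 1 \<omega>\<bar> (y / b ^ j)) =
        (\<lambda>\<omega>. y / b ^ m * min (\<bar>X 1 \<omega>\<bar> / y) (b ^ (m - j)))"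
    proof
      fix \<omega>
      have 1: "(1 / 2 ^ m) powr (1/\<alpha>) = 1 / b ^ m" using bpow[of m] by (simp add: powr_divide)
      have 2: "y / b ^ j = y / b ^ m * b ^ (m - j)" using jm b by (simp add: power_diff)
      have 3: "\<bar>(1 / 2 ^ m) powr (1/\<alpha>) * X 1 \<omega>\<bar> = y / b ^ m * (\<bar>X 1 \<omega>\<bar> / y)"
        unfolding 1 using y b by (simp add: abs_mult)
      have 4: "0 \<le> y / b ^ m" using y b by simp
      show "min \<bar>(1 / 2 ^ m) powr (1/\<alpha>) * X 1 \<omega>\<bar> (y / b ^ j) =
          y / b ^ m * min (\<bar>X 1 \<omega>\<bar> / y) (b ^ (m - j))"
        unfolding 3 2 using 4 by (simp add: min_mult_distrib_left)
    qed
    also have "expectation \<dots> \<le> y / b ^ m * (1 + D * (b/2) ^ (m - j))"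
      using E1[of "m - j"] y b by (simp add: mult_left_mono divide_right_mono)
    finally have "2 ^ m * expectation (\<lambda>\<omega>. min \<bar>X (1 / 2 ^ m) \<omega>\<bar> (y / b ^ j)) \<le>
        2 ^ m * (y / b ^ m * (1 + D * (b/2) ^ (m - j)))" by (intro mult_left_mono) auto
    \<comment> \<open>The term 1 of \<open>E1\<close> contributes (2/b) ^ m, at most (2/b) ^ j
      because j \<le> m; in the other term the powers with exponent m - j cancel.\<close>
    also have "\<dots> = y * ((2/b) ^ m + D * (2/b) ^ j)"
    proof -
      have "(2/b) ^ m = (2/b) ^ j * (2/b) ^ (m - j)" using jm by (simp add: power_add[symmetric])
      moreover have "(2/b) ^ (m - j) * (b/2) ^ (m - j) = 1"
        using b by (simp add: power_mult_distrib[symmetric])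
      ultimately have e: "(2/b) ^ m * (b/2) ^ (m - j) = (2/b) ^ j" by simp
      have "2 ^ m * (y / b ^ m * (1 + D * Q)) = y * ((2/b) ^ m + D * ((2/b) ^ m * Q))" for Q
        by (simp add: power_divide algebra_simps add_divide_distrib)
      then show ?thesis by (simp only: e)
    qed
    also have "\<dots> \<le> y * ((2/b) ^ j + D * (2/b) ^ j)"
      using y b jm by (intro mult_left_mono add_right_mono power_decreasing) auto
    finally show "2 ^ m * expectation (\<lambda>\<omega>. min \<bar>X (1 / 2 ^ m) \<omega>\<bar> (y / b ^ j)) \<le> (y * (1 + D)) * (2 / b) ^ j"
      by (simp add: algebra_simps)
  qed
qed

lemma AE_X1_nonneg: "AE \<omega> in M. 0 \<le> X 1 \<omega>"
proof -
  obtain y b C where y: "0 < y" and b: "2 < b" and C: "0 \<le> C"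
    and small: "\<And>m j. j \<le> m \<Longrightarrow> 2 ^ m * expectation (\<lambda>\<omega>. min \<bar>X (1 / 2 ^ m) \<omega>\<bar> (y / b ^ j)) \<le> C * (2 / b) ^ j"
    by (rule expectation_small_increment) (rule that)
  define Y where "Y m i \<omega> = X (real (Suc i) / 2 ^ m) \<omega> - X (real i / 2 ^ m) \<omega>" for m i \<omega>
  have [measurable]: "Y m i \<in> borel_measurable M" for m i unfolding Y_def by measurable
  define G where "G m j \<omega> = (\<Sum>i<2 ^ m. min \<bar>Y m i \<omega>\<bar> (y / b ^ j))" for m j \<omega>
  have [measurable]: "G m j \<in> borel_measurable M" for m j unfolding G_def by measurable
  have G0: "0 \<le> G m j \<omega>" for m j \<omega> unfolding G_def using y b by (intro sum_nonneg) auto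
  have int: "integrable M (\<lambda>\<omega>. min \<bar>Y m i \<omega>\<bar> (y / b ^ j))" for m i j
    using y b by (intro integrable_const_bound[of _ "y / b ^ j"]) auto
  have EG: "(\<integral>\<^sup>+\<omega>. ennreal (G m j \<omega>) \<partial>M) \<le> ennreal (C * (2/b) ^ j)" if "j \<le> m" for m j
  proof -
    have "expectation (\<lambda>\<omega>. min \<bar>Y m i \<omega>\<bar> (y / b ^ j)) = expectation (\<lambda>\<omega>. min \<bar>X (1 / 2 ^ m) \<omega>\<bar> (y / b ^ j))" for i
    proof -
      have "distr M borel (Y m i) = distr M borel (X (1 / 2 ^ m))"
        using distr_increment[of "real i / 2 ^ m" "1 / 2 ^ m"]
        by (simp add: Y_def[abs_def] add_divide_distrib add.commute)
      then have "(\<integral>x. min \<bar>x\<bar> (y / b ^ j) \<partial>distr M borel (Y m i)) = (\<integral>x. min \<bar>x\<bar> (y / b ^ j) \<partial>distr M borel (X (1 / 2 ^ m)))"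
        by simp
      then show ?thesis by (simp add: integral_distr)
    qed
    then have "expectation (G m j) = 2 ^ m * expectation (\<lambda>\<omega>. min \<bar>X (1 / 2 ^ m) \<omega>\<bar> (y / b ^ j))"
      unfolding G_def using int by simp
    moreover have "(\<integral>\<^sup>+\<omega>. ennreal (G m j \<omega>) \<partial>M) = ennreal (expectation (G m j))"
      using G0 int by (intro nn_integral_eq_integral) (auto simp: G_def[abs_def])
    ultimately show ?thesis using small[OF that] by (simp add: ennreal_leI)
  qed
  \<comment> \<open>\<open>ennreal\<close> maps negative numbers to 0, so this is the mean of the
    negative part of \<open>X 1\<close>. The height, indexed by \<open>j\<close>, stays fixed while
    the mesh vanishes; only then does \<open>j\<close> grow.\<close>
  have "(\<integral>\<^sup>+\<omega>. ennreal (- X 1 \<omega>) \<partial>M) \<le> ennreal (C * (2/b) ^ j)" for j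
  proof -
    have "AE \<omega> in M. ennreal (- X 1 \<omega>) \<le> liminf (\<lambda>m. ennreal (G m j \<omega>))"
      using AE_regular
    proof eventually_elim
      case (elim \<omega>)
      have yb: "0 < y / b ^ j" using y b by simp
      obtain \<eta> where \<eta>: "0 < \<eta>" "\<forall>s u. 0 \<le> s \<and> s \<le> u \<and> u \<le> 1 \<and> u \<le> s + \<eta> \<longrightarrow> X s \<omega> - X u \<omega> < y / b ^ j"
        using cadlag_small_decrement[of "\<lambda>s. X s \<omega>" "y / b ^ j" 1] elim yb by blast
      have "(\<lambda>m. (1/2 :: real) ^ m) \<longlonglongrightarrow> 0" by (intro LIMSEQ_power_zero) simp
      then have "\<forall>\<^sub>F m in sequentially. (1/2) ^ m < \<eta>" using \<eta>(1) by (rule order_tendstoD)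
      then have "\<forall>\<^sub>F m in sequentially. ennreal (- X 1 \<omega>) \<le> ennreal (G m j \<omega>)"
      proof eventually_elim
        case m: (elim m)
        \<comment> \<open>All decrements are below the truncation height, so truncation discards
          none of the downward movement.\<close>
        have le: "- Y m i \<omega> \<le> min \<bar>Y m i \<omega>\<bar> (y / b ^ j)" if i: "i < 2 ^ m" for i
        proof -
          have "real (Suc i) \<le> real (2 ^ m)" using i by (intro of_nat_mono) simp
          then have 1: "real (Suc i) / 2 ^ m \<le> 1" by simp
          have 2: "real (Suc i) / 2 ^ m = real i / 2 ^ m + (1/2) ^ m"
            by (simp add: add_divide_distrib power_divide)
          have 3: "real i / 2 ^ m \<le> real (Suc i) / 2 ^ m" "real (Suc i) / 2 ^ m \<le> real i / 2 ^ m + \<eta>" "0 \<le> real i / 2 ^ m"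
            unfolding 2 using m by simp_all
          have "X (real i / 2 ^ m) \<omega> - X (real (Suc i) / 2 ^ m) \<omega> < y / b ^ j"
            by (intro \<eta>(2)[rule_format] conjI 1 3)
          then show ?thesis unfolding Y_def by linarith
        qed
        have "(\<Sum>i<2 ^ m. Y m i \<omega>) = X (real (2 ^ m) / 2 ^ m) \<omega> - X (real 0 / 2 ^ m) \<omega>"
          unfolding Y_def by (rule sum_lessThan_telescope)
        then have "- X 1 \<omega> = (\<Sum>i<2 ^ m. - Y m i \<omega>)" using elim by (simp add: sum_negf)
        also have "\<dots> \<le> G m j \<omega>" unfolding G_def by (intro sum_mono le) auto
        finally show ?case by (rule ennreal_leI)
      qed
      then show ?case by (intro Liminf_bounded)
    qed
    then have "(\<integral>\<^sup>+\<omega>. ennreal (- X 1 \<omega>) \<partial>M) \<le> (\<integral>\<^sup>+\<omega>. liminf (\<lambda>m. ennreal (G m j \<omega>)) \<partial>M)"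
      by (rule nn_integral_mono_AE)
    also have "\<dots> \<le> liminf (\<lambda>m. \<integral>\<^sup>+\<omega>. ennreal (G m j \<omega>) \<partial>M)"
      by (rule nn_integral_liminf) measurable
    also have "\<dots> \<le> limsup (\<lambda>m. \<integral>\<^sup>+\<omega>. ennreal (G m j \<omega>) \<partial>M)"
      by (rule Liminf_le_Limsup) simp
    also have "\<dots> \<le> ennreal (C * (2/b) ^ j)"
      by (rule Limsup_bounded) (auto simp: eventually_sequentially intro!: exI[of _ j] EG)
    finally show ?thesis .
  qed
  moreover have "(\<lambda>j. ennreal (C * (2/b) ^ j)) \<longlonglongrightarrow> ennreal (C * 0)"
    using b by (intro tendsto_ennrealI tendsto_mult tendsto_const LIMSEQ_power_zero) auto
  ultimately have "(\<integral>\<^sup>+\<omega>. ennreal (- X 1 \<omega>) \<partial>M) \<le> ennreal (C * 0)"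
    by (intro LIMSEQ_le_const) auto
  then have "(\<integral>\<^sup>+\<omega>. ennreal (- X 1 \<omega>) \<partial>M) = 0" by simp
  then have "AE \<omega> in M. ennreal (- X 1 \<omega>) = 0" by (subst (asm) nn_integral_0_iff_AE) auto
  then show ?thesis by eventually_elim (simp add: ennreal_eq_0_iff)
qed

lemma AE_X_nonneg: assumes t: "0 \<le> t" shows "AE \<omega> in M. 0 \<le> X t \<omega>"
proof (cases "t = 0")
  case True
  show ?thesis using AE_regular by eventually_elim (simp add: True)
next
  case False
  have "AE \<omega> in M. 0 \<le> t powr (1/\<alpha>) * X 1 \<omega>"
    using AE_X1_nonneg by eventually_elim simp
  then have "AE x in distr M borel (\<lambda>\<omega>. t powr (1/\<alpha>) * X 1 \<omega>). 0 \<le> x"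
    by (subst AE_distr_iff) auto
  then have "AE x in distr M borel (X t). 0 \<le> x"
    using distr_scaling'[of t] t False by (simp only: order.strict_iff_order simp_thms eq_commute[of 0])
  then show ?thesis by (subst (asm) AE_distr_iff) auto
qed

lemma AE_increment_nonneg: assumes st: "0 \<le> s" "s \<le> t" shows "AE \<omega> in M. X s \<omega> \<le> X t \<omega>"
proof -
  have "AE x in distr M borel (X (t - s)). 0 \<le> x"
    using AE_X_nonneg[of "t - s"] st by (subst AE_distr_iff) auto
  then have "AE x in distr M borel (\<lambda>\<omega>. X (s + (t - s)) \<omega> - X s \<omega>). 0 \<le> x"
    by (subst distr_increment) (use st in auto)
  then have "AE \<omega> in M. 0 \<le> X (s + (t - s)) \<omega> - X s \<omega>" by (subst (asm) AE_distr_iff) auto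
  then show ?thesis by eventually_elim simp
qed

text \<open>Rational pairs of times leave a single null set. A violation at real times s < t would,
  by right continuity, persist at rationals slightly to the right of s and of t, on opposite sides
  of the midpoint of the two values.\<close>

lemma AE_mono: "AE \<omega> in M. mono_on {0..} (\<lambda>t. X t \<omega>)"
proof -
  have "AE \<omega> in M. \<forall>p\<in>{p. fst p \<in> \<rat> \<and> snd p \<in> \<rat> \<and> 0 \<le> fst p \<and> fst p \<le> snd p}. X (fst p) \<omega> \<le> X (snd p) \<omega>"
  proof (subst AE_ball_countable)
    show "countable {p :: real \<times> real. fst p \<in> \<rat> \<and> snd p \<in> \<rat> \<and> 0 \<le> fst p \<and> fst p \<le> snd p}"
      by (rule countable_subset[of _ "\<rat> \<times> \<rat>"]) (auto intro!: countable_SIGMA countable_rat)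
  qed (auto intro!: AE_increment_nonneg)
  with AE_regular show ?thesis
  proof eventually_elim
    case (elim \<omega>)
    have rat: "X p \<omega> \<le> X q \<omega>" if "p \<in> \<rat>" "q \<in> \<rat>" "0 \<le> p" "p \<le> q" for p q
      using elim that by (auto dest!: bspec[where x = "(p, q)"])
    have lim: "((\<lambda>s. X s \<omega>) \<longlongrightarrow> X t \<omega>) (at_right t)" if "0 \<le> t" for t
      using elim that by (auto simp: continuous_within)
    show ?case
    proof (rule mono_onI)
      fix s t :: real assume st: "s \<in> {0..}" "t \<in> {0..}" "s \<le> t"
      show "X s \<omega> \<le> X t \<omega>"
      proof (rule ccontr)
        assume "\<not> X s \<omega> \<le> X t \<omega>"
        then have gt: "X t \<omega> < X s \<omega>" by simp
        then have "s < t" using st by (cases "s = t") auto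
        define c where "c = (X t \<omega> + X s \<omega>) / 2"
        have c: "X t \<omega> < c" "c < X s \<omega>" using gt by (auto simp: c_def)
        have "\<forall>\<^sub>F u in at_right s. c < X u \<omega>" using lim[of s] c st by (intro order_tendstoD) auto
        then obtain u where u: "s < u" "\<And>v. s < v \<Longrightarrow> v < u \<Longrightarrow> c < X v \<omega>"
          by (auto simp: eventually_at_right_field)
        have "\<forall>\<^sub>F u in at_right t. X u \<omega> < c" using lim[of t] c st by (intro order_tendstoD) auto
        then obtain w where w: "t < w" "\<And>v. t < v \<Longrightarrow> v < w \<Longrightarrow> X v \<omega> < c"
          by (auto simp: eventually_at_right_field)
        obtain p where p: "p \<in> \<rat>" "s < p" "p < min u t" using Rats_dense_in_real[of s "min u t"] u \<open>s < t\<close> by auto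
        obtain q where q: "q \<in> \<rat>" "t < q" "q < w" using Rats_dense_in_real[of t w] w by auto
        have "X p \<omega> \<le> X q \<omega>" using p q st by (intro rat) auto
        moreover have "c < X p \<omega>" using p u(2) by auto
        moreover have "X q \<omega> < c" using q w(2) by auto
        ultimately show False by simp
      qed
    qed
  qed
qed

section \<open>Markov property and Laplace transform\<close>

lemma distr_grid_increments:
  assumes t: "0 \<le> t" and d: "0 < d" and K: "0 < K"
  shows "distr M (PiM {..<K} (\<lambda>_. borel)) (\<lambda>\<omega>. \<lambda>k\<in>{..<K}. X (t + d * real (Suc k)) \<omega> - X (t + d * real k) \<omega>)
    = PiM {..<K} (\<lambda>_. distr M borel (X d))"
proof -
  have "indep_vars (\<lambda>_. borel) (\<lambda>k \<omega>. X (t + d * real (Suc k)) \<omega> - X (t + d * real k) \<omega>) {..<K}"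
    using indep_increments[of "\<lambda>k. t + d * real k" K] t d by simp
  then have "distr M (PiM {..<K} (\<lambda>_. borel)) (\<lambda>\<omega>. \<lambda>k\<in>{..<K}. X (t + d * real (Suc k)) \<omega> - X (t + d * real k) \<omega>)
    = PiM {..<K} (\<lambda>k. distr M borel (\<lambda>\<omega>. X (t + d * real (Suc k)) \<omega> - X (t + d * real k) \<omega>))"
    using K by (subst (asm) indep_vars_iff_distr_eq_PiM) auto
  also have "\<dots> = PiM {..<K} (\<lambda>_. distr M borel (X d))"
  proof (rule PiM_cong)
    fix k assume "k \<in> {..<K}"
    show "distr M borel (\<lambda>\<omega>. X (t + d * real (Suc k)) \<omega> - X (t + d * real k) \<omega>) = distr M borel (X d)"
      using distr_increment[of "t + d * real k" d] t d by (simp add: algebra_simps)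
  qed simp
  finally show ?thesis .
qed

text \<open>\<open>X t\<close> is independent of the increments after \<open>t\<close>, and these
  have the law of the increments from time 0, so they may be replaced by an independent copy. The
  future enters as a finite vector because independence is given for finite families of
  increments.\<close>

lemma nn_integral_markov:
  fixes H :: "real \<times> (nat \<Rightarrow> real) \<Rightarrow> ennreal"
  assumes [measurable]: "H \<in> borel_measurable (borel \<Otimes>\<^sub>M PiM {..<K} (\<lambda>_. borel))"
    and t: "0 \<le> t" and d: "0 < d" and K: "0 < K"
  shows "(\<integral>\<^sup>+\<omega>. H (X t \<omega>, \<lambda>k\<in>{..<K}. X (t + d * real (Suc k)) \<omega> - X (t + d * real k) \<omega>) \<partial>M) =
    (\<integral>\<^sup>+\<omega>'. \<integral>\<^sup>+\<omega>. H (X t \<omega>', \<lambda>k\<in>{..<K}. X (d * real (Suc k)) \<omega> - X (d * real k) \<omega>) \<partial>M \<partial>M)"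
proof -
  let ?P = "PiM {..<K} (\<lambda>_. borel :: real measure)"
  define Y where "Y s \<omega> = (\<lambda>k\<in>{..<K}. X (s + d * real (Suc k)) \<omega> - X (s + d * real k) \<omega>)" for s \<omega>
  have Y[measurable]: "Y s \<in> measurable M ?P" for s
    unfolding Y_def[abs_def] by measurable
  \<comment> \<open>The times 0, t, t + d, t + 2 d, ...: increment 0 leads from 0 to
    \<open>t\<close>, increments 1 to \<open>K\<close> are those of \<open>Y t\<close> with the
    index shifted by one.\<close>
  define ts where "ts i = (case i of 0 \<Rightarrow> 0 | Suc k \<Rightarrow> t + d * real k)" for i
  define Z where "Z i \<omega> = X (ts (Suc i)) \<omega> - X (ts i) \<omega>" for i \<omega>
  have ind: "indep_vars (\<lambda>_. borel) Z {..<Suc K}"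
    unfolding Z_def[abs_def]
    by (rule indep_increments) (use t d in \<open>auto simp: ts_def split: nat.splits\<close>)
  let ?Q = "PiM {1..K} (\<lambda>_. borel :: real measure)" and ?O = "PiM {0} (\<lambda>_. borel :: real measure)"
  have "indep_var ?O (\<lambda>\<omega>. restrict (\<lambda>i. Z i \<omega>) {0::nat}) ?Q (\<lambda>\<omega>. restrict (\<lambda>i. Z i \<omega>) {1..K})"
    by (rule indep_var_restrict[OF ind]) auto
  then have "indep_var ?O (id \<circ> (\<lambda>\<omega>. restrict (\<lambda>i. Z i \<omega>) {0::nat}))
      ?P ((\<lambda>v. \<lambda>k\<in>{..<K}. v (Suc k)) \<circ> (\<lambda>\<omega>. restrict (\<lambda>i. Z i \<omega>) {1..K}))"
    by (rule indep_var_compose) (auto intro!: measurable_restrict)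
  moreover have "(\<lambda>v. \<lambda>k\<in>{..<K}. v (Suc k)) \<circ> (\<lambda>\<omega>. restrict (\<lambda>i. Z i \<omega>) {1..K}) = Y t"
    by (auto simp: fun_eq_iff Z_def ts_def Y_def restrict_def)
  moreover define R where "R \<omega> = restrict (\<lambda>i. Z i \<omega>) {0::nat}" for \<omega>
  ultimately have iv: "indep_var ?O R ?P (Y t)" by (simp add: R_def[abs_def])
  have [measurable]: "R \<in> measurable M ?O" unfolding R_def[abs_def] Z_def by measurable
  have R0: "R \<omega> 0 = X t \<omega> - X 0 \<omega>" for \<omega> by (simp add: R_def Z_def ts_def)
  have c0: "(\<lambda>v. v (0::nat)) \<in> measurable ?O borel" by (rule measurable_component_singleton) simp
  have c1: "(\<lambda>z. (fst z 0, snd z)) \<in> measurable (?O \<Otimes>\<^sub>M ?P) (borel \<Otimes>\<^sub>M ?P)"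
    using measurable_compose[OF measurable_fst[of ?O ?P] c0] by (intro measurable_Pair measurable_snd) simp_all
  have c2 [measurable]: "(\<lambda>z. H (fst z 0, snd z)) \<in> borel_measurable (?O \<Otimes>\<^sub>M ?P)"
    by (rule measurable_compose[OF c1]) measurable
  have "(\<lambda>x. \<integral>\<^sup>+\<omega>. H (x, Y 0 \<omega>) \<partial>M) \<in> borel_measurable borel" by measurable
  from measurable_compose[OF c0 this]
  have c3: "(\<lambda>u. \<integral>\<^sup>+\<omega>. H (u 0, Y 0 \<omega>) \<partial>M) \<in> borel_measurable ?O" by simp
  have X0: "AE \<omega> in M. X t \<omega> = X t \<omega> - X 0 \<omega>" using AE_regular by eventually_elim simp
  have dY: "distr M ?P (Y t) = distr M ?P (Y 0)"
    unfolding Y_def[abs_def] using distr_grid_increments[OF t d K] distr_grid_increments[OF order_refl d K] by simp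
  interpret Y0: prob_space "distr M ?P (Y 0)" by (rule prob_space_distr) measurable
  have "(\<integral>\<^sup>+\<omega>. H (X t \<omega>, Y t \<omega>) \<partial>M) = (\<integral>\<^sup>+\<omega>. H (R \<omega> 0, Y t \<omega>) \<partial>M)"
    using X0 unfolding R0 by (intro nn_integral_cong_AE) (auto elim: eventually_mono)
  also have "\<dots> = (\<integral>\<^sup>+z. H (fst z 0, snd z) \<partial>distr M (?O \<Otimes>\<^sub>M ?P) (\<lambda>\<omega>. (R \<omega>, Y t \<omega>)))"
    by (subst nn_integral_distr) auto
  also have "distr M (?O \<Otimes>\<^sub>M ?P) (\<lambda>\<omega>. (R \<omega>, Y t \<omega>)) = distr M ?O R \<Otimes>\<^sub>M distr M ?P (Y 0)"
    using iv unfolding indep_var_distribution_eq dY by simp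
  also have "(\<integral>\<^sup>+z. H (fst z 0, snd z) \<partial>\<dots>) =
      (\<integral>\<^sup>+u. \<integral>\<^sup>+v. H (u 0, v) \<partial>distr M ?P (Y 0) \<partial>distr M ?O R)"
    using Y0.nn_integral_fst[of "\<lambda>z. H (fst z 0, snd z)" "distr M ?O R"] c2 by simp
  also have "\<dots> = (\<integral>\<^sup>+u. \<integral>\<^sup>+\<omega>. H (u 0, Y 0 \<omega>) \<partial>M \<partial>distr M ?O R)"
  proof (rule nn_integral_cong)
    fix u :: "nat \<Rightarrow> real"
    have "(\<lambda>v. H (u 0, v)) \<in> borel_measurable ?P" by measurable
    then show "(\<integral>\<^sup>+v. H (u 0, v) \<partial>distr M ?P (Y 0)) = (\<integral>\<^sup>+\<omega>. H (u 0, Y 0 \<omega>) \<partial>M)"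
      by (subst nn_integral_distr) auto
  qed
  also have "\<dots> = (\<integral>\<^sup>+\<omega>'. \<integral>\<^sup>+\<omega>. H (R \<omega>' 0, Y 0 \<omega>) \<partial>M \<partial>M)"
    by (rule nn_integral_distr) (use c3 in \<open>simp_all\<close>)
  also have "\<dots> = (\<integral>\<^sup>+\<omega>'. \<integral>\<^sup>+\<omega>. H (X t \<omega>', Y 0 \<omega>) \<partial>M \<partial>M)"
    using X0 unfolding R0 by (intro nn_integral_cong_AE) (auto elim: eventually_mono)
  finally show ?thesis by (simp only: Y_def add_0)
qed

section \<open>The Laplace transform of \<open>X t\<close> and its exponent\<close>

definition laplace :: "real \<Rightarrow> real" where "laplace t = expectation (\<lambda>\<omega>. exp (- X t \<omega>))"

text \<open>The Laplace exponent at 1. It may be 0, but only for the zero process, see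
  \<open>AE_zero_if_rate_zero\<close>.\<close>

definition rate :: real where "rate = - ln (laplace 1)"

text \<open>Scaling by the factor \<open>p\<close> trades the transform parameter for time, so
  \<open>laplace\<close> at parameter 1, as a function of time, carries all other
  parameters.\<close>

lemma laplace_scaled_nn:
  assumes p: "0 < p" and t: "0 \<le> t"
  shows "(\<integral>\<^sup>+\<omega>. ennreal (exp (- (p * X t \<omega>))) \<partial>M) = ennreal (laplace (p powr \<alpha> * t))"
proof -
  have e: "p powr (-\<alpha>) * (p powr \<alpha> * t) = t"
    using p by (simp add: powr_minus field_simps)
  have "distr M borel (\<lambda>\<omega>. p * X t \<omega>) = distr M borel (X (p powr \<alpha> * t))"
    using distr_scaling[OF p, of "p powr \<alpha> * t"] t unfolding e by simp
  then have "(\<integral>\<^sup>+x. ennreal (exp (-x)) \<partial>distr M borel (\<lambda>\<omega>. p * X t \<omega>)) =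
      (\<integral>\<^sup>+x. ennreal (exp (-x)) \<partial>distr M borel (X (p powr \<alpha> * t)))" by simp
  then have "(\<integral>\<^sup>+\<omega>. ennreal (exp (- (p * X t \<omega>))) \<partial>M) = (\<integral>\<^sup>+\<omega>. ennreal (exp (- X (p powr \<alpha> * t) \<omega>)) \<partial>M)"
    by (simp add: nn_integral_distr)
  also have "\<dots> = ennreal (laplace (p powr \<alpha> * t))"
    unfolding laplace_def
  proof (intro nn_integral_eq_integral)
    have "AE \<omega> in M. norm (exp (- X (p powr \<alpha> * t) \<omega>)) \<le> 1"
      using AE_X_nonneg[of "p powr \<alpha> * t", OF mult_nonneg_nonneg[OF powr_ge_zero t]] by eventually_elim simp
    then show "integrable M (\<lambda>\<omega>. exp (- X (p powr \<alpha> * t) \<omega>))"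
      by (rule integrable_const_bound) measurable
  qed simp
  finally show ?thesis .
qed

lemma laplace_nn: "0 \<le> t \<Longrightarrow> (\<integral>\<^sup>+\<omega>. ennreal (exp (- X t \<omega>)) \<partial>M) = ennreal (laplace t)"
  using laplace_scaled_nn[of 1 t] by simp

lemma laplace_nonneg: "0 \<le> laplace t"
  unfolding laplace_def by (intro integral_nonneg_AE) auto

text \<open>With p = 1 this yields the multiplicativity of \<open>laplace\<close>; with p < 1 it
  evaluates what a single grid step contributes to the overshoot transform.\<close>

lemma laplace_increment_nn:
  assumes p: "0 < p" and s: "0 \<le> s" and t: "0 < t"
  shows "(\<integral>\<^sup>+\<omega>. ennreal (exp (- X s \<omega> - p * (X (s + t) \<omega> - X s \<omega>))) \<partial>M) =
    ennreal (laplace s * laplace (p powr \<alpha> * t))"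
proof -
  let ?H = "\<lambda>z :: real \<times> (nat \<Rightarrow> real). ennreal (exp (- fst z)) * ennreal (exp (- (p * snd z 0)))"
  have "(\<lambda>z. snd z 0) \<in> borel_measurable (borel \<Otimes>\<^sub>M PiM {..<Suc 0} (\<lambda>_. borel :: real measure))"
    by (rule measurable_compose[OF measurable_snd measurable_component_singleton]) simp
  then have H: "?H \<in> borel_measurable (borel \<Otimes>\<^sub>M PiM {..<Suc 0} (\<lambda>_. borel))" by measurable
  have e: "exp (- x - p * y) = exp (- x) * exp (- (p * y))" for x y :: real
    by (simp add: exp_add[symmetric])
  have X0: "AE \<omega> in M. X 0 \<omega> = 0" using AE_regular by eventually_elim simp
  have "(\<integral>\<^sup>+\<omega>. ennreal (exp (- X s \<omega> - p * (X (s + t) \<omega> - X s \<omega>))) \<partial>M) =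
    (\<integral>\<^sup>+\<omega>. ?H (X s \<omega>, \<lambda>k\<in>{..<Suc 0}. X (s + t * real (Suc k)) \<omega> - X (s + t * real k) \<omega>) \<partial>M)"
    by (simp add: e ennreal_mult)
  also have "\<dots> = (\<integral>\<^sup>+\<omega>'. \<integral>\<^sup>+\<omega>. ?H (X s \<omega>', \<lambda>k\<in>{..<Suc 0}. X (t * real (Suc k)) \<omega> - X (t * real k) \<omega>) \<partial>M \<partial>M)"
    using s t H by (intro nn_integral_markov) auto
  also have "\<dots> = (\<integral>\<^sup>+\<omega>'. ennreal (exp (- X s \<omega>')) * (\<integral>\<^sup>+\<omega>. ennreal (exp (- (p * (X t \<omega> - X 0 \<omega>)))) \<partial>M) \<partial>M)"
    by (simp add: nn_integral_cmult)
  also have "(\<integral>\<^sup>+\<omega>. ennreal (exp (- (p * (X t \<omega> - X 0 \<omega>)))) \<partial>M) = (\<integral>\<^sup>+\<omega>. ennreal (exp (- (p * X t \<omega>))) \<partial>M)"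
    using X0 by (intro nn_integral_cong_AE) (auto elim: eventually_mono)
  also have "(\<integral>\<^sup>+\<omega>'. ennreal (exp (- X s \<omega>')) * (\<integral>\<^sup>+\<omega>. ennreal (exp (- (p * X t \<omega>))) \<partial>M) \<partial>M) =
      ennreal (laplace s) * ennreal (laplace (p powr \<alpha> * t))"
    using p s t by (simp add: nn_integral_multc laplace_scaled_nn laplace_nn)
  finally show ?thesis by (simp add: ennreal_mult laplace_nonneg)
qed

lemma laplace_add: assumes "0 \<le> s" "0 \<le> t" shows "laplace (s + t) = laplace s * laplace t"
proof (cases "t = 0")
  case True
  have "laplace 0 = expectation (\<lambda>\<omega>. 1)"
    unfolding laplace_def using AE_regular by (intro integral_cong_AE) (auto elim: eventually_mono)
  then show ?thesis using True by (simp add: prob_space)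
next
  case False
  have "ennreal (laplace (s + t)) = ennreal (laplace s * laplace t)"
    using laplace_increment_nn[of 1 s t] assms False by (simp add: laplace_nn[symmetric])
  then show ?thesis by (simp add: laplace_nonneg)
qed

lemma laplace_pos: assumes t: "0 \<le> t" shows "0 < laplace t"
proof (rule ccontr)
  assume "\<not> 0 < laplace t"
  then have "(\<integral>\<^sup>+\<omega>. ennreal (exp (- X t \<omega>)) \<partial>M) = 0"
    using laplace_nn[OF t] laplace_nonneg[of t] by simp
  then have "AE \<omega> in M. ennreal (exp (- X t \<omega>)) = 0" by (subst (asm) nn_integral_0_iff_AE) auto
  then have "AE \<omega> in M. False" by eventually_elim (simp add: ennreal_eq_0_iff)
  then show False by simp
qed

lemma laplace_le_1: assumes t: "0 \<le> t" shows "laplace t \<le> 1"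
proof -
  have "ennreal (laplace t) \<le> (\<integral>\<^sup>+\<omega>. 1 \<partial>M)"
    unfolding laplace_nn[OF t, symmetric] using AE_X_nonneg[OF t]
    by (intro nn_integral_mono_AE) (auto elim!: eventually_mono)
  then show ?thesis by (simp add: emeasure_space_1)
qed

lemma rate_nonneg: "0 \<le> rate"
  unfolding rate_def using laplace_pos[of 1] laplace_le_1[of 1] by simp

text \<open>Cauchy's functional equation for L = - ln laplace: additive and nonnegative, hence
  monotone. Enclosing n t between consecutive integers gives n |L t - t L 1| \<le> L 1 for every
  n.\<close>

lemma laplace_eq: assumes t: "0 \<le> t" shows "laplace t = exp (- rate * t)"
proof -
  define L where "L u = - ln (laplace u)" for u
  have L_add: "L (u + v) = L u + L v" if "0 \<le> u" "0 \<le> v" for u v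
    using that laplace_pos[of u] laplace_pos[of v] by (simp add: L_def laplace_add ln_mult)
  have L_nonneg: "0 \<le> L u" if "0 \<le> u" for u
    using laplace_pos[of u] laplace_le_1[of u] that by (simp add: L_def)
  have L_mono: "L u \<le> L v" if "0 \<le> u" "u \<le> v" for u v
    using L_add[of u "v - u"] L_nonneg[of "v - u"] that by simp
  have L0: "L 0 = 0" using L_add[of 0 0] by simp
  have L_mult: "L (real n * u) = real n * L u" if u: "0 \<le> u" for n u
  proof (induction n)
    case (Suc n)
    then show ?case using L_add[of "real n * u" u] u by (simp add: algebra_simps)
  qed (simp add: L0)
  have "\<bar>L t - t * L 1\<bar> * real n \<le> L 1" for n
  proof -
    define k where "k = nat \<lfloor>real n * t\<rfloor>"
    have k: "real k \<le> real n * t" "real n * t \<le> real (Suc k)"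
      using t by (simp_all add: k_def) linarith
    have "L (real k * 1) \<le> L (real n * t)" "L (real n * t) \<le> L (real (Suc k) * 1)"
      using k t by (intro L_mono; simp)+
    then have 1: "real k * L 1 \<le> real n * L t" "real n * L t \<le> real (Suc k) * L 1"
      using t by (simp_all only: L_mult zero_le_one)
    have 2: "real k * L 1 \<le> real n * t * L 1" "real n * t * L 1 \<le> real (Suc k) * L 1"
      using k L_nonneg[of 1] by (auto intro!: mult_right_mono simp del: of_nat_Suc)
    have "\<bar>real n * L t - real n * t * L 1\<bar> \<le> L 1"
      using 1 2 by (simp add: algebra_simps abs_le_iff)
    moreover have "real n * L t - real n * t * L 1 = real n * (L t - t * L 1)" by (simp add: algebra_simps)
    then have "\<bar>real n * L t - real n * t * L 1\<bar> = real n * \<bar>L t - t * L 1\<bar>"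
      by (simp only: abs_mult abs_of_nat)
    ultimately show ?thesis by (simp add: mult.commute)
  qed
  then have "L t - t * L 1 = 0"
  proof (rule_tac ccontr)
    assume *: "\<And>n. \<bar>L t - t * L 1\<bar> * real n \<le> L 1" "L t - t * L 1 \<noteq> 0"
    obtain n where "L 1 / \<bar>L t - t * L 1\<bar> < real n" using reals_Archimedean2 by blast
    with *(2) have "L 1 < \<bar>L t - t * L 1\<bar> * real n" by (simp add: pos_divide_less_eq mult.commute)
    with *(1)[of n] show False by simp
  qed
  then have "ln (laplace t) = - rate * t" by (simp add: L_def rate_def mult.commute)
  then show ?thesis using laplace_pos[OF t] by (metis exp_ln)
qed

text \<open>The nonnegative variable 1 - exp (- X n) has mean 0, so X vanishes at integer times, and
  monotonicity fills the gaps.\<close>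

lemma AE_zero_if_rate_zero:
  assumes "rate = 0"
  shows "AE \<omega> in M. \<forall>t\<ge>0. X t \<omega> = 0"
proof -
  have "AE \<omega> in M. X (real n) \<omega> = 0" for n
  proof -
    have n: "AE \<omega> in M. 0 \<le> X (real n) \<omega>" by (rule AE_X_nonneg) simp
    have "integrable M (\<lambda>\<omega>. exp (- X (real n) \<omega>))"
      by (rule integrable_const_bound[of _ 1]) (use n in \<open>auto elim: eventually_mono\<close>)
    then have "expectation (\<lambda>\<omega>. 1 - exp (- X (real n) \<omega>)) = 1 - laplace (real n)"
      by (simp add: laplace_def prob_space)
    also have "\<dots> = 0" by (simp add: laplace_eq assms)
    finally have "AE \<omega> in M. 1 - exp (- X (real n) \<omega>) = 0"
      using n \<open>integrable M (\<lambda>\<omega>. exp (- X (real n) \<omega>))\<close>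
      by (subst (asm) integral_nonneg_eq_0_iff_AE) (auto elim: eventually_mono)
    then show ?thesis by eventually_elim simp
  qed
  then have "AE \<omega> in M. \<forall>n. X (real n) \<omega> = 0" by (subst AE_all_countable) blast
  with AE_regular AE_mono show ?thesis
  proof eventually_elim
    case (elim \<omega>)
    show ?case
    proof (intro allI impI)
      fix t :: real assume t: "0 \<le> t"
      obtain n where n: "t \<le> real n" using real_arch_simple by blast
      have "X 0 \<omega> \<le> X t \<omega>" "X t \<omega> \<le> X (real n) \<omega>"
        using elim(2) t n by (auto simp: mono_on_def)
      then show "X t \<omega> = 0" using elim by simp
    qed
  qed
qed

text \<open>Unboundedness comes from an exponential Markov inequality: the probability that X stays
  at or below k at all integers is at most exp k * E exp (- X n) = exp (k - rate * n), for every
  n.\<close>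

lemma AE_subordinator_path:
  assumes c: "0 < rate"
  shows "AE \<omega> in M. subordinator_path (\<lambda>s. X s \<omega>)"
proof -
  have "AE \<omega> in M. \<exists>n. real k < X (real n) \<omega>" for k :: nat
  proof -
    let ?B = "{\<omega> \<in> space M. \<forall>n. X (real n) \<omega> \<le> real k}"
    have "emeasure M ?B \<le> ennreal (exp (real k) * exp (- rate * real n))" for n
    proof -
      have "emeasure M ?B = (\<integral>\<^sup>+\<omega>. indicator ?B \<omega> \<partial>M)" by (rule nn_integral_indicator[symmetric]) measurable
      also have "\<dots> \<le> (\<integral>\<^sup>+\<omega>. ennreal (exp (real k)) * ennreal (exp (- X (real n) \<omega>)) \<partial>M)"
      proof (rule nn_integral_mono)
        fix \<omega> assume "\<omega> \<in> space M"
        have "1 \<le> exp (real k) * exp (- X (real n) \<omega>)" if "\<omega> \<in> ?B"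
          using that by (auto simp: exp_add[symmetric])
        then show "indicator ?B \<omega> \<le> ennreal (exp (real k)) * ennreal (exp (- X (real n) \<omega>))"
          by (auto simp: ennreal_mult[symmetric] split: split_indicator)
      qed
      also have "\<dots> = ennreal (exp (real k)) * ennreal (laplace (real n))"
        by (simp add: nn_integral_cmult laplace_nn)
      finally show ?thesis by (simp add: laplace_eq ennreal_mult)
    qed
    moreover have "(\<lambda>n. ennreal (exp (real k) * exp (- rate * real n))) \<longlonglongrightarrow> ennreal (exp (real k) * 0)"
    proof (intro tendsto_ennrealI tendsto_mult tendsto_const)
      have "(\<lambda>n. exp (- rate) ^ n) \<longlonglongrightarrow> 0" using c by (intro LIMSEQ_power_zero) simp
      then show "(\<lambda>n. exp (- rate * real n)) \<longlonglongrightarrow> 0" by (simp add: exp_of_nat_mult[symmetric] mult.commute)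
    qed
    ultimately have "emeasure M ?B \<le> ennreal (exp (real k) * 0)" by (intro LIMSEQ_le_const) auto
    then have "emeasure M ?B = 0" by simp
    then have "AE \<omega> in M. \<omega> \<notin> ?B" by (intro AE_not_in null_setsI) auto
    with AE_space show ?thesis by eventually_elim (auto simp: not_le)
  qed
  then have "AE \<omega> in M. \<forall>k::nat. \<exists>n::nat. real k < X (real n) \<omega>" by (subst AE_all_countable) blast
  with AE_regular AE_mono show ?thesis
  proof eventually_elim
    case (elim \<omega>)
    have "\<exists>t\<ge>0. a \<le> X t \<omega>" for a
    proof -
      obtain k :: nat where k: "a \<le> real k" using real_arch_simple by blast
      obtain n :: nat where n: "real k < X (real n) \<omega>" using elim(3) by blast
      show ?thesis using k n by (intro exI[of _ "real n"]) simp
    qed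
    then show ?case using elim(1,2) by (simp add: subordinator_path_def)
  qed
qed

end

section \<open>Law of the first passage value\<close>

text \<open>Exactly one grid step crosses \<open>a\<close>, so a single summand survives. A
  functional of the whole walk becomes a sum of functionals of two consecutive values.\<close>

lemma suminf_grid_passage:
  fixes f :: "real \<Rightarrow> ennreal"
  assumes path: "subordinator_path F" and d: "0 < d" and a: "0 < a"
  shows "(\<Sum>n. f (F (d * real (Suc n))) * indicator {F (d * real n)<..F (d * real (Suc n))} a) = f (grid_passage d F a)"
proof -
  obtain k where k: "F (d * real k) < a" "a \<le> F (d * real (Suc k))"
    and uniq: "\<And>n. F (d * real n) < a \<and> a \<le> F (d * real (Suc n)) \<Longrightarrow> n = k"
    using grid_passage_bracket[OF path d a] by blast
  have "(\<Sum>n. f (F (d * real (Suc n))) * indicator {F (d * real n)<..F (d * real (Suc n))} a) =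
      (\<Sum>n\<in>{k}. f (F (d * real (Suc n))) * indicator {F (d * real n)<..F (d * real (Suc n))} a)"
    by (rule suminf_finite) (use uniq in \<open>auto split: split_indicator simp del: of_nat_Suc\<close>)
  also have "\<dots> = f (grid_passage d F a)"
    using k grid_passage_eq[OF path d k] by simp
  finally show ?thesis .
qed

lemma (in prob_space) expectation_eq_nn:
  assumes [measurable]: "f \<in> borel_measurable M" and "AE \<omega> in M. 0 \<le> f \<omega>"
    and "(\<integral>\<^sup>+\<omega>. ennreal (f \<omega>) \<partial>M) = ennreal r" "0 \<le> r"
  shows "expectation f = r"
  using assms by (simp add: integral_eq_nn_integral)

lemma exp_difference_quotient_tendsto:
  fixes d :: "nat \<Rightarrow> real"
  assumes d: "\<And>n. 0 < d n" "d \<longlonglongrightarrow> 0"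
  shows "(\<lambda>n. (exp (u * d n) - 1) / d n) \<longlonglongrightarrow> u"
proof -
  have "((\<lambda>x. exp (u * x)) has_real_derivative u) (at 0)"
    by (auto intro!: derivative_eq_intros)
  then have "((\<lambda>h. (exp (u * h) - 1) / h) \<longlongrightarrow> u) (at 0)"
    by (simp add: DERIV_def)
  moreover have "filterlim d (at 0) sequentially"
    using d by (auto simp: filterlim_at less_imp_neq[symmetric])
  ultimately show ?thesis by (rule filterlim_compose)
qed

text \<open>Numerator and denominator are both of first order in \<open>d n\<close>. The limit is
  free of \<open>c\<close>, which is how the unknown \<open>rate\<close> drops out of the law of the
  overshoot.\<close>

lemma exp_ratio_tendsto:
  fixes d :: "nat \<Rightarrow> real"
  assumes d: "\<And>n. 0 < d n" "d \<longlonglongrightarrow> 0" and c: "0 < c"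
  shows "(\<lambda>n. (exp (- c * q * d n) - exp (- c * d n)) / (1 - exp (- c * d n))) \<longlonglongrightarrow> 1 - q"
proof -
  have "(\<lambda>n. ((exp ((- c * q) * d n) - 1) / d n - (exp ((- c) * d n) - 1) / d n) / (- ((exp ((- c) * d n) - 1) / d n)))
      \<longlonglongrightarrow> ((- c * q) - (- c)) / (- (- c))"
    using c by (intro tendsto_divide tendsto_diff tendsto_minus exp_difference_quotient_tendsto d) simp
  moreover have "((exp ((- c * q) * d n) - 1) / d n - (exp ((- c) * d n) - 1) / d n) / (- ((exp ((- c) * d n) - 1) / d n)) =
      (exp (- c * q * d n) - exp (- c * d n)) / (1 - exp (- c * d n))" for n
  proof -
    have "(A / D - B / D) / (- (B / D)) = (A - B) / (- B)" if "0 < D" for A B D :: real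
      using that by (simp add: diff_divide_distrib[symmetric])
    from this[OF d(1), of "exp ((- c * q) * d n) - 1" n "exp ((- c) * d n) - 1"] show ?thesis by simp
  qed
  moreover have "((- c * q) - (- c)) / (- (- c)) = 1 - q" using c by (simp add: field_simps)
  ultimately show ?thesis by simp
qed

lemma inverse_Suc_tendsto_0: "(\<lambda>n. 1 / real (Suc n)) \<longlonglongrightarrow> 0"
  by (rule LIMSEQ_Suc[OF lim_1_over_n])

lemma indicator_half_open: "indicator {x<..y} a = (if x < a \<and> a \<le> y then 1 else 0)"
  by (simp add: indicator_def)

text \<open>The contribution of one step from \<open>s\<close> to \<open>u\<close>, integrated over
  the levels it crosses; the exponent is affine in the level with slope p - 1.\<close>

lemma nn_integral_exp_segment:
  assumes su: "s \<le> u" and p: "p < 1"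
  shows "(\<integral>\<^sup>+a. ennreal (exp (- a - p * (u - a))) * indicator {s<..u} a \<partial>lborel) =
    ennreal ((exp (- s - p * (u - s)) - exp (- u)) / (1 - p))"
proof -
  define F where "F a = - exp (- a - p * (u - a)) / (1 - p)" for a
  have "(\<integral>\<^sup>+a. ennreal (exp (- a - p * (u - a))) * indicator {s<..u} a \<partial>lborel) =
      (\<integral>\<^sup>+a. ennreal (exp (- a - p * (u - a))) * indicator {s..u} a \<partial>lborel)"
    using AE_lborel_singleton[of s] by (intro nn_integral_cong_AE) (auto elim!: eventually_mono split: split_indicator)
  also have "\<dots> = ennreal (F u - F s)"
  proof (rule nn_integral_FTC_Icc)
    fix a
    have "(F has_real_derivative - (exp (- a - p * (u - a)) * (- 1 + p)) / (1 - p)) (at a)"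
      unfolding F_def by (rule derivative_eq_intros refl | use p in simp)+
    moreover have "- (exp (- a - p * (u - a)) * (- 1 + p)) / (1 - p) = exp (- a - p * (u - a))"
      using p by (simp add: field_simps)
    ultimately show "(F has_real_derivative exp (- a - p * (u - a))) (at a)" by simp
  qed (use su in auto)
  also have "F u - F s = (exp (- s - p * (u - s)) - exp (- u)) / (1 - p)"
    by (simp add: F_def diff_divide_distrib)
  finally show ?thesis .
qed

lemma nn_integral_exp_atLeast_0:
  assumes "0 < q"
  shows "(\<integral>\<^sup>+a. ennreal (exp (- (q * a))) * indicator {0<..} a \<partial>lborel) = ennreal (1 / q)"
proof -
  have "(\<integral>\<^sup>+a. ennreal (exp (- (q * a))) * indicator {0<..} a \<partial>lborel) =
      (\<integral>\<^sup>+a. ennreal (exp (- (q * a))) * indicator {0..} a \<partial>lborel)"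
    using AE_lborel_singleton[of 0] by (intro nn_integral_cong_AE) (auto elim!: eventually_mono split: split_indicator)
  also have "\<dots> = ennreal (0 - (- exp (- (q * 0)) / q))"
  proof (rule nn_integral_FTC_atLeast)
    show "((\<lambda>a. - exp (- (q * a)) / q) has_real_derivative exp (- (q * x))) (at x)" for x
      by (rule derivative_eq_intros refl | use assms in simp)+
    have L: "((\<lambda>a. exp (- (q * a))) \<longlongrightarrow> 0) at_top"
      using assms
      by (intro filterlim_compose[OF exp_at_bot] filterlim_compose[OF filterlim_uminus_at_bot_at_top]
          filterlim_tendsto_pos_mult_at_top[OF tendsto_const] filterlim_ident)
    show "((\<lambda>a. - exp (- (q * a)) / q) \<longlongrightarrow> 0) at_top"
      using tendsto_divide[OF tendsto_minus[OF L] tendsto_const[of q]] assms by simp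
  qed auto
  finally show ?thesis by simp
qed

section \<open>Grid passage of the process: reduction to pairs of times, scaling, and the limit of
  fine grids\<close>

context stable_no_neg_jumps
begin

text \<open>A crossing step involves its two end times, so scaling is required for pairs of
  values.\<close>

lemma nn_integral_scaling_pair:
  fixes f :: "real \<Rightarrow> real \<Rightarrow> ennreal"
  assumes [measurable]: "case_prod f \<in> borel_measurable (borel \<Otimes>\<^sub>M borel)"
    and c: "0 < c" and st: "0 \<le> s" "0 \<le> t"
  shows "(\<integral>\<^sup>+\<omega>. f (c * X (c powr (-\<alpha>) * s) \<omega>) (c * X (c powr (-\<alpha>) * t) \<omega>) \<partial>M) =
    (\<integral>\<^sup>+\<omega>. f (X s \<omega>) (X t \<omega>) \<partial>M)"
proof -
  let ?P = "PiM {..<2::nat} (\<lambda>_. borel :: real measure)"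
  have "(\<lambda>v. (v 0, v 1)) \<in> measurable ?P (borel \<Otimes>\<^sub>M borel)"
    by (intro measurable_Pair measurable_component_singleton) auto
  then have H: "(\<lambda>v. f (v 0) (v 1)) \<in> borel_measurable ?P"
    using measurable_compose[of "\<lambda>v. (v 0, v 1)" ?P "borel \<Otimes>\<^sub>M borel" "case_prod f" borel] assms(1) by simp
  have *: "(\<integral>\<^sup>+v. f (v 0) (v 1) \<partial>distr M ?P (\<lambda>\<omega>. \<lambda>i\<in>{..<2}. g i \<omega>)) = (\<integral>\<^sup>+\<omega>. f (g 0 \<omega>) (g 1 \<omega>) \<partial>M)"
    if [measurable]: "\<And>i. g i \<in> borel_measurable M" for g
    using H by (subst nn_integral_distr) auto
  show ?thesis
    using *[of "\<lambda>i \<omega>. c * X (c powr (-\<alpha>) * (if i = 0 then s else t)) \<omega>"] *[of "\<lambda>i. X (if i = 0 then s else t)"]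
      distr_scaling_vector[OF c, of "\<lambda>i. if i = 0 then s else t" 2] st
    by simp
qed

lemma grid_passage_measurable [measurable]: "(\<lambda>\<omega>. grid_passage d (\<lambda>s. X s \<omega>) a) \<in> borel_measurable M"
  unfolding grid_passage_def by measurable

text \<open>A measurable version of the first passage value; the limit exists almost surely.\<close>

definition passage :: "real \<Rightarrow> 'a \<Rightarrow> real" where
  "passage a \<omega> = lim (\<lambda>n. grid_passage (1 / real (Suc n)) (\<lambda>s. X s \<omega>) a)"

lemma passage_measurable [measurable]: "passage a \<in> borel_measurable M"
  unfolding passage_def by (rule borel_measurable_lim_metric) measurable

lemma passage_eq:
  assumes "subordinator_path (\<lambda>s. X s \<omega>)" "0 < a"
  shows "passage a \<omega> = passage_value (\<lambda>s. X s \<omega>) a"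
  unfolding passage_def
  by (rule limI, rule grid_passage_tendsto[OF assms _ inverse_Suc_tendsto_0]) simp

end

locale nontrivial_stable = stable_no_neg_jumps +
  assumes rate_pos: "0 < rate"
begin

lemma AE_path: "AE \<omega> in M. subordinator_path (\<lambda>s. X s \<omega>)"
  by (rule AE_subordinator_path[OF rate_pos])

lemma nn_integral_grid_passage:
  fixes f :: "real \<Rightarrow> ennreal"
  assumes [measurable]: "f \<in> borel_measurable borel" and d: "0 < d" and a: "0 < a"
  shows "(\<integral>\<^sup>+\<omega>. f (grid_passage d (\<lambda>s. X s \<omega>) a) \<partial>M) =
    (\<Sum>n. \<integral>\<^sup>+\<omega>. f (X (d * real (Suc n)) \<omega>) * indicator {X (d * real n) \<omega><..X (d * real (Suc n)) \<omega>} a \<partial>M)"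
proof -
  have "(\<integral>\<^sup>+\<omega>. f (grid_passage d (\<lambda>s. X s \<omega>) a) \<partial>M) =
    (\<integral>\<^sup>+\<omega>. (\<Sum>n. f (X (d * real (Suc n)) \<omega>) * indicator {X (d * real n) \<omega><..X (d * real (Suc n)) \<omega>} a) \<partial>M)"
    using AE_path
    by (intro nn_integral_cong_AE, eventually_elim) (rule suminf_grid_passage[OF _ d a, symmetric])
  also have "\<dots> = (\<Sum>n. \<integral>\<^sup>+\<omega>. f (X (d * real (Suc n)) \<omega>) * indicator {X (d * real n) \<omega><..X (d * real (Suc n)) \<omega>} a \<partial>M)"
    unfolding indicator_half_open by (rule nn_integral_suminf) measurable
  finally show ?thesis .
qed

text \<open>Scaling with c = a, applied to each summand of the step decomposition: crossing
  \<open>a\<close> with mesh \<open>d\<close> is, in law, \<open>a\<close> times crossing 1 with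
  mesh \<open>a powr (-\<alpha>) * d\<close>.\<close>

lemma nn_integral_grid_passage_scaled:
  fixes f :: "real \<Rightarrow> ennreal"
  assumes f[measurable]: "f \<in> borel_measurable borel" and d: "0 < d" and a: "0 < a"
  shows "(\<integral>\<^sup>+\<omega>. f (grid_passage d (\<lambda>s. X s \<omega>) a) \<partial>M) =
    (\<integral>\<^sup>+\<omega>. f (a * grid_passage (a powr (-\<alpha>) * d) (\<lambda>s. X s \<omega>) 1) \<partial>M)"
proof -
  have [measurable]: "(\<lambda>x. f (a * x)) \<in> borel_measurable borel" by measurable
  have "(\<integral>\<^sup>+\<omega>. f (X (d * real (Suc n)) \<omega>) * indicator {X (d * real n) \<omega><..X (d * real (Suc n)) \<omega>} a \<partial>M) =
    (\<integral>\<^sup>+\<omega>. f (a * X (a powr (-\<alpha>) * d * real (Suc n)) \<omega>) *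
      indicator {X (a powr (-\<alpha>) * d * real n) \<omega><..X (a powr (-\<alpha>) * d * real (Suc n)) \<omega>} 1 \<partial>M)" for n
  proof -
    let ?h = "\<lambda>x y. f y * (if x < a \<and> a \<le> y then 1 else 0)"
    have "(\<lambda>z. ?h (fst z) (snd z)) \<in> borel_measurable (borel \<Otimes>\<^sub>M borel)" by measurable
    then have hm: "case_prod ?h \<in> borel_measurable (borel \<Otimes>\<^sub>M borel)" by (simp add: case_prod_beta')
    have "(\<integral>\<^sup>+\<omega>. f (X (d * real (Suc n)) \<omega>) * indicator {X (d * real n) \<omega><..X (d * real (Suc n)) \<omega>} a \<partial>M) =
        (\<integral>\<^sup>+\<omega>. ?h (X (d * real n) \<omega>) (X (d * real (Suc n)) \<omega>) \<partial>M)"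
      by (simp only: indicator_half_open)
    also have "\<dots> = (\<integral>\<^sup>+\<omega>. ?h (a * X (a powr (-\<alpha>) * (d * real n)) \<omega>) (a * X (a powr (-\<alpha>) * (d * real (Suc n))) \<omega>) \<partial>M)"
      using d a hm by (intro nn_integral_scaling_pair[symmetric]) auto
    also have "\<dots> = (\<integral>\<^sup>+\<omega>. f (a * X (a powr (-\<alpha>) * d * real (Suc n)) \<omega>) *
      indicator {X (a powr (-\<alpha>) * d * real n) \<omega><..X (a powr (-\<alpha>) * d * real (Suc n)) \<omega>} 1 \<partial>M)"
      using a by (simp add: indicator_half_open mult.assoc pos_le_divide_eq[symmetric] pos_divide_less_eq[symmetric] less_divide_eq_1)
    finally show ?thesis .
  qed
  then show ?thesis
    using nn_integral_grid_passage[OF f d a] nn_integral_grid_passage[of "\<lambda>x. f (a * x)" "a powr (-\<alpha>) * d" 1] a d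
    by simp
qed

text \<open>Pathwise convergence under dominated convergence. Passage values lie in [a,
  \<infinity>), so bound and continuity are asked for there; an upper bound dominates because
  \<open>ennreal\<close> maps negative numbers to 0.\<close>

lemma nn_integral_passage_tendsto:
  fixes f :: "real \<Rightarrow> real"
  assumes [measurable]: "f \<in> borel_measurable borel"
    and bound: "\<And>v. a \<le> v \<Longrightarrow> f v \<le> B" and cont: "\<And>v. a \<le> v \<Longrightarrow> isCont f v"
    and a: "0 < a" and d: "\<And>n. 0 < d n" "d \<longlonglongrightarrow> 0"
  shows "(\<lambda>n. \<integral>\<^sup>+\<omega>. ennreal (f (grid_passage (d n) (\<lambda>s. X s \<omega>) a)) \<partial>M) \<longlonglongrightarrow> (\<integral>\<^sup>+\<omega>. ennreal (f (passage a \<omega>)) \<partial>M)"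
proof (rule nn_integral_dominated_convergence[where w = "\<lambda>_. ennreal B"])
  show "AE \<omega> in M. ennreal (f (grid_passage (d n) (\<lambda>s. X s \<omega>) a)) \<le> ennreal B" for n
    using AE_path by eventually_elim (rule ennreal_leI[OF bound[OF grid_passage_ge[OF _ d(1)]]])
  show "AE \<omega> in M. (\<lambda>n. ennreal (f (grid_passage (d n) (\<lambda>s. X s \<omega>) a))) \<longlonglongrightarrow> ennreal (f (passage a \<omega>))"
    using AE_path
  proof eventually_elim
    case (elim \<omega>)
    have "(\<lambda>n. grid_passage (d n) (\<lambda>s. X s \<omega>) a) \<longlonglongrightarrow> passage a \<omega>"
      unfolding passage_eq[OF elim a] by (rule grid_passage_tendsto[OF elim a d])
    moreover have "isCont f (passage a \<omega>)"
      unfolding passage_eq[OF elim a] by (rule cont[OF le_passage_value[OF elim]])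
    ultimately show ?case by (intro tendsto_ennrealI isCont_tendsto_compose[of _ f])
  qed
qed (auto simp: emeasure_space_1 ennreal_mult_less_top)

text \<open>Both meshes in the scaled grid identity tend to 0, one side leading to the passage over
  \<open>a\<close>, the other to the passage over 1.\<close>

lemma nn_integral_passage_scaled:
  fixes f :: "real \<Rightarrow> real"
  assumes [measurable]: "f \<in> borel_measurable borel"
    and bound: "\<And>v. 1 \<le> v \<Longrightarrow> f v \<le> B" and cont: "\<And>v. 1 \<le> v \<Longrightarrow> isCont f v" and a: "0 < a"
  shows "(\<integral>\<^sup>+\<omega>. ennreal (f (passage a \<omega> / a)) \<partial>M) = (\<integral>\<^sup>+\<omega>. ennreal (f (passage 1 \<omega>)) \<partial>M)"
proof -
  define d where "d n = 1 / real (Suc n)" for n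
  have d: "\<And>n. 0 < d n" "d \<longlonglongrightarrow> 0"
    unfolding d_def[abs_def] by (simp, rule inverse_Suc_tendsto_0)
  have d': "0 < a powr (-\<alpha>) * d n" for n using a d by simp
  have d'': "(\<lambda>n. a powr (-\<alpha>) * d n) \<longlonglongrightarrow> 0"
    using tendsto_mult_right_zero[OF d(2)] by simp
  have "(\<lambda>n. \<integral>\<^sup>+\<omega>. ennreal (f (grid_passage (d n) (\<lambda>s. X s \<omega>) a / a)) \<partial>M) \<longlonglongrightarrow> (\<integral>\<^sup>+\<omega>. ennreal (f (passage a \<omega> / a)) \<partial>M)"
  proof (rule nn_integral_passage_tendsto[where f = "\<lambda>v. f (v / a)" and B = B])
    fix v assume v: "a \<le> v"
    then have v1: "1 \<le> v / a" using a by simp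
    show "f (v / a) \<le> B" using v1 by (rule bound)
    show "isCont (\<lambda>v. f (v / a)) v"
      by (rule isCont_o2[where f = "\<lambda>v. v / a" and g = f, OF _ cont[OF v1]]) (use a in \<open>auto intro!: continuous_intros\<close>)
  qed (use a d in auto)
  moreover have "(\<integral>\<^sup>+\<omega>. ennreal (f (grid_passage (d n) (\<lambda>s. X s \<omega>) a / a)) \<partial>M) =
      (\<integral>\<^sup>+\<omega>. ennreal (f (grid_passage (a powr (-\<alpha>) * d n) (\<lambda>s. X s \<omega>) 1)) \<partial>M)" for n
    using nn_integral_grid_passage_scaled[of "\<lambda>x. ennreal (f (x / a))" "d n" a] d a by simp
  moreover have "(\<lambda>n. \<integral>\<^sup>+\<omega>. ennreal (f (grid_passage (a powr (-\<alpha>) * d n) (\<lambda>s. X s \<omega>) 1)) \<partial>M)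
      \<longlonglongrightarrow> (\<integral>\<^sup>+\<omega>. ennreal (f (passage 1 \<omega>)) \<partial>M)"
    by (rule nn_integral_passage_tendsto[where B = B]) (use bound cont d' d'' in auto)
  ultimately show ?thesis by (simp add: LIMSEQ_unique)
qed

text \<open>Exactly one step \<open>(X (d n), X (d (n + 1))]\<close> contains \<open>a\<close>; summing over \<open>n\<close>, independence of the
  increments yields a geometric series.\<close>

lemma laplace_grid_overshoot:
  assumes p: "0 < p" "p < 1" and d: "0 < d"
  shows "(\<integral>\<^sup>+a. (\<integral>\<^sup>+\<omega>. ennreal (exp (- a - p * (grid_passage d (\<lambda>s. X s \<omega>) a - a))) \<partial>M) * indicator {0<..} a \<partial>lborel)
    = ennreal ((exp (- rate * p powr \<alpha> * d) - exp (- rate * d)) / ((1 - p) * (1 - exp (- rate * d))))"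
proof -
  \<comment> \<open>The share of the n-th grid step in the overshoot transform at level
    \<open>a\<close>.\<close>
  define T where "T n a \<omega> = ennreal (exp (- a - p * (X (d * real (Suc n)) \<omega> - a))) *
    indicator {X (d * real n) \<omega><..X (d * real (Suc n)) \<omega>} a" for n a \<omega>
  have T_if: "T n a \<omega> = ennreal (exp (- a - p * (X (d * real (Suc n)) \<omega> - a))) *
    (if X (d * real n) \<omega> < a \<and> a \<le> X (d * real (Suc n)) \<omega> then 1 else 0)" for n a \<omega>
    by (simp only: T_def indicator_half_open)
  have [measurable]: "(\<lambda>z. T n (fst z) (snd z)) \<in> borel_measurable (lborel \<Otimes>\<^sub>M M)" for n
    unfolding T_if by measurable
  have [measurable]: "(\<lambda>z. T n (snd z) (fst z)) \<in> borel_measurable (M \<Otimes>\<^sub>M lborel)" for n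
    unfolding T_if by measurable
  interpret P: pair_sigma_finite M lborel ..
  have "(\<integral>\<^sup>+\<omega>. ennreal (exp (- a - p * (grid_passage d (\<lambda>s. X s \<omega>) a - a))) \<partial>M) * indicator {0<..} a =
      (\<Sum>n. \<integral>\<^sup>+\<omega>. T n a \<omega> * indicator {0<..} a \<partial>M)" for a
  proof (cases "0 < a")
    case True
    then show ?thesis
      using nn_integral_grid_passage[of "\<lambda>v. ennreal (exp (- a - p * (v - a)))", OF _ d True]
      by (simp add: T_def)
  qed simp
  then have "(\<integral>\<^sup>+a. (\<integral>\<^sup>+\<omega>. ennreal (exp (- a - p * (grid_passage d (\<lambda>s. X s \<omega>) a - a))) \<partial>M) * indicator {0<..} a \<partial>lborel) =
      (\<integral>\<^sup>+a. (\<Sum>n. \<integral>\<^sup>+\<omega>. T n a \<omega> * indicator {0<..} a \<partial>M) \<partial>lborel)" by simp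
  also have "\<dots> = (\<Sum>n. \<integral>\<^sup>+a. \<integral>\<^sup>+\<omega>. T n a \<omega> * indicator {0<..} a \<partial>M \<partial>lborel)"
    by (rule nn_integral_suminf) measurable
  \<comment> \<open>With the path fixed, the level runs over the explicit interval between two
    consecutive values of the walk, so it is integrated before the expectation is taken.\<close>
  also have "\<dots> = (\<Sum>n. \<integral>\<^sup>+\<omega>. \<integral>\<^sup>+a. T n a \<omega> * indicator {0<..} a \<partial>lborel \<partial>M)"
    by (intro suminf_cong P.Fubini') measurable
  also have "\<dots> = (\<Sum>n. ennreal (exp (- rate * d) ^ n * ((exp (- rate * p powr \<alpha> * d) - exp (- rate * d)) / (1 - p))))"
  proof (rule suminf_cong)
    fix n
    define s where "s = d * real n"
    have s: "0 \<le> s" "d * real (Suc n) = s + d" using d by (simp_all add: s_def algebra_simps)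
    have "(\<integral>\<^sup>+\<omega>. \<integral>\<^sup>+a. T n a \<omega> * indicator {0<..} a \<partial>lborel \<partial>M) =
        (\<integral>\<^sup>+\<omega>. ennreal ((exp (- X s \<omega> - p * (X (s + d) \<omega> - X s \<omega>)) - exp (- X (s + d) \<omega>)) / (1 - p)) \<partial>M)"
    proof (rule nn_integral_cong_AE)
      show "AE \<omega> in M. (\<integral>\<^sup>+a. T n a \<omega> * indicator {0<..} a \<partial>lborel) =
        ennreal ((exp (- X s \<omega> - p * (X (s + d) \<omega> - X s \<omega>)) - exp (- X (s + d) \<omega>)) / (1 - p))"
        using AE_path
      proof eventually_elim
        case (elim \<omega>)
        have 0: "0 \<le> X s \<omega>" "X s \<omega> \<le> X (s + d) \<omega>"
          using path_mono[OF elim, of 0 s] path_mono[OF elim, of s "s + d"] elim s d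
          by (auto simp: subordinator_path_def)
        have "(\<integral>\<^sup>+a. T n a \<omega> * indicator {0<..} a \<partial>lborel) =
          (\<integral>\<^sup>+a. ennreal (exp (- a - p * (X (s + d) \<omega> - a))) * indicator {X s \<omega><..X (s + d) \<omega>} a \<partial>lborel)"
          using 0 unfolding T_def s(2) s_def[symmetric] by (intro nn_integral_cong) (auto split: split_indicator)
        also have "\<dots> = ennreal ((exp (- X s \<omega> - p * (X (s + d) \<omega> - X s \<omega>)) - exp (- X (s + d) \<omega>)) / (1 - p))"
          using 0 p by (intro nn_integral_exp_segment)
        finally show ?case .
      qed
    qed
    also have "\<dots> = (\<integral>\<^sup>+\<omega>. (ennreal (exp (- X s \<omega> - p * (X (s + d) \<omega> - X s \<omega>))) - ennreal (exp (- X (s + d) \<omega>))) / ennreal (1 - p) \<partial>M)"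
    proof (rule nn_integral_cong_AE)
      show "AE \<omega> in M. ennreal ((exp (- X s \<omega> - p * (X (s + d) \<omega> - X s \<omega>)) - exp (- X (s + d) \<omega>)) / (1 - p)) =
        (ennreal (exp (- X s \<omega> - p * (X (s + d) \<omega> - X s \<omega>))) - ennreal (exp (- X (s + d) \<omega>))) / ennreal (1 - p)"
        using AE_path
      proof eventually_elim
        case (elim \<omega>)
        have "p * (X (s + d) \<omega> - X s \<omega>) \<le> 1 * (X (s + d) \<omega> - X s \<omega>)"
          using path_mono[OF elim, of s "s + d"] s d p by (intro mult_right_mono) auto
        then have "exp (- X (s + d) \<omega>) \<le> exp (- X s \<omega> - p * (X (s + d) \<omega> - X s \<omega>))" by simp
        then show ?case using p by (simp add: divide_ennreal[symmetric] ennreal_minus)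
      qed
    qed
    also have "\<dots> = (\<integral>\<^sup>+\<omega>. ennreal (exp (- X s \<omega> - p * (X (s + d) \<omega> - X s \<omega>))) - ennreal (exp (- X (s + d) \<omega>)) \<partial>M) / ennreal (1 - p)"
      by (rule nn_integral_divide) measurable
    also have "(\<integral>\<^sup>+\<omega>. ennreal (exp (- X s \<omega> - p * (X (s + d) \<omega> - X s \<omega>))) - ennreal (exp (- X (s + d) \<omega>)) \<partial>M) =
      (\<integral>\<^sup>+\<omega>. ennreal (exp (- X s \<omega> - p * (X (s + d) \<omega> - X s \<omega>))) \<partial>M) - (\<integral>\<^sup>+\<omega>. ennreal (exp (- X (s + d) \<omega>)) \<partial>M)"
    proof (rule nn_integral_diff)
      show "(\<integral>\<^sup>+\<omega>. ennreal (exp (- X (s + d) \<omega>)) \<partial>M) \<noteq> \<infinity>" using laplace_nn[of "s + d"] s d by simp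
      show "AE \<omega> in M. ennreal (exp (- X (s + d) \<omega>)) \<le> ennreal (exp (- X s \<omega> - p * (X (s + d) \<omega> - X s \<omega>)))"
        using AE_path
      proof eventually_elim
        case (elim \<omega>)
        have "p * (X (s + d) \<omega> - X s \<omega>) \<le> 1 * (X (s + d) \<omega> - X s \<omega>)"
          using path_mono[OF elim, of s "s + d"] s d p by (intro mult_right_mono) auto
        then show ?case by (intro ennreal_leI) simp
      qed
    qed measurable
    also have "\<dots> = ennreal (laplace s * laplace (p powr \<alpha> * d) - laplace (s + d))"
      using laplace_increment_nn[OF p(1) s(1) d] laplace_nn[of "s + d"] s d
      by (simp add: ennreal_minus laplace_nonneg)
    also have "\<dots> / ennreal (1 - p) = ennreal ((laplace s * laplace (p powr \<alpha> * d) - laplace (s + d)) / (1 - p))"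
    proof (rule divide_ennreal)
      have "p powr \<alpha> * d \<le> 1 * d" using p \<alpha> d by (intro mult_right_mono powr_le1) auto
      then have "laplace d \<le> laplace (p powr \<alpha> * d)" using d rate_pos by (simp add: laplace_eq)
      then have "laplace s * laplace d \<le> laplace s * laplace (p powr \<alpha> * d)"
        by (intro mult_left_mono laplace_nonneg)
      then show "0 \<le> laplace s * laplace (p powr \<alpha> * d) - laplace (s + d)"
        using s d by (simp add: laplace_add)
    qed (use p in simp)
    also have "laplace s = exp (- rate * d) ^ n"
      using s by (simp add: laplace_eq s_def exp_of_nat_mult[symmetric] mult_ac)
    also have "laplace (s + d) = exp (- rate * d) ^ n * exp (- rate * d)"
      using s d \<open>laplace s = exp (- rate * d) ^ n\<close> by (simp add: laplace_add) (simp add: laplace_eq)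
    also have "laplace (p powr \<alpha> * d) = exp (- rate * p powr \<alpha> * d)"
      using d by (simp add: laplace_eq mult_ac)
    finally show "(\<integral>\<^sup>+\<omega>. \<integral>\<^sup>+a. T n a \<omega> * indicator {0<..} a \<partial>lborel \<partial>M) =
      ennreal (exp (- rate * d) ^ n * ((exp (- rate * p powr \<alpha> * d) - exp (- rate * d)) / (1 - p)))"
      by (simp add: algebra_simps)
  qed
  also have "\<dots> = ennreal (1 / (1 - exp (- rate * d)) * ((exp (- rate * p powr \<alpha> * d) - exp (- rate * d)) / (1 - p)))"
  proof (rule suminf_ennreal_eq)
    have "p powr \<alpha> * d \<le> 1 * d" using p \<alpha> d by (intro mult_right_mono powr_le1) auto
    then have "rate * (p powr \<alpha> * d) \<le> rate * d" using rate_pos by (intro mult_left_mono) auto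
    then show "0 \<le> exp (- rate * d) ^ n * ((exp (- rate * p powr \<alpha> * d) - exp (- rate * d)) / (1 - p))" for n
      using p by (simp add: mult.assoc)
    show "(\<lambda>n. exp (- rate * d) ^ n * ((exp (- rate * p powr \<alpha> * d) - exp (- rate * d)) / (1 - p)))
      sums (1 / (1 - exp (- rate * d)) * ((exp (- rate * p powr \<alpha> * d) - exp (- rate * d)) / (1 - p)))"
      using rate_pos d by (intro sums_mult2 geometric_sums) simp
  qed
  finally show ?thesis by (simp add: mult_ac)
qed

lemma AE_passage_ge: "0 < a \<Longrightarrow> AE \<omega> in M. a \<le> passage a \<omega>"
  using AE_path by eventually_elim (simp add: passage_eq le_passage_value)

lemma grid_passage_measurable_pair [measurable]:
  "(\<lambda>z. grid_passage d (\<lambda>s. X s (snd z)) (fst z)) \<in> borel_measurable (borel \<Otimes>\<^sub>M M)"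
  unfolding grid_passage_def by measurable

text \<open>The mesh tends to 0 in \<open>laplace_grid_overshoot\<close>. On the left, scaling
  replaces the passage over \<open>a\<close> by \<open>a\<close> times the passage over 1, and
  integrating exp (- (1 + p (V - 1)) a) over the level leaves the reciprocal of its rate; on the
  right, a ratio of difference quotients converges.\<close>

lemma overshoot_Stieltjes:
  assumes p: "0 < p" "p < 1"
  shows "(\<integral>\<^sup>+\<omega>. ennreal (1 / (1 + p * (passage 1 \<omega> - 1))) \<partial>M) = ennreal ((1 - p powr \<alpha>) / (1 - p))"
proof -
  define d where "d n = 1 / real (Suc n)" for n
  have d: "\<And>n. 0 < d n" "d \<longlonglongrightarrow> 0"
    unfolding d_def[abs_def] by (simp, rule inverse_Suc_tendsto_0)
  define J where "J n a = (\<integral>\<^sup>+\<omega>. ennreal (exp (- a - p * (grid_passage (d n) (\<lambda>s. X s \<omega>) a - a))) \<partial>M) * indicator {0<..} a" for n a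
  define U where "U a = (\<integral>\<^sup>+\<omega>. ennreal (exp (- ((1 + p * (passage 1 \<omega> - 1)) * a))) \<partial>M) * indicator {0<..} a" for a
  have J_meas: "J n \<in> borel_measurable lborel" for n
  proof -
    have "(\<lambda>z. ennreal (exp (- fst z - p * (grid_passage (d n) (\<lambda>s. X s (snd z)) (fst z) - fst z)))) \<in> borel_measurable (borel \<Otimes>\<^sub>M M)"
      by measurable
    from borel_measurable_nn_integral_fst[OF this] show ?thesis
      unfolding J_def[abs_def] by simp
  qed
  have U_pair: "(\<lambda>(\<omega>, a). ennreal (exp (- ((1 + p * (passage 1 \<omega> - 1)) * a))) * indicator {0<..} a) \<in> borel_measurable (M \<Otimes>\<^sub>M lborel)"
    by measurable
  have U_meas: "U \<in> borel_measurable lborel"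
    unfolding U_def[abs_def] by measurable
  have "(\<lambda>n. \<integral>\<^sup>+a. J n a \<partial>lborel) \<longlonglongrightarrow> (\<integral>\<^sup>+a. U a \<partial>lborel)"
  \<comment> \<open>Overshoots are nonnegative, so exp (- a) dominates; the factor 1 fits it to
    \<open>nn_integral_exp_atLeast_0\<close>.\<close>
  proof (rule nn_integral_dominated_convergence[where w = "\<lambda>a. ennreal (exp (- (1 * a))) * indicator {0<..} a"])
    show "AE a in lborel. J n a \<le> ennreal (exp (- (1 * a))) * indicator {0<..} a" for n
    proof (rule AE_I2)
      fix a :: real
      show "J n a \<le> ennreal (exp (- (1 * a))) * indicator {0<..} a"
      proof (cases "0 < a")
        case True
        have "(\<integral>\<^sup>+\<omega>. ennreal (exp (- a - p * (grid_passage (d n) (\<lambda>s. X s \<omega>) a - a))) \<partial>M) \<le> (\<integral>\<^sup>+\<omega>. ennreal (exp (- (1 * a))) \<partial>M)"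
        proof (rule nn_integral_mono_AE)
          show "AE \<omega> in M. ennreal (exp (- a - p * (grid_passage (d n) (\<lambda>s. X s \<omega>) a - a))) \<le> ennreal (exp (- (1 * a)))"
            using AE_path
          proof eventually_elim
            case (elim \<omega>)
            have "0 \<le> p * (grid_passage (d n) (\<lambda>s. X s \<omega>) a - a)"
              using grid_passage_ge[OF elim d(1), of a n] p by simp
            then show ?case by (intro ennreal_leI) simp
          qed
        qed
        then show ?thesis using True by (simp add: J_def emeasure_space_1)
      qed (simp add: J_def)
    qed
    show "(\<integral>\<^sup>+a. ennreal (exp (- (1 * a))) * indicator {0<..} a \<partial>lborel) < \<infinity>"
      by (subst nn_integral_exp_atLeast_0) auto
    show "AE a in lborel. (\<lambda>n. J n a) \<longlonglongrightarrow> U a"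
    proof (rule AE_I2)
      fix a :: real
      show "(\<lambda>n. J n a) \<longlonglongrightarrow> U a"
      proof (cases "0 < a")
        case True
        let ?f = "\<lambda>v. exp (- a - p * (v - a))" and ?g = "\<lambda>v. exp (- a - p * (a * v - a))"
        have "(\<lambda>n. \<integral>\<^sup>+\<omega>. ennreal (?f (grid_passage (d n) (\<lambda>s. X s \<omega>) a)) \<partial>M) \<longlonglongrightarrow> (\<integral>\<^sup>+\<omega>. ennreal (?f (passage a \<omega>)) \<partial>M)"
        proof (rule nn_integral_passage_tendsto[where B = "exp (- a)"])
          show "?f v \<le> exp (- a)" if "a \<le> v" for v
            using that p by simp
          show "isCont ?f v" for v by (intro continuous_intros)
        qed (use True d in auto)
        also have "(\<integral>\<^sup>+\<omega>. ennreal (?f (passage a \<omega>)) \<partial>M) = (\<integral>\<^sup>+\<omega>. ennreal (?g (passage a \<omega> / a)) \<partial>M)"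
          using True by simp
        also have "\<dots> = (\<integral>\<^sup>+\<omega>. ennreal (?g (passage 1 \<omega>)) \<partial>M)"
        proof (rule nn_integral_passage_scaled[where B = "exp (- a)"])
          show "?g v \<le> exp (- a)" if "1 \<le> v" for v
            using that True p by simp
          show "isCont ?g v" for v by (intro continuous_intros)
        qed (use True in auto)
        also have "\<dots> = U a" using True by (simp add: U_def algebra_simps)
        finally show ?thesis using True by (simp add: J_def)
      qed (simp add: J_def U_def)
    qed
  qed (use J_meas U_meas in auto)
  moreover have "(\<lambda>n. \<integral>\<^sup>+a. J n a \<partial>lborel) \<longlonglongrightarrow> ennreal ((1 - p powr \<alpha>) / (1 - p))"
  proof -
    have "(\<lambda>n. (exp (- rate * p powr \<alpha> * d n) - exp (- rate * d n)) / (1 - exp (- rate * d n)) / (1 - p)) \<longlonglongrightarrow> (1 - p powr \<alpha>) / (1 - p)"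
      using p by (intro tendsto_divide exp_ratio_tendsto d rate_pos tendsto_const) simp
    then have "(\<lambda>n. ennreal ((exp (- rate * p powr \<alpha> * d n) - exp (- rate * d n)) / (1 - exp (- rate * d n)) / (1 - p))) \<longlonglongrightarrow> ennreal ((1 - p powr \<alpha>) / (1 - p))"
      by (rule tendsto_ennrealI)
    then show ?thesis
      unfolding J_def laplace_grid_overshoot[OF p d(1)] by (simp add: mult.commute)
  qed
  ultimately have "(\<integral>\<^sup>+a. U a \<partial>lborel) = ennreal ((1 - p powr \<alpha>) / (1 - p))"
    by (rule LIMSEQ_unique)
  moreover have "(\<integral>\<^sup>+a. U a \<partial>lborel) = (\<integral>\<^sup>+\<omega>. ennreal (1 / (1 + p * (passage 1 \<omega> - 1))) \<partial>M)"
  proof -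
    interpret P: pair_sigma_finite M lborel ..
    have "(\<integral>\<^sup>+a. U a \<partial>lborel) = (\<integral>\<^sup>+a. \<integral>\<^sup>+\<omega>. ennreal (exp (- ((1 + p * (passage 1 \<omega> - 1)) * a))) * indicator {0<..} a \<partial>M \<partial>lborel)"
      unfolding U_def by (intro nn_integral_cong nn_integral_multc[symmetric]) measurable
    also have "\<dots> = (\<integral>\<^sup>+\<omega>. \<integral>\<^sup>+a. ennreal (exp (- ((1 + p * (passage 1 \<omega> - 1)) * a))) * indicator {0<..} a \<partial>lborel \<partial>M)"
      by (rule P.Fubini'[OF U_pair])
    also have "\<dots> = (\<integral>\<^sup>+\<omega>. ennreal (1 / (1 + p * (passage 1 \<omega> - 1))) \<partial>M)"
    proof (rule nn_integral_cong_AE)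
      show "AE \<omega> in M. (\<integral>\<^sup>+a. ennreal (exp (- ((1 + p * (passage 1 \<omega> - 1)) * a))) * indicator {0<..} a \<partial>lborel) =
          ennreal (1 / (1 + p * (passage 1 \<omega> - 1)))"
        using AE_passage_ge[of 1, OF zero_less_one]
      proof eventually_elim
        case (elim \<omega>)
        then have "0 \<le> p * (passage 1 \<omega> - 1)" using p by simp
        then show ?case by (intro nn_integral_exp_atLeast_0) simp
      qed
    qed
    finally show ?thesis .
  qed
  ultimately show ?thesis by simp
qed

text \<open>For W = 1 - 1 / V, p = 1 - z and S = 1 / (1 + p (V - 1)) one has 1 / (1 - z W) = (1 - z
  S) / (1 - z), so the mean of S gives the generating function (1 - z) powr (\<alpha> - 1). This
  settles level 1; scaling, for a bounded continuous function, carries it to level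
  \<open>a\<close>.\<close>

lemma distr_passage:
  assumes a: "0 < a"
  shows "distr M borel (\<lambda>\<omega>. 1 - a / passage a \<omega>) = arcsine_law \<alpha>"
proof (rule distr_eq_arcsine_law[OF \<alpha>])
  show "(\<lambda>\<omega>. 1 - a / passage a \<omega>) \<in> borel_measurable M" by measurable
  show "AE \<omega> in M. 0 \<le> 1 - a / passage a \<omega> \<and> 1 - a / passage a \<omega> \<le> 1"
    using AE_passage_ge[OF a] by eventually_elim (use a in auto)
  fix z :: real assume z: "0 < z" "z < 1"
  define p where "p = 1 - z"
  have p: "0 < p" "p < 1" using z by (auto simp: p_def)
  let ?f = "\<lambda>v. 1 / (1 - z * (1 - 1 / v))"
  have pos: "1 - z \<le> 1 - z * (1 - 1 / v)" if "1 \<le> v" for v :: real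
  proof -
    have "z * (1 - 1 / v) \<le> z * 1" using z that by (intro mult_left_mono) auto
    then show ?thesis by simp
  qed
  define S where "S \<omega> = 1 / (1 + p * (passage 1 \<omega> - 1))" for \<omega>
  have [measurable]: "S \<in> borel_measurable M" unfolding S_def by measurable
  have V: "AE \<omega> in M. 1 \<le> passage 1 \<omega>" by (rule AE_passage_ge) simp
  have S01: "AE \<omega> in M. 0 \<le> S \<omega> \<and> S \<omega> \<le> 1"
    using V
  proof eventually_elim
    case (elim \<omega>)
    then have "0 \<le> p * (passage 1 \<omega> - 1)" using p by simp
    then show ?case by (simp add: S_def)
  qed
  have pa: "p powr \<alpha> \<le> 1" using p \<alpha> by (intro powr_le1) auto
  have ES: "expectation S = (1 - p powr \<alpha>) / (1 - p)"
  proof (rule expectation_eq_nn)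
    show "(\<integral>\<^sup>+\<omega>. ennreal (S \<omega>) \<partial>M) = ennreal ((1 - p powr \<alpha>) / (1 - p))"
      unfolding S_def by (rule overshoot_Stieltjes[OF p])
    show "0 \<le> (1 - p powr \<alpha>) / (1 - p)" using pa p by simp
    show "AE \<omega> in M. 0 \<le> S \<omega>" using S01 by eventually_elim simp
  qed simp
  have intS: "integrable M S"
    using S01 by (intro integrable_const_bound[of _ 1]) (auto elim: eventually_mono)
  have "expectation (\<lambda>\<omega>. ?f (passage 1 \<omega>)) = expectation (\<lambda>\<omega>. (1 - z * S \<omega>) / (1 - z))"
  proof (rule integral_cong_AE)
    show "AE \<omega> in M. ?f (passage 1 \<omega>) = (1 - z * S \<omega>) / (1 - z)"
      using V
    proof eventually_elim
      case (elim \<omega>)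
      define v where "v = passage 1 \<omega>"
      have v: "1 \<le> v" using elim by (simp add: v_def)
      have "0 \<le> p * (v - 1)" using p v by simp
      then have D: "0 < 1 + p * (v - 1)" by linarith
      have "1 - z * (1 - 1 / v) = (1 + p * (v - 1)) / v" using v by (simp add: p_def field_simps)
      then have "?f v = v / (1 + p * (v - 1))" by simp
      moreover have "(1 - z * (1 / (1 + p * (v - 1)))) / (1 - z) = (1 + p * (v - 1) - z) / (1 + p * (v - 1)) / p"
        using D by (simp add: p_def diff_divide_distrib)
      moreover have "1 + p * (v - 1) - z = p * v" by (simp add: p_def algebra_simps)
      ultimately show ?case using p by (simp add: S_def v_def)
    qed
  qed measurable
  also have "\<dots> = (1 - z * expectation S) / (1 - z)"
    using intS by (simp add: prob_space)
  also have "\<dots> = (1 - z) powr (\<alpha> - 1)"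
    unfolding ES using p by (simp add: p_def powr_diff)
  finally have E1: "expectation (\<lambda>\<omega>. ?f (passage 1 \<omega>)) = (1 - z) powr (\<alpha> - 1)" .
  have "(\<integral>\<^sup>+\<omega>. ennreal (?f (passage a \<omega> / a)) \<partial>M) = (\<integral>\<^sup>+\<omega>. ennreal (?f (passage 1 \<omega>)) \<partial>M)"
  proof (rule nn_integral_passage_scaled[where B = "1 / (1 - z)"])
    show "?f v \<le> 1 / (1 - z)" if "1 \<le> v" for v
      using pos[OF that] z by (intro frac_le) auto
    show "isCont ?f v" if "1 \<le> v" for v
    proof -
      have "1 - z * (1 - 1 / v) \<noteq> 0" using pos[OF that] z by linarith
      then show ?thesis using that by (intro continuous_intros) auto
    qed
  qed (use a in auto)
  also have "(\<integral>\<^sup>+\<omega>. ennreal (?f (passage 1 \<omega>)) \<partial>M) = ennreal (expectation (\<lambda>\<omega>. ?f (passage 1 \<omega>)))"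
  proof (rule nn_integral_eq_integral)
    have b: "AE \<omega> in M. 0 \<le> ?f (passage 1 \<omega>) \<and> ?f (passage 1 \<omega>) \<le> 1 / (1 - z)"
      using V
    proof eventually_elim
      case (elim \<omega>)
      note P = pos[OF elim]
      then have "0 < 1 - z * (1 - 1 / passage 1 \<omega>)" using z by linarith
      with P z show ?case by (intro conjI frac_le) auto
    qed
    then show "AE \<omega> in M. 0 \<le> ?f (passage 1 \<omega>)" by eventually_elim simp
    show "integrable M (\<lambda>\<omega>. ?f (passage 1 \<omega>))"
      using b by (intro integrable_const_bound[of _ "1 / (1 - z)"]) (auto elim: eventually_mono)
  qed
  finally have nn: "(\<integral>\<^sup>+\<omega>. ennreal (?f (passage a \<omega> / a)) \<partial>M) = ennreal ((1 - z) powr (\<alpha> - 1))"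
    unfolding E1 .
  have "expectation (\<lambda>\<omega>. ?f (passage a \<omega> / a)) = (1 - z) powr (\<alpha> - 1)"
  proof (rule expectation_eq_nn[OF _ _ nn])
    show "AE \<omega> in M. 0 \<le> ?f (passage a \<omega> / a)"
      using AE_passage_ge[OF a]
    proof eventually_elim
      case (elim \<omega>)
      then have "1 \<le> passage a \<omega> / a" using a by simp
      from pos[OF this] z have "0 < 1 - z * (1 - 1 / (passage a \<omega> / a))" by linarith
      then show ?case by simp
    qed
  qed simp_all
  then show "expectation (\<lambda>\<omega>. 1 / (1 - z * (1 - a / passage a \<omega>))) = (1 - z) powr (\<alpha> - 1)" by simp
qed

text \<open>V > a + 2 means 1 - a / V > 2 / (a + 2) = r / (1 + r) with r = 2 / a, the upper limit of
  the integral in \<open>h_inv\<close> at - 1 - a. The second claim holds because the Beta law has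
  no atoms.\<close>

lemma prob_passage:
  assumes a: "0 < a"
  shows "prob {\<omega> \<in> space M. a + 2 < passage a \<omega>} = h_inv \<alpha> (- 1 - a)"
    and "AE \<omega> in M. passage a \<omega> \<noteq> a + 2"
proof -
  have r: "(2 / a) / (1 + 2 / a) = 2 / (a + 2)" using a by (simp add: field_simps)
  have iff: "2 / (a + 2) < 1 - a / v \<longleftrightarrow> a + 2 < v" "1 - a / v = 2 / (a + 2) \<longleftrightarrow> v = a + 2" if "a \<le> v" for v
  proof -
    have v: "0 < v" using a that by simp
    define N where "N = v * (a + 2)"
    have N: "0 < N" using v a by (simp add: N_def)
    have "1 - a / v - 2 / (a + 2) = a * (v - (a + 2)) / N"
      using v a by (simp add: N_def field_simps)
    then have e: "1 - a / v = 2 / (a + 2) + a * (v - (a + 2)) / N" by linarith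
    show "2 / (a + 2) < 1 - a / v \<longleftrightarrow> a + 2 < v"
      unfolding e using N a by (simp add: zero_less_divide_iff zero_less_mult_iff)
    show "1 - a / v = 2 / (a + 2) \<longleftrightarrow> v = a + 2"
      unfolding e using N a by auto
  qed
  have "prob {\<omega> \<in> space M. a + 2 < passage a \<omega>} = prob {\<omega> \<in> space M. 2 / (a + 2) < 1 - a / passage a \<omega>}"
  proof (rule measure_eq_AE)
    show "AE \<omega> in M. (\<omega> \<in> {\<omega> \<in> space M. a + 2 < passage a \<omega>}) = (\<omega> \<in> {\<omega> \<in> space M. 2 / (a + 2) < 1 - a / passage a \<omega>})"
      using AE_passage_ge[OF a] by eventually_elim (simp add: iff)
  qed measurable
  also have "\<dots> = measure (distr M borel (\<lambda>\<omega>. 1 - a / passage a \<omega>)) {2 / (a + 2)<..}"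
    by (subst measure_distr) (auto intro!: arg_cong[where f = prob])
  also have "\<dots> = 1 - sin (pi * \<alpha>) / pi * (LBINT s:{0..2 / a}. s powr (-\<alpha>) / (1 + s))"
    unfolding distr_passage[OF a] using measure_arcsine_law_greater[OF \<alpha>, of "2 / a"] a r by simp
  also have "\<dots> = h_inv \<alpha> (- 1 - a)" using a by (simp add: h_inv_def)
  finally show "prob {\<omega> \<in> space M. a + 2 < passage a \<omega>} = h_inv \<alpha> (- 1 - a)" .
  interpret D: real_distribution "arcsine_law \<alpha>" by (rule real_distribution_arcsine_law[OF \<alpha>])
  have "AE w in arcsine_law \<alpha>. w \<notin> {2 / (a + 2)}"
    by (intro AE_not_in) (auto simp: null_sets_def D.emeasure_eq_measure measure_arcsine_law_singleton[OF \<alpha>])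
  then have "AE \<omega> in M. 1 - a / passage a \<omega> \<notin> {2 / (a + 2)}"
    unfolding distr_passage[OF a, symmetric] by (subst (asm) AE_distr_iff) auto
  with AE_passage_ge[OF a] show "AE \<omega> in M. passage a \<omega> \<noteq> a + 2"
    by eventually_elim (simp add: iff)
qed

section \<open>Invariance\<close>

text \<open>Used twice: with y = x at time 0 for a fresh copy started at x, and with y = 0 at time
  \<open>t\<close> for the original path. Seen from \<open>y\<close>, the level is a - y. The index
  \<open>Suc n\<close> avoids the mesh 1/0.\<close>

lemma AE_grid_avoids_eventually_iff:
  assumes t: "0 \<le> t" and ty: "AE \<omega> in M. y + X t \<omega> < a \<longrightarrow> passage (a - y) \<omega> \<noteq> a - y + 2" and a: "0 < a - y"
  shows "AE \<omega> in M. y + X t \<omega> < a \<longrightarrow>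
    (\<forall>\<^sub>F n in sequentially. (\<forall>k\<le>(Suc n)^2. y + X (t + real k / real (Suc n)) \<omega> \<notin> {a..a + 2}) \<longleftrightarrow> a - y + 2 < passage (a - y) \<omega>)"
  using AE_path ty
proof eventually_elim
  case (elim \<omega>)
  show ?case
  proof
    assume lt: "y + X t \<omega> < a"
    have "\<forall>\<^sub>F n in sequentially. (\<forall>k\<le>n^2. X (t + real k / real n) \<omega> \<notin> {a - y..a - y + 2}) \<longleftrightarrow> a - y + 2 < passage (a - y) \<omega>"
      unfolding passage_eq[OF elim(1) a]
      by (rule grid_avoids_eventually_iff[OF elim(1) t]) (use lt elim(2) passage_eq[OF elim(1) a] in auto)
    then have "\<forall>\<^sub>F n in sequentially. (\<forall>k\<le>(Suc n)^2. X (t + real k / real (Suc n)) \<omega> \<notin> {a - y..a - y + 2}) \<longleftrightarrow> a - y + 2 < passage (a - y) \<omega>"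
      by (subst (asm) eventually_sequentially_Suc[symmetric])
    then show "\<forall>\<^sub>F n in sequentially. (\<forall>k\<le>(Suc n)^2. y + X (t + real k / real (Suc n)) \<omega> \<notin> {a..a + 2}) \<longleftrightarrow> a - y + 2 < passage (a - y) \<omega>"
      by eventually_elim (simp add: algebra_simps)
  qed
qed

text \<open>With the start moved to 0, the interval [-1, 1] becomes [a, a + 2] and the position at
  \<open>t\<close> is X t - 1 - a. Both integrals are limits of the probability of being below
  \<open>a\<close> at \<open>t\<close> and then avoiding [a, a + 2] on a finite grid: taken
  directly, it tends to the probability of X t < a and a passage beyond a + 2; by the Markov
  property it is the mean of \<open>u n (X t)\<close>, and \<open>u n\<close> tends to
  \<open>h\<close>.\<close>

lemma nn_integral_killed_markov:
  assumes a: "0 < a" and t: "0 \<le> t"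
  shows "(\<lambda>\<omega>. indicator {y. y < a} (X t \<omega>) * ennreal (h_inv \<alpha> (X t \<omega> - 1 - a))) \<in> borel_measurable M"
    and "(\<integral>\<^sup>+\<omega>. indicator {y. y < a} (X t \<omega>) * ennreal (h_inv \<alpha> (X t \<omega> - 1 - a)) \<partial>M) =
      (\<integral>\<^sup>+\<omega>. indicator {y. y < a} (X t \<omega>) * indicator {v. a + 2 < v} (passage a \<omega>) \<partial>M)"
proof -
  \<comment> \<open>Partial sums of the increments rebuild the path at the grid times, so avoidance
    depends on the start and a finite vector, as \<open>nn_integral_markov\<close> requires.\<close>
  define P where "P n x v \<longleftrightarrow> x < a \<and> (\<forall>k\<le>(Suc n)^2. x + (\<Sum>j<k. v j) \<notin> {a..a + 2})" for n x and v :: "nat \<Rightarrow> real"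
  define H where "H n z = (if P n (fst z) (snd z) then 1 else 0 :: ennreal)" for n z
  define W where "W n s \<omega> = (\<lambda>k\<in>{..<(Suc n)^2}. X (s + 1 / real (Suc n) * real (Suc k)) \<omega> - X (s + 1 / real (Suc n) * real k) \<omega>)" for n s \<omega>
  have W_meas [measurable]: "W n s \<in> measurable M (PiM {..<(Suc n)^2} (\<lambda>_. borel))" for n s
    unfolding W_def[abs_def] by measurable
  have H_meas [measurable]: "H n \<in> borel_measurable (borel \<Otimes>\<^sub>M PiM {..<(Suc n)^2} (\<lambda>_. borel))" for n
  proof -
    have c: "(\<lambda>z. snd z j) \<in> borel_measurable (borel \<Otimes>\<^sub>M PiM {..<(Suc n)^2} (\<lambda>_. borel :: real measure))" if "j < (Suc n)^2" for j
      by (rule measurable_compose[OF measurable_snd measurable_component_singleton]) (use that in simp)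
    have s: "(\<lambda>z. fst z + (\<Sum>j<k. snd z j)) \<in> borel_measurable (borel \<Otimes>\<^sub>M PiM {..<(Suc n)^2} (\<lambda>_. borel :: real measure))" if "k \<le> (Suc n)^2" for k
      by (intro borel_measurable_add borel_measurable_sum measurable_fst c) (use that in auto)
    have "Measurable.pred (borel \<Otimes>\<^sub>M PiM {..<(Suc n)^2} (\<lambda>_. borel :: real measure)) (\<lambda>z. \<forall>k\<in>{..(Suc n)^2}. fst z + (\<Sum>j<k. snd z j) \<notin> {a..a + 2})"
    proof (rule pred_intros_finite(3))
      fix k assume "k \<in> {..(Suc n)^2}"
      then have [measurable]: "(\<lambda>z. fst z + (\<Sum>j<k. snd z j)) \<in> borel_measurable (borel \<Otimes>\<^sub>M PiM {..<(Suc n)^2} (\<lambda>_. borel :: real measure))"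
        using s by simp
      show "Measurable.pred (borel \<Otimes>\<^sub>M PiM {..<(Suc n)^2} (\<lambda>_. borel :: real measure)) (\<lambda>z. fst z + (\<Sum>j<k. snd z j) \<notin> {a..a + 2})"
        by measurable
    qed simp
    then have [measurable]: "Measurable.pred (borel \<Otimes>\<^sub>M PiM {..<(Suc n)^2} (\<lambda>_. borel :: real measure)) (\<lambda>z. \<forall>k\<le>(Suc n)^2. fst z + (\<Sum>j<k. snd z j) \<notin> {a..a + 2})"
      by (simp add: atMost_def)
    show ?thesis unfolding H_def[abs_def] P_def by measurable
  qed
  have sumW: "(\<Sum>j<k. W n s \<omega> j) = X (s + real k / real (Suc n)) \<omega> - X s \<omega>" if "k \<le> (Suc n)^2" for k n s \<omega>
  proof -
    have "(\<Sum>j<k. W n s \<omega> j) = (\<Sum>j<k. X (s + 1 / real (Suc n) * real (Suc j)) \<omega> - X (s + 1 / real (Suc n) * real j) \<omega>)"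
      unfolding W_def using that by (intro sum.cong) auto
    also have "\<dots> = X (s + 1 / real (Suc n) * real k) \<omega> - X (s + 1 / real (Suc n) * real 0) \<omega>"
      by (rule sum_lessThan_telescope)
    finally show ?thesis by simp
  qed
  have PW: "P n x (W n s \<omega>) \<longleftrightarrow> x < a \<and> (\<forall>k\<le>(Suc n)^2. x - X s \<omega> + X (s + real k / real (Suc n)) \<omega> \<notin> {a..a + 2})" for n x s \<omega>
    unfolding P_def by (auto simp: sumW algebra_simps)
  have HW: "(\<lambda>\<omega>. H n (x, W n s \<omega>)) \<in> borel_measurable M" for n x s by measurable
  have H_le: "H n z \<le> 1" for n z by (simp add: H_def)
  define u where "u n x = (\<integral>\<^sup>+\<omega>. H n (x, W n 0 \<omega>) \<partial>M)" for n x
  have u_meas [measurable]: "u n \<in> borel_measurable borel" for n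
    unfolding u_def[abs_def] by measurable
  \<comment> \<open>A fresh copy started at x < a has to pass the level a - x, so
    \<open>prob_passage\<close> identifies the limit.\<close>
  have u_lim: "(\<lambda>n. u n x) \<longlonglongrightarrow> indicator {y. y < a} x * ennreal (h_inv \<alpha> (x - 1 - a))" for x
  proof (cases "x < a")
    case True
    then have b: "0 < a - x" by simp
    have "(\<lambda>n. u n x) \<longlonglongrightarrow> (\<integral>\<^sup>+\<omega>. indicator {v. a - x + 2 < v} (passage (a - x) \<omega>) \<partial>M)"
      unfolding u_def
    proof (rule nn_integral_dominated_convergence[where w = "\<lambda>_. 1"])
      show "AE \<omega> in M. (\<lambda>n. H n (x, W n 0 \<omega>)) \<longlonglongrightarrow> indicator {v. a - x + 2 < v} (passage (a - x) \<omega>)"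
      proof -
        have "AE \<omega> in M. x + X 0 \<omega> < a \<longrightarrow> passage (a - x) \<omega> \<noteq> a - x + 2"
          using prob_passage(2)[OF b] by eventually_elim simp
        from AE_grid_avoids_eventually_iff[OF order_refl this b] AE_regular show ?thesis
        proof eventually_elim
          case (elim \<omega>)
          then have "\<forall>\<^sub>F n in sequentially. (\<forall>k\<le>(Suc n)^2. x + X (0 + real k / real (Suc n)) \<omega> \<notin> {a..a + 2}) \<longleftrightarrow> a - x + 2 < passage (a - x) \<omega>"
            using True by simp
          then have "\<forall>\<^sub>F n in sequentially. H n (x, W n 0 \<omega>) = indicator {v. a - x + 2 < v} (passage (a - x) \<omega>)"
          proof eventually_elim
            case e: (elim n)
            show ?case unfolding H_def fst_conv snd_conv PW using e elim(2) True by (simp add: indicator_def)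
          qed
          then show ?case by (rule tendsto_eventually)
        qed
      qed
    qed (use HW H_le in \<open>auto simp: emeasure_space_1\<close>)
    also have "(\<integral>\<^sup>+\<omega>. indicator {v. a - x + 2 < v} (passage (a - x) \<omega>) \<partial>M) =
        (\<integral>\<^sup>+\<omega>. indicator {\<omega> \<in> space M. a - x + 2 < passage (a - x) \<omega>} \<omega> \<partial>M)"
      by (intro nn_integral_cong) (simp add: indicator_def)
    also have "\<dots> = emeasure M {\<omega> \<in> space M. a - x + 2 < passage (a - x) \<omega>}"
      by (rule nn_integral_indicator) measurable
    also have "\<dots> = ennreal (h_inv \<alpha> (x - 1 - a))"
      using prob_passage(1)[OF b] by (simp add: emeasure_eq_measure algebra_simps)
    finally show ?thesis using True by simp
  next
    case False
    then show ?thesis by (simp add: u_def H_def P_def)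
  qed
  define h where "h x = indicator {y. y < a} x * ennreal (h_inv \<alpha> (x - 1 - a))" for x
  \<comment> \<open>Borel measurability of \<open>h\<close> is inherited from its approximations
    \<open>u n\<close>.\<close>
  have h_meas [measurable]: "h \<in> borel_measurable borel"
    using u_lim by (intro borel_measurable_LIMSEQ_order[of borel u h]) (auto simp: h_def)
  show "(\<lambda>\<omega>. indicator {y. y < a} (X t \<omega>) * ennreal (h_inv \<alpha> (X t \<omega> - 1 - a))) \<in> borel_measurable M"
    using measurable_compose[OF X_measurable h_meas] by (simp add: h_def)
  have u_le: "u n x \<le> 1" for n x
  proof -
    have "u n x \<le> (\<integral>\<^sup>+\<omega>. 1 \<partial>M)" unfolding u_def by (intro nn_integral_mono) (simp add: H_def)
    then show ?thesis by (simp add: emeasure_space_1)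
  qed
  have "(\<lambda>n. \<integral>\<^sup>+\<omega>. u n (X t \<omega>) \<partial>M) \<longlonglongrightarrow> (\<integral>\<^sup>+\<omega>. h (X t \<omega>) \<partial>M)"
    by (rule nn_integral_dominated_convergence[where w = "\<lambda>_. 1"])
      (use u_le u_lim[folded h_def] in \<open>auto simp: emeasure_space_1\<close>)
  moreover have "(\<lambda>n. \<integral>\<^sup>+\<omega>. H n (X t \<omega>, W n t \<omega>) \<partial>M) \<longlonglongrightarrow>
      (\<integral>\<^sup>+\<omega>. indicator {y. y < a} (X t \<omega>) * indicator {v. a + 2 < v} (passage a \<omega>) \<partial>M)"
  proof (rule nn_integral_dominated_convergence[where w = "\<lambda>_. 1"])
    have "AE \<omega> in M. 0 + X t \<omega> < a \<longrightarrow> passage (a - 0) \<omega> \<noteq> a - 0 + 2"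
      using prob_passage(2)[OF a] by eventually_elim simp
    from AE_grid_avoids_eventually_iff[OF t this] a
    have "AE \<omega> in M. X t \<omega> < a \<longrightarrow> (\<forall>\<^sub>F n in sequentially.
        (\<forall>k\<le>(Suc n)^2. X (t + real k / real (Suc n)) \<omega> \<notin> {a..a + 2}) \<longleftrightarrow> a + 2 < passage a \<omega>)" by simp
    then show "AE \<omega> in M. (\<lambda>n. H n (X t \<omega>, W n t \<omega>)) \<longlonglongrightarrow>
        indicator {y. y < a} (X t \<omega>) * indicator {v. a + 2 < v} (passage a \<omega>)"
    proof eventually_elim
      case (elim \<omega>)
      show ?case
      proof (cases "X t \<omega> < a")
        case True
        with elim have "\<forall>\<^sub>F n in sequentially.
          (\<forall>k\<le>(Suc n)^2. X (t + real k / real (Suc n)) \<omega> \<notin> {a..a + 2}) \<longleftrightarrow> a + 2 < passage a \<omega>" by blast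
        then have "\<forall>\<^sub>F n in sequentially. H n (X t \<omega>, W n t \<omega>) =
          indicator {y. y < a} (X t \<omega>) * indicator {v. a + 2 < v} (passage a \<omega>)"
        proof eventually_elim
          case e: (elim n)
          show ?case unfolding H_def fst_conv snd_conv PW using e True by (simp add: indicator_def)
        qed
        then show ?thesis by (rule tendsto_eventually)
      next
        case False
        then show ?thesis by (simp add: H_def P_def)
      qed
    qed
  qed (use H_le in \<open>auto simp: emeasure_space_1\<close>)
  moreover have "(\<integral>\<^sup>+\<omega>. H n (X t \<omega>, W n t \<omega>) \<partial>M) = (\<integral>\<^sup>+\<omega>. u n (X t \<omega>) \<partial>M)" for n
    using nn_integral_markov[OF H_meas t, of "1 / real (Suc n)" n] unfolding u_def W_def by (simp only: add_0) simp
  ultimately show "(\<integral>\<^sup>+\<omega>. indicator {y. y < a} (X t \<omega>) * ennreal (h_inv \<alpha> (X t \<omega> - 1 - a)) \<partial>M) =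
      (\<integral>\<^sup>+\<omega>. indicator {y. y < a} (X t \<omega>) * indicator {v. a + 2 < v} (passage a \<omega>) \<partial>M)"
    by (simp add: h_def LIMSEQ_unique)
qed

text \<open>A passage beyond a + 2 leaves the hitting set empty, with infimum \<infinity>. Otherwise
  the infimum is attained at the passage time, which exceeds \<open>t\<close> exactly when X t <
  a.\<close>

lemma less_hit_time_iff:
  assumes path: "subordinator_path (\<lambda>s. X s \<omega>)" and x: "x < -1" and t: "0 \<le> t"
  shows "ereal t < hit_time X x \<omega> \<longleftrightarrow> X t \<omega> < - 1 - x \<or> (- 1 - x) + 2 < passage (- 1 - x) \<omega>"
proof -
  define a where "a = - 1 - x"
  have a: "0 < a" using x by (simp add: a_def)
  define S where "S = {s. 0 \<le> s \<and> x + X s \<omega> \<in> {-1..1}}"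
  have S: "s \<in> S \<longleftrightarrow> 0 \<le> s \<and> a \<le> X s \<omega> \<and> X s \<omega> \<le> a + 2" for s
    by (auto simp: S_def a_def)
  let ?T = "passage_time (\<lambda>s. X s \<omega>) a"
  have V: "passage a \<omega> = X ?T \<omega>" using passage_eq[OF path a] by (simp add: passage_value_def)
  have T0: "0 \<le> ?T" by (rule passage_time_nonneg[OF path])
  have hit: "hit_time X x \<omega> = Inf (ereal ` S)" by (simp add: hit_time_def S_def)
  show ?thesis unfolding a_def[symmetric]
  proof (cases "a + 2 < passage a \<omega>")
    case True
    then have "S = {}" using passage_value_le[OF path, of _ a] passage_eq[OF path a] S by force
    then show "ereal t < hit_time X x \<omega> \<longleftrightarrow> X t \<omega> < a \<or> a + 2 < passage a \<omega>"
      using True by (simp add: hit top_ereal_def)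
  next
    case False
    have TS: "?T \<in> S"
      unfolding S using T0 False V le_passage_value[OF path, of a] by (simp add: passage_value_def)
    have lb: "?T \<le> s" if "s \<in> S" for s using that S passage_time_le[OF path] by blast
    have "hit_time X x \<omega> = ereal ?T"
      unfolding hit
    proof (rule antisym)
      show "Inf (ereal ` S) \<le> ereal ?T" using TS by (intro Inf_lower) auto
      show "ereal ?T \<le> Inf (ereal ` S)" using lb by (intro Inf_greatest) auto
    qed
    then show "ereal t < hit_time X x \<omega> \<longleftrightarrow> X t \<omega> < a \<or> a + 2 < passage a \<omega>"
      using False le_path_iff[OF path t, of a] by auto
  qed
qed

text \<open>Surviving at \<open>t\<close> with X t \<ge> a means having jumped over the interval,
  where \<open>h_inv\<close> is 1; below \<open>a\<close> the integral gives the probability of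
  jumping over it later. Together they make up the event of a passage beyond a + 2, whatever
  \<open>t\<close> is.\<close>

lemma h_inv_invariant_left:
  assumes x: "x < -1" and t: "0 \<le> t"
  shows "(\<integral>\<^sup>+\<omega>. ennreal (indicator {\<omega>. ereal t < hit_time X x \<omega>} \<omega> * h_inv \<alpha> (x + X t \<omega>)) \<partial>M) = ennreal (h_inv \<alpha> x)"
proof -
  define a where "a = - 1 - x"
  have a: "0 < a" using x by (simp add: a_def)
  have xa: "x + X t \<omega> = X t \<omega> - 1 - a" for \<omega> by (simp add: a_def)
  let ?A = "\<lambda>\<omega>. indicator {y. y < a} (X t \<omega>) * ennreal (h_inv \<alpha> (X t \<omega> - 1 - a))"
  let ?B = "\<lambda>\<omega>. indicator {y. a \<le> y} (X t \<omega>) * indicator {v. a + 2 < v} (passage a \<omega>) :: ennreal"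
  let ?C = "\<lambda>\<omega>. indicator {y. y < a} (X t \<omega>) * indicator {v. a + 2 < v} (passage a \<omega>) :: ennreal"
  have "(\<integral>\<^sup>+\<omega>. ennreal (indicator {\<omega>. ereal t < hit_time X x \<omega>} \<omega> * h_inv \<alpha> (x + X t \<omega>)) \<partial>M) = (\<integral>\<^sup>+\<omega>. ?A \<omega> + ?B \<omega> \<partial>M)"
  proof (rule nn_integral_cong_AE)
    show "AE \<omega> in M. ennreal (indicator {\<omega>. ereal t < hit_time X x \<omega>} \<omega> * h_inv \<alpha> (x + X t \<omega>)) = ?A \<omega> + ?B \<omega>"
      using AE_path
    proof eventually_elim
      case (elim \<omega>)
      have "h_inv \<alpha> (x + X t \<omega>) = 1" if "a \<le> X t \<omega>" "a + 2 < passage a \<omega>"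
      proof -
        \<comment> \<open>Once at or above \<open>a\<close>, the path is at least its passage value,
          hence beyond the interval.\<close>
        have "passage a \<omega> \<le> X t \<omega>" using passage_value_le[OF elim t that(1)] passage_eq[OF elim a] by simp
        then show ?thesis using that by (simp add: h_inv_def a_def)
      qed
      moreover have "ereal t < hit_time X x \<omega> \<longleftrightarrow> X t \<omega> < a \<or> a + 2 < passage a \<omega>"
        unfolding a_def by (rule less_hit_time_iff[OF elim x t])
      ultimately show ?case
        unfolding xa by (cases "X t \<omega> < a"; cases "a + 2 < passage a \<omega>") (simp_all add: indicator_def)
    qed
  qed
  also have "\<dots> = (\<integral>\<^sup>+\<omega>. ?A \<omega> \<partial>M) + (\<integral>\<^sup>+\<omega>. ?B \<omega> \<partial>M)"
    by (rule nn_integral_add[OF nn_integral_killed_markov(1)[OF a t]]) measurable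
  also have "\<dots> = (\<integral>\<^sup>+\<omega>. ?C \<omega> \<partial>M) + (\<integral>\<^sup>+\<omega>. ?B \<omega> \<partial>M)"
    by (simp only: nn_integral_killed_markov(2)[OF a t])
  also have "\<dots> = (\<integral>\<^sup>+\<omega>. ?C \<omega> + ?B \<omega> \<partial>M)"
    by (rule nn_integral_add[symmetric]) measurable
  also have "\<dots> = (\<integral>\<^sup>+\<omega>. indicator {\<omega> \<in> space M. a + 2 < passage a \<omega>} \<omega> \<partial>M)"
    by (intro nn_integral_cong) (auto simp: indicator_def)
  also have "\<dots> = ennreal (prob {\<omega> \<in> space M. a + 2 < passage a \<omega>})"
    by (simp add: emeasure_eq_measure)
  also have "\<dots> = ennreal (h_inv \<alpha> x)" using prob_passage(1)[OF a] by (simp add: a_def)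
  finally show ?thesis .
qed

end

section \<open>Invariance in the cases x > 1, zero process, and x < -1 with positive rate\<close>

theorem theorem2p1:
  fixes M :: "'a measure" and X :: "real \<Rightarrow> 'a \<Rightarrow> real" and \<alpha> x t :: real
  assumes "0 < \<alpha>" and "\<alpha> < 1"
    and "stable_process M \<alpha> X"
    and "no_negative_jumps M X"
    and "x \<notin> {-1..1}"
    and "0 \<le> t"
  shows "(\<integral>\<^sup>+ \<omega>. ennreal (indicator {\<omega>. ereal t < hit_time X x \<omega>} \<omega> * h_inv \<alpha> (x + X t \<omega>)) \<partial>M)
         = ennreal (h_inv \<alpha> x)"
proof -
  have "prob_space M" using assms(3) by (simp add: stable_process_def levy_process_def)
  then interpret prob_space M .
  interpret stable_no_neg_jumps M X \<alpha>
    by unfold_locales (use assms in auto)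
  \<comment> \<open>Covers the cases in which the interval is never hit and \<open>h_inv\<close> is
    constant along the path: a nondecreasing path from x > 1 stays above 1, and the zero process
    stays at x.\<close>
  have const: ?thesis
    if "AE \<omega> in M. hit_time X x \<omega> = \<infinity> \<and> h_inv \<alpha> (x + X t \<omega>) = h_inv \<alpha> x"
  proof -
    have "(\<integral>\<^sup>+ \<omega>. ennreal (indicator {\<omega>. ereal t < hit_time X x \<omega>} \<omega> * h_inv \<alpha> (x + X t \<omega>)) \<partial>M) =
        (\<integral>\<^sup>+ \<omega>. ennreal (h_inv \<alpha> x) \<partial>M)"
      using that by (intro nn_integral_cong_AE, eventually_elim) simp
    then show ?thesis by (simp add: emeasure_space_1)
  qed
  consider "1 < x" | "x < -1" "rate = 0" | "x < -1" "0 < rate"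
    using assms(5) rate_nonneg by fastforce
  then show ?thesis
  proof cases
    case 1
    show ?thesis
    proof (rule const)
      show "AE \<omega> in M. hit_time X x \<omega> = \<infinity> \<and> h_inv \<alpha> (x + X t \<omega>) = h_inv \<alpha> x"
        using AE_regular AE_mono
      proof eventually_elim
        case (elim \<omega>)
        have nonneg: "0 \<le> X s \<omega>" if "0 \<le> s" for s
          using mono_onD[OF elim(2), of 0 s] elim(1) that by simp
        have empty: "{s. 0 \<le> s \<and> x + X s \<omega> \<in> {-1..1}} = {}"
          using nonneg 1 by force
        have "hit_time X x \<omega> = \<infinity>" unfolding hit_time_def empty by (simp add: top_ereal_def)
        then show ?case using 1 nonneg[OF assms(6)] by (simp add: h_inv_def)
      qed
    qed
  next
    case 2
    show ?thesis
    proof (rule const)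
      show "AE \<omega> in M. hit_time X x \<omega> = \<infinity> \<and> h_inv \<alpha> (x + X t \<omega>) = h_inv \<alpha> x"
        using AE_zero_if_rate_zero[OF 2(2)]
      proof eventually_elim
        case (elim \<omega>)
        have empty: "{s. 0 \<le> s \<and> x + X s \<omega> \<in> {-1..1}} = {}"
          using elim 2(1) by auto
        have "hit_time X x \<omega> = \<infinity>" unfolding hit_time_def empty by (simp add: top_ereal_def)
        then show ?case using elim assms(6) by simp
      qed
    qed
  next
    case 3
    interpret nontrivial_stable M X \<alpha> by unfold_locales (rule 3(2))
    show ?thesis by (rule h_inv_invariant_left[OF 3(1) assms(6)])
  qed
qed

end
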